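(* Consider $\dot{\vec{x}}=\vec{f}(\vec{x})+\epsilon\,\vec{g}(\vec{x},t)$ on $\Omega\subset\mathbb{R}^3$, with $0<\epsilon\ll1$, under the standing assumptions listed in the context, with two-dimensional heteroclinic manifold $\Gamma$ for $\epsilon=0$ parametrized by $\bar{\vec x}(p,\alpha)$. Suppose $\vec g$ is harmonic, i.e. $\vec g(\vec x,t)=\tilde{\vec g}(\vec x)\cos[\omega t+\phi]$ with $\tilde{\vec g}$, $D\tilde{\vec g}$ bounded and constants $\omega>0$ and $\phi$, and suppose the unperturbed flow is volume-preserving, i.e. $\nabla\cdot\vec f=0$. Let $$h(\alpha,\tau):=\left[\vec{f}(\bar{\vec{x}}(\tau,\alpha))\wedge\bar{\vec{x}}_{\alpha}(\tau,\alpha)\right]\cdot\tilde{\vec g}(\bar{\vec{x}}(\tau,\alpha)).$$ Then, at each fixed time $t$, each and every one of the lobes $L_k$, $k\in\mathbb{Z}$ (defined in the context), has volume $$\mathrm{Volume}(L_k)=\frac{2\epsilon}{\omega}\int_0^1\left|\mathcal{F}\{h(\alpha,\cdot)\}(\omega)\right|\,\mathrm{d}\alpha+\mathcal{O}(\epsilon^2).$$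
   Context: Here $\wedge$ is the cross product in $\mathbb{R}^3$, a subscript $\alpha$ denotes $\partial/\partial\alpha$, and $\mathrm{S}^1=[0,1)$ extended periodically with period $1$. $\mathcal{O}(\cdot)$ refers to $\epsilon\to0$. The Fourier transform of $H\in L^1(\mathbb{R})$ is $\mathcal{F}\{H(\tau)\}(\omega):=\int_{-\infty}^\infty e^{i\omega\tau}H(\tau)\,\mathrm{d}\tau$; $\mathcal{F}\{h(\alpha,\cdot)\}$ is taken with respect to $\tau$. Standing assumptions. $\vec f:\Omega\to\mathbb{R}^3$ is $C^2$ with $D\vec f$ bounded on $\Omega$. For each $t\in\mathbb{R}$, $\vec g(\cdot,t)\in C^2(\Omega)$, and $\vec g$, $D\vec g$ (spatial derivative) are bounded on $\Omega\times\mathbb{R}$. $\vec a\ne\vec b$ are fixed points of $\dot{\vec x}=\vec f(\vec x)$; $D\vec f(\vec a)$ has one negative eigenvalue and two eigenvalues with positive real parts, $D\vec f(\vec b)$ has one positive eigenvalue and two eigenvalues with negative real parts, and in each case the eigenvectors associated with the two-dimensional (unstable, resp. stable) subspace are linearly independent. The two-dimensional unstable manifold of $\vec a$ and the two-dimensional stable manifold of $\vec b$ are $C^2$-smooth and coincide to form a two-dimensional orientable heteroclinic manifold $\Gamma$, a closed surface (together with $\vec a,\vec b$) separating an inside from an outside. Parametrization. $\Gamma$ is foliated by heteroclinic trajectories labelled by $\alpha\in\mathrm{S}^1$, with $p\in\mathbb{R}$ the time along the trajectory: $\partial_p\bar{\vec x}(p,\alpha)=\vec f(\bar{\vec x}(p,\alpha))$,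 $\lim_{p\to-\infty}\bar{\vec x}(p,\alpha)=\vec a$, $\lim_{p\to\infty}\bar{\vec x}(p,\alpha)=\vec b$. The parametrization $(p,\alpha)\in\mathbb{R}\times\mathrm{S}^1$ is $C^2$-smooth, and $\vec f(\bar{\vec x}(p,\alpha))\wedge\bar{\vec x}_\alpha(p,\alpha)$ is nonzero and points outward from $\Gamma$; $\hat{\vec n}(p,\alpha)$ denotes its normalization. Melnikov functions (with $\nabla\cdot\vec f=0$). Put $I(\tau)=[\vec f(\bar{\vec x}(\tau,\alpha))\wedge\bar{\vec x}_\alpha(\tau,\alpha)]\cdot\vec g(\bar{\vec x}(\tau,\alpha),\tau+t-p)$, and $M^u(p,\alpha,t)=\int_{-\infty}^pI(\tau)\,\mathrm{d}\tau$, $M^s(p,\alpha,t)=-\int_p^\infty I(\tau)\,\mathrm{d}\tau$, $M=M^u-M^s$. To leading order, the perturbed unstable manifold of (the continuation of) $\vec a$ and the perturbed stable manifold of (the continuation of) $\vec b$ at time $t$ lie at signed distances $\epsilon M^u/|\vec f(\bar{\vec x})\wedge\bar{\vec x}_\alpha|$ and $\epsilon M^s/|\vec f(\bar{\vec x})\wedge\bar{\vec x}_\alpha|$ from $\bar{\vec x}(p,\alpha)$ along $\hat{\vec n}(p,\alpha)$. In the harmonic volume-preserving case, $M(p,\alpha,t)=|\mathcal{F}\{h(\alpha,\cdot)\}(\omega)|\cos[\omega(t-p)+\phi+\arg(\mathcal{F}\{h(\alpha,\cdot)\}(\omega))]$. Lobes. It is assumed that $\mathcal{F}\{h(\alpha,\cdot)\}(\omega)$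 is not identically zero and that, for each $k\in\mathbb{Z}$, the zeros of $M$ $$p=\tilde p(\alpha,k)=\frac1\omega\left[\arg\left(\mathcal{F}\{h(\alpha,\cdot)\}(\omega)\right)-\frac{\pi(2k+1)}{2}+\omega t+\phi\right],\qquad\alpha\in\mathrm{S}^1,$$ define a curve going across all $\alpha\in\mathrm{S}^1$ (a closed ring on $\Gamma$). At fixed $t$, the lobe $L_k$, flanked by the adjacent curves $p=\tilde p(\alpha,k-1)$ and $p=\tilde p(\alpha,k)$ and lying between the perturbed stable and unstable manifolds, is (to leading order in $\epsilon$) $$L_k=\left\{\bar{\vec x}(p,\alpha)+\frac{\epsilon\left[sM^u(p,\alpha,t)+(1-s)M^s(p,\alpha,t)\right]\hat{\vec n}(p,\alpha)}{\left|\vec f(\bar{\vec x}(p,\alpha))\wedge\bar{\vec x}_\alpha(p,\alpha)\right|}:\ \alpha\in\mathrm{S}^1,\ p\text{ between }\tilde p(\alpha,k-1)\text{ and }\tilde p(\alpha,k),\ s\in[0,1]\right\}.$$ *)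

theory Defs
  imports "HOL-Analysis.Analysis" "HOL-Library.Landau_Symbols"
begin

(* Intended for open S: the derivatives are two-sided at every point of S. *)
definition C2_on :: "'a::real_normed_vector set \<Rightarrow> ('a \<Rightarrow> 'b::real_normed_vector) \<Rightarrow> bool" where
  "C2_on S f \<longleftrightarrow>
     (\<exists>(f' :: 'a \<Rightarrow> 'a \<Rightarrow>\<^sub>L 'b) (f'' :: 'a \<Rightarrow> 'a \<Rightarrow>\<^sub>L ('a \<Rightarrow>\<^sub>L 'b)).
        (\<forall>x\<in>S. (f has_derivative blinfun_apply (f' x)) (at x)) \<and>
        (\<forall>x\<in>S. (f' has_derivative blinfun_apply (f'' x)) (at x)) \<and>
        continuous_on S f'')"

definition divergence :: "(real^3 \<Rightarrow> real^3) \<Rightarrow> real^3 \<Rightarrow> real" where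
  "divergence f x = trace (jacobian f (at x))"

(* The eigenvalues of A, counted with algebraic multiplicity, are l0, l1, l2; moreover l1 and l2
   (which may coincide or be complex conjugates) have eigenvectors independent over the complex
   numbers. *)
definition saddle_spectrum :: "real^3^3 \<Rightarrow> real \<Rightarrow> complex \<Rightarrow> complex \<Rightarrow> bool" where
  "saddle_spectrum A l0 l1 l2 \<longleftrightarrow>
     (let B = map_matrix complex_of_real A in
        (\<forall>z. det (mat z - B) = (z - complex_of_real l0) * (z - l1) * (z - l2)) \<and>
        (\<exists>v1 v2. B *v v1 = l1 *s v1 \<and> B *v v2 = l2 *s v2 \<and>
                 v1 \<noteq> v2 \<and> vec.independent {v1, v2}))"

definition unstable_manifold :: "(real^3) set \<Rightarrow> (real^3 \<Rightarrow> real^3) \<Rightarrow> real^3 \<Rightarrow> (real^3) set" where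
  "unstable_manifold \<Omega> f a =
     {x. \<exists>y. y 0 = x \<and>
             (\<forall>s\<le>0. y s \<in> \<Omega> \<and> (y has_vector_derivative f (y s)) (at s within {..0})) \<and>
             (y \<longlongrightarrow> a) at_bot}"

definition stable_manifold :: "(real^3) set \<Rightarrow> (real^3 \<Rightarrow> real^3) \<Rightarrow> real^3 \<Rightarrow> (real^3) set" where
  "stable_manifold \<Omega> f b =
     {x. \<exists>y. y 0 = x \<and>
             (\<forall>s\<ge>0. y s \<in> \<Omega> \<and> (y has_vector_derivative f (y s)) (at s within {0..})) \<and>
             (y \<longlongrightarrow> b) at_top}"

(* Embedded two-dimensional C^2 submanifold without boundary, as a local regular level set. *)
definition C2_surface :: "(real^3) set \<Rightarrow> bool" where
  "C2_surface S \<longleftrightarrow>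
     (\<forall>x\<in>S. \<exists>U (F :: real^3 \<Rightarrow> real).
        open U \<and> x \<in> U \<and> C2_on U F \<and>
        (\<forall>y\<in>U. frechet_derivative F (at y) \<noteq> (\<lambda>_. 0)) \<and>
        S \<inter> U = {y \<in> U. F y = 0})"

definition tangent_vectors :: "(real^3) set \<Rightarrow> real^3 \<Rightarrow> (real^3) set" where
  "tangent_vectors S x =
     {v. \<exists>c. c 0 = x \<and> range c \<subseteq> S \<and> (c has_vector_derivative v) (at (0::real))}"

definition orientable_surface :: "(real^3) set \<Rightarrow> bool" where
  "orientable_surface S \<longleftrightarrow>
     C2_surface S \<and>
     (\<exists>\<nu>. continuous_on S \<nu> \<and>
          (\<forall>x\<in>S. norm (\<nu> x) = 1 \<and> (\<forall>v\<in>tangent_vectors S x. \<nu> x \<bullet> v = 0)))"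

definition fourier :: "(real \<Rightarrow> real) \<Rightarrow> real \<Rightarrow> complex" where
  "fourier H \<omega> = (LINT \<tau>|lborel. exp (\<i> * of_real (\<omega> * \<tau>)) * of_real (H \<tau>))"

(* Throughout, X p \<alpha> is the parametrization, p the time along the trajectory labelled \<alpha>. *)

definition surface_normal ::
  "(real^3 \<Rightarrow> real^3) \<Rightarrow> (real \<Rightarrow> real \<Rightarrow> real^3) \<Rightarrow> real \<Rightarrow> real \<Rightarrow> real^3" where
  "surface_normal f X p \<alpha> = cross3 (f (X p \<alpha>)) (vector_derivative (\<lambda>\<beta>. X p \<beta>) (at \<alpha>))"

definition unit_normal ::
  "(real^3 \<Rightarrow> real^3) \<Rightarrow> (real \<Rightarrow> real \<Rightarrow> real^3) \<Rightarrow> real \<Rightarrow> real \<Rightarrow> real^3" where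
  "unit_normal f X p \<alpha> = surface_normal f X p \<alpha> /\<^sub>R norm (surface_normal f X p \<alpha>)"

definition melnikov_integrand ::
  "(real^3 \<Rightarrow> real^3) \<Rightarrow> (real^3 \<Rightarrow> real \<Rightarrow> real^3) \<Rightarrow> (real \<Rightarrow> real \<Rightarrow> real^3) \<Rightarrow>
     real \<Rightarrow> real \<Rightarrow> real \<Rightarrow> real \<Rightarrow> real" where
  "melnikov_integrand f g X p \<alpha> t \<tau> = surface_normal f X \<tau> \<alpha> \<bullet> g (X \<tau> \<alpha>) (\<tau> + t - p)"

definition melnikov_u ::
  "(real^3 \<Rightarrow> real^3) \<Rightarrow> (real^3 \<Rightarrow> real \<Rightarrow> real^3) \<Rightarrow> (real \<Rightarrow> real \<Rightarrow> real^3) \<Rightarrow>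
     real \<Rightarrow> real \<Rightarrow> real \<Rightarrow> real" where
  "melnikov_u f g X p \<alpha> t = (LINT \<tau>:{..p}|lborel. melnikov_integrand f g X p \<alpha> t \<tau>)"

definition melnikov_s ::
  "(real^3 \<Rightarrow> real^3) \<Rightarrow> (real^3 \<Rightarrow> real \<Rightarrow> real^3) \<Rightarrow> (real \<Rightarrow> real \<Rightarrow> real^3) \<Rightarrow>
     real \<Rightarrow> real \<Rightarrow> real \<Rightarrow> real" where
  "melnikov_s f g X p \<alpha> t = - (LINT \<tau>:{p..}|lborel. melnikov_integrand f g X p \<alpha> t \<tau>)"

definition melnikov_amplitude ::
  "(real^3 \<Rightarrow> real^3) \<Rightarrow> (real^3 \<Rightarrow> real^3) \<Rightarrow> (real \<Rightarrow> real \<Rightarrow> real^3) \<Rightarrow> real \<Rightarrow> real \<Rightarrow> real" where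
  "melnikov_amplitude f gt X \<alpha> \<tau> = surface_normal f X \<tau> \<alpha> \<bullet> gt (X \<tau> \<alpha>)"

(* Zeros of the Melnikov function; \<theta> \<alpha> is an argument of the Fourier transform at \<alpha>. *)
definition melnikov_zero ::
  "real \<Rightarrow> real \<Rightarrow> (real \<Rightarrow> real) \<Rightarrow> real \<Rightarrow> real \<Rightarrow> int \<Rightarrow> real" where
  "melnikov_zero \<omega> \<phi> \<theta> t \<alpha> k = (\<theta> \<alpha> - pi * (2 * of_int k + 1) / 2 + \<omega> * t + \<phi>) / \<omega>"

definition lobe ::
  "(real^3 \<Rightarrow> real^3) \<Rightarrow> (real^3 \<Rightarrow> real \<Rightarrow> real^3) \<Rightarrow> (real \<Rightarrow> real \<Rightarrow> real^3) \<Rightarrow>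
     real \<Rightarrow> real \<Rightarrow> (real \<Rightarrow> real) \<Rightarrow> real \<Rightarrow> int \<Rightarrow> real \<Rightarrow> (real^3) set" where
  "lobe f g X \<omega> \<phi> \<theta> t k \<epsilon> =
     {X p \<alpha> + ((\<epsilon> * (s * melnikov_u f g X p \<alpha> t + (1 - s) * melnikov_s f g X p \<alpha> t))
                 / norm (surface_normal f X p \<alpha>)) *\<^sub>R unit_normal f X p \<alpha>
      | p \<alpha> s. \<alpha> \<in> {0..<1} \<and>
               p \<in> closed_segment (melnikov_zero \<omega> \<phi> \<theta> t \<alpha> (k - 1)) (melnikov_zero \<omega> \<phi> \<theta> t \<alpha> k) \<and>
               s \<in> {0..1}}"

end

(* In the tubular coordinates (p, alpha, r) -> x(p, alpha) + r n(p, alpha) around the heteroclinic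
   manifold, whose Jacobian is |N| + O(r) with N = f(x) \<and> x_alpha, the lobe is the region where
   (p, alpha) lies between two zero curves of M and r lies between eps M^s / |N| and eps M^u / |N|.
   Its volume is therefore the integral of eps |M| up to O(eps^2), and |M| = |F h| |cos| integrates to
   2 |F h| / omega over each half period. Since r enters as a coordinate, M^u and M^s only have to be
   measurable and bounded, uniformly in alpha.

   The uniform bound is the exponential decay of N as p -> -oo and p -> oo. As div f = 0, N' = - Df(x)^T N.
   Near a the unstable manifold is {F = 0}, so N is a multiple of grad F(x), and with m = grad F(a) the
   component psi = N . m satisfies psi' = kappa(x) psi, kappa(a) = - (m . Df(a) m) / |m|^2. Here
   kappa(a) = 0 would force Df(a)^T m = 0, which the spectrum excludes, and kappa(a) < 0 would make
   |psi| bounded below as p -> -oo, giving the surface infinite area near a. The end at b is the same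
   statement for the reversed flow. *)
theory Submission
  imports Defs
begin

text \<open>Two difficulties lie behind the overview. First, |N| <= C exp(-c |p|) must hold with one
  C for all labels, so all trajectories must enter a ball around the saddle before a common time.
  Pointwise limits of X(p, \<alpha>) do not give this; compactness of the closed surface does,
  together with the fact that each of its points other than \<open>a\<close> tends to
  \<open>b\<close> in forward time. Second, the sign of kappa(a) is found by contradiction, without
  first identifying the tangent plane at the saddle with an eigenspace: writing N = psi zeta(x), the
  direction zeta(x) converges to m / |m|^2, so a limit of its time derivative must be zero; and a
  lower bound on |psi| would place strips of the surface, thickened along m and of unbounded volume,
  injectively into one ball. In the volume estimate (p, \<alpha>) stays in a compact set, because
  theta is continuous and the labels form a circle. There the tubular map is injective for small r
  and |N| is bounded below. A Jacobian error of order eps is integrated over a set of volume of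
  order eps, which is the origin of O(eps^2).\<close>

section \<open>The normal field near a saddle\<close>

text \<open>This is the derivative of det(u, v, w) when all columns move under \<open>A\<close>: the
  three determinants with one column replaced by its image add up to the trace times det(u, v, w).
  With trace zero it gives the adjoint equation for the normal.\<close>

lemma cross3_linear_trace:
  fixes A :: "real^3 \<Rightarrow> real^3"
  assumes "linear A"
  shows "(cross3 (A u) v + cross3 u (A v)) \<bullet> w = trace (matrix A) * (cross3 u v \<bullet> w) - cross3 u v \<bullet> A w"
proof -
  have B: "A = (*v) (matrix A)"
    using matrix_vector_mul(2)[OF assms] by simp
  define B where "B = matrix A"
  have A: "A x $ i = B $ i $ 1 * x $ 1 + B $ i $ 2 * x $ 2 + B $ i $ 3 * x $ 3" for x i
    by (subst B) (simp add: matrix_vector_mult_def sum_3 B_def)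
  show ?thesis
    by (simp only: inner_vec_def sum_3 inner_real_def vector_add_component cross_components A trace_def B_def[symmetric]) algebra
qed

text \<open>Since \<open>u\<close> and \<open>v\<close> are orthogonal to \<open>g\<close>, the
  product of \<open>g\<close> with their cross product vanishes; applying \<open>cross3 g\<close>
  once more and expanding gives the claim. The factor \<open>g \<bullet> g\<close> avoids a
  division.\<close>

lemma cross3_parallel_common_normal:
  fixes g u v :: "real^3"
  assumes "g \<bullet> u = 0" "g \<bullet> v = 0"
  shows "(g \<bullet> g) *\<^sub>R cross3 u v = (cross3 u v \<bullet> g) *\<^sub>R g"
proof -
  have "cross3 g (cross3 u v) = 0"
    using assms by (simp add: Lagrange)
  then have "cross3 g (cross3 g (cross3 u v)) = 0" by simp
  then have "(g \<bullet> cross3 u v) *\<^sub>R g - (g \<bullet> g) *\<^sub>R cross3 u v = 0"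
    unfolding Lagrange[of g g] .
  then show ?thesis by (simp add: inner_commute)
qed

lemma bounded_bilinear_cross3: "bounded_bilinear cross3"
  using bilinear_cross bilinear_conv_bounded_bilinear by blast

lemma periodic_shift_int:
  fixes g :: "real \<Rightarrow> 'a"
  assumes "\<And>\<alpha>. g (\<alpha> + 1) = g \<alpha>"
  shows "g (\<alpha> + of_int n) = g \<alpha>"
proof -
  have *: "g (\<alpha> + of_nat m) = g \<alpha>" for m \<alpha>
    by (induction m) (simp_all add: assms add.assoc[symmetric] add.commute[of 1])
  show ?thesis
    using *[of \<alpha> "nat n"] *[of "\<alpha> + of_int n" "nat (-n)"] by (cases "n \<ge> 0") auto
qed

lemma periodic_frac:
  fixes g :: "real \<Rightarrow> 'a"
  assumes "\<And>\<alpha>. g (\<alpha> + 1) = g \<alpha>"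
  shows "g (frac \<alpha>) = g \<alpha>"
  using periodic_shift_int[of g \<alpha> "- \<lfloor>\<alpha>\<rfloor>", OF assms] by (simp add: frac_def)

text \<open>On an interval of length one the mean value theorem yields a point where
  \<open>R'\<close> equals an increment of \<open>R\<close>, and these increments tend to
  zero.\<close>

lemma derivative_limit_at_bot_zero:
  fixes R R' :: "real \<Rightarrow> real"
  assumes der: "eventually (\<lambda>p. (R has_real_derivative R' p) (at p)) at_bot"
    and lim: "(R \<longlongrightarrow> L) at_bot" and lim': "(R' \<longlongrightarrow> L') at_bot"
  shows "L' = 0"
proof (rule ccontr)
  assume "L' \<noteq> 0"
  \<comment> \<open>A quarter suffices: the increment is below \<open>2 * e\<close> and
    \<open>R'\<close> is within \<open>e\<close> of \<open>L'\<close>, so the modulus of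
    \<open>L'\<close> would be below \<open>3 * e\<close>.\<close>
  define e where "e = \<bar>L'\<bar> / 4"
  have e: "e > 0" using \<open>L' \<noteq> 0\<close> by (simp add: e_def)
  have "eventually (\<lambda>p. (R has_real_derivative R' p) (at p) \<and> \<bar>R p - L\<bar> < e \<and> \<bar>R' p - L'\<bar> < e) at_bot"
    using der tendstoD[OF lim e] tendstoD[OF lim' e] by eventually_elim (simp add: dist_real_def)
  then obtain T where T: "\<And>p. p \<le> T \<Longrightarrow> (R has_real_derivative R' p) (at p) \<and> \<bar>R p - L\<bar> < e \<and> \<bar>R' p - L'\<bar> < e"
    unfolding eventually_at_bot_linorder by blast
  have "\<exists>z>T-1. z < T \<and> R T - R (T-1) = (T - (T-1)) * R' z"
    by (rule MVT2) (simp, use T in blast)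
  then obtain z where z: "z < T" "R T - R (T-1) = R' z" by auto
  have "\<bar>R' z\<bar> < 2 * e" using T[of T] T[of "T-1"] z by auto
  moreover have "\<bar>R' z - L'\<bar> < e" using T z by auto
  ultimately show False using e unfolding e_def by linarith
qed

text \<open>One end of the surface, phrased so that it can be instantiated twice: with
  \<open>f\<close> at \<open>a\<close>, and with \<open>-f\<close> and reversed time at
  \<open>b\<close>. \<open>K\<close> stands for the surface with both saddles added,
  \<open>surj_a\<close> is the spectral information, and \<open>surf\<close> is a regular equation F
  = 0 satisfied by the trajectories near \<open>a\<close>.\<close>

locale saddle_end =
  fixes \<Omega> K :: "(real^3) set"
    and f :: "real^3 \<Rightarrow> real^3" and f' :: "real^3 \<Rightarrow> ((real^3) \<Rightarrow>\<^sub>L (real^3))"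
    and a b :: "real^3"
    and X X\<^sub>\<alpha> :: "real \<Rightarrow> real \<Rightarrow> real^3"
  assumes open_dom: "open \<Omega>"
    and f_deriv: "\<And>x. x \<in> \<Omega> \<Longrightarrow> (f has_derivative blinfun_apply (f' x)) (at x)"
    and f'_cont: "continuous_on \<Omega> f'"
    and K: "compact K" "K \<subseteq> \<Omega>" "a \<in> K" "b \<in> K" "K \<subseteq> {a, b} \<union> range (case_prod X)"
    and f_b: "f b = 0" and a_neq_b: "a \<noteq> b"
    and X_in_K: "\<And>p \<alpha>. X p \<alpha> \<in> K"
    and X_periodic: "\<And>p \<alpha>. X p (\<alpha> + 1) = X p \<alpha>"
    and X_inj: "inj_on (case_prod X) {(p, \<alpha>). \<alpha> \<in> {0..<1}}"
    and X_deriv: "\<And>p \<alpha>. (case_prod X has_derivative (\<lambda>(s, u). s *\<^sub>R f (X p \<alpha>) + u *\<^sub>R X\<^sub>\<alpha> p \<alpha>)) (at (p, \<alpha>))"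
    and X\<alpha>_cont: "continuous_on UNIV (case_prod X\<^sub>\<alpha>)"
    and X_lim_a: "\<And>\<alpha>. ((\<lambda>p. X p \<alpha>) \<longlongrightarrow> a) at_bot"
    and X_lim_b: "\<And>\<alpha>. ((\<lambda>p. X p \<alpha>) \<longlongrightarrow> b) at_top"
    and normal_nz: "\<And>p \<alpha>. cross3 (f (X p \<alpha>)) (X\<^sub>\<alpha> p \<alpha>) \<noteq> 0"
    and div_free: "\<And>x. x \<in> \<Omega> \<Longrightarrow> trace (matrix (blinfun_apply (f' x))) = 0"
    and surj_a: "surj (blinfun_apply (f' a))"
    and surf: "\<exists>r F G. 0 < r \<and> (\<forall>x\<in>ball a r. (F has_derivative (\<lambda>h. G x \<bullet> h)) (at x)) \<and>
        continuous_on (ball a r) G \<and> G a \<noteq> (0::real^3) \<and> (\<forall>p \<alpha>. X p \<alpha> \<in> ball a r \<longrightarrow> F (X p \<alpha>) = (0::real))"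
begin

lemma X_cont: "continuous_on UNIV (case_prod X)"
proof -
  have "isCont (case_prod X) z" for z
    by (cases z) (simp only: has_derivative_continuous[OF X_deriv])
  then show ?thesis
    by (simp add: continuous_at_imp_continuous_on)
qed

lemma f_cont: "continuous_on \<Omega> f"
  by (intro continuous_at_imp_continuous_on ballI has_derivative_continuous[OF f_deriv])

lemma X_in_dom: "X p \<alpha> \<in> \<Omega>"
  using X_in_K K(2) by blast

lemma X_continuous_on [continuous_intros]:
  assumes "continuous_on S p" "continuous_on S \<alpha>"
  shows "continuous_on S (\<lambda>x. X (p x) (\<alpha> x))"
  using continuous_on_compose2[OF X_cont continuous_on_Pair[OF assms]] by auto

lemma X\<alpha>_continuous_on [continuous_intros]:
  assumes "continuous_on S p" "continuous_on S \<alpha>"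
  shows "continuous_on S (\<lambda>x. X\<^sub>\<alpha> (p x) (\<alpha> x))"
  using continuous_on_compose2[OF X\<alpha>_cont continuous_on_Pair[OF assms]] by auto

lemma f_X_continuous_on [continuous_intros]:
  assumes "continuous_on S p" "continuous_on S \<alpha>"
  shows "continuous_on S (\<lambda>x. f (X (p x) (\<alpha> x)))"
  using continuous_on_compose2[OF f_cont X_continuous_on[OF assms]] X_in_dom by auto

lemma f'_X_continuous_on [continuous_intros]:
  assumes "continuous_on S p" "continuous_on S \<alpha>"
  shows "continuous_on S (\<lambda>x. f' (X (p x) (\<alpha> x)))"
  using continuous_on_compose2[OF f'_cont X_continuous_on[OF assms]] X_in_dom by auto

lemma X_deriv_time: "((\<lambda>q. X q \<alpha>) has_vector_derivative f (X p \<alpha>)) (at p within S)"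
proof -
  have "((\<lambda>q. (q, \<alpha>)) has_derivative (\<lambda>s. (s, 0))) (at p within S)"
    by (auto intro!: derivative_eq_intros)
  from has_derivative_compose[OF this X_deriv] show ?thesis
    by (simp add: has_vector_derivative_def)
qed

lemma X_deriv_label: "((\<lambda>\<beta>. X p \<beta>) has_vector_derivative X\<^sub>\<alpha> p \<alpha>) (at \<alpha> within S)"
proof -
  have "((\<lambda>\<beta>. (p, \<beta>)) has_derivative (\<lambda>s. (0, s))) (at \<alpha> within S)"
    by (auto intro!: derivative_eq_intros)
  from has_derivative_compose[OF this X_deriv] show ?thesis
    by (simp add: has_vector_derivative_def)
qed

text \<open>The locale supplies no mixed second derivative of \<open>X\<close>, so the equation is
  derived from the integral form of the flow: differentiate under the integral in the label, then
  differentiate the result in time.\<close>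

lemma variational: "((\<lambda>q. X\<^sub>\<alpha> q \<alpha>) has_vector_derivative f' (X p \<alpha>) (X\<^sub>\<alpha> p \<alpha>)) (at p)"
proof -
  \<comment> \<open>Starting one unit earlier makes \<open>p\<close> an interior point of the
    interval of integration, so that the derivative is two-sided.\<close>
  define c where "c = p - 1"
  have f_X_label: "((\<lambda>\<beta>. f (X s \<beta>)) has_vector_derivative f' (X s \<beta>) (X\<^sub>\<alpha> s \<beta>)) (at \<beta> within U)" for s \<beta> U
    using has_derivative_compose[OF X_deriv_label[unfolded has_vector_derivative_def] f_deriv[OF X_in_dom], of s \<beta> U]
    by (simp add: has_vector_derivative_def blinfun.scaleR_right)
  have I: "X\<^sub>\<alpha> q \<alpha> = X\<^sub>\<alpha> c \<alpha> + integral {c..q} (\<lambda>s. f' (X s \<alpha>) (X\<^sub>\<alpha> s \<alpha>))" if "c \<le> q" for q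
  proof -
    have "((\<lambda>\<beta>. integral (cbox c q) (\<lambda>s. f (X s \<beta>))) has_vector_derivative
            integral (cbox c q) (\<lambda>s. f' (X s \<alpha>) (X\<^sub>\<alpha> s \<alpha>))) (at \<alpha> within UNIV)"
    proof (rule leibniz_rule_vector_derivative[where fx = "\<lambda>\<beta> s. f' (X s \<beta>) (X\<^sub>\<alpha> s \<beta>)"])
      show "continuous_on (UNIV \<times> cbox c q) (\<lambda>(x, t). f' (X t x) (X\<^sub>\<alpha> t x))"
        unfolding split_beta by (intro continuous_intros)
      show "(\<lambda>s. f (X s \<beta>)) integrable_on cbox c q" for \<beta>
        by (intro integrable_continuous continuous_intros)
    qed (use f_X_label in auto)
    then have "((\<lambda>\<beta>. X c \<beta> + integral (cbox c q) (\<lambda>s. f (X s \<beta>))) has_vector_derivative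
            X\<^sub>\<alpha> c \<alpha> + integral (cbox c q) (\<lambda>s. f' (X s \<alpha>) (X\<^sub>\<alpha> s \<alpha>))) (at \<alpha>)"
      by (intro has_vector_derivative_add X_deriv_label) auto
    moreover have "X c \<beta> + integral (cbox c q) (\<lambda>s. f (X s \<beta>)) = X q \<beta>" for \<beta>
      using integral_unique[OF fundamental_theorem_of_calculus[OF that X_deriv_time, of \<beta>]] by simp
    ultimately have "((\<lambda>\<beta>. X q \<beta>) has_vector_derivative
            X\<^sub>\<alpha> c \<alpha> + integral (cbox c q) (\<lambda>s. f' (X s \<alpha>) (X\<^sub>\<alpha> s \<alpha>))) (at \<alpha>)" by simp
    from vector_derivative_unique_at[OF this X_deriv_label[of q \<alpha> UNIV]] show ?thesis by simp
  qed
  have "((\<lambda>q. integral {c..q} (\<lambda>s. f' (X s \<alpha>) (X\<^sub>\<alpha> s \<alpha>))) has_vector_derivative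
          f' (X p \<alpha>) (X\<^sub>\<alpha> p \<alpha>)) (at p within {c..p+1})"
    by (rule integral_has_vector_derivative) (auto intro!: continuous_intros simp: c_def)
  then have "((\<lambda>q. X\<^sub>\<alpha> c \<alpha> + integral {c..q} (\<lambda>s. f' (X s \<alpha>) (X\<^sub>\<alpha> s \<alpha>))) has_vector_derivative
          f' (X p \<alpha>) (X\<^sub>\<alpha> p \<alpha>)) (at p within {c..p+1})"
    using has_vector_derivative_add[OF has_vector_derivative_const] by fastforce
  then have "((\<lambda>q. X\<^sub>\<alpha> q \<alpha>) has_vector_derivative f' (X p \<alpha>) (X\<^sub>\<alpha> p \<alpha>)) (at p within {c..p+1})"
    by (rule has_vector_derivative_transform[rotated 2]) (simp add: c_def, rule I, simp)
  moreover have "at p within {c..p+1} = at p"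
    by (rule at_within_interior) (simp add: c_def)
  ultimately show ?thesis by simp
qed

definition normal :: "real \<Rightarrow> real \<Rightarrow> real^3" where
  "normal p \<alpha> = cross3 (f (X p \<alpha>)) (X\<^sub>\<alpha> p \<alpha>)"

lemma normal_continuous_on [continuous_intros]:
  assumes "continuous_on S p" "continuous_on S \<alpha>"
  shows "continuous_on S (\<lambda>x. normal (p x) (\<alpha> x))"
  unfolding normal_def
  by (intro bounded_bilinear.continuous_on[OF bounded_bilinear_cross3] continuous_intros assms)

lemma normal_deriv:
  "((\<lambda>q. normal q \<alpha> \<bullet> w) has_real_derivative - (normal p \<alpha> \<bullet> f' (X p \<alpha>) w)) (at p)"
proof -
  let ?A = "blinfun_apply (f' (X p \<alpha>))"
  have fX: "((\<lambda>q. f (X q \<alpha>)) has_derivative (\<lambda>s. s *\<^sub>R ?A (f (X p \<alpha>)))) (at p)"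
    using has_derivative_compose[OF X_deriv_time[unfolded has_vector_derivative_def] f_deriv[OF X_in_dom], of \<alpha> p UNIV]
    by (simp add: blinfun.scaleR_right)
  have "((\<lambda>q. normal q \<alpha> \<bullet> w) has_derivative
     (\<lambda>s. (cross3 (f (X p \<alpha>)) (s *\<^sub>R ?A (X\<^sub>\<alpha> p \<alpha>)) + cross3 (s *\<^sub>R ?A (f (X p \<alpha>))) (X\<^sub>\<alpha> p \<alpha>)) \<bullet> w)) (at p)"
    unfolding normal_def
    by (intro has_derivative_inner_left bounded_bilinear.FDERIV[OF bounded_bilinear_cross3] fX variational[unfolded has_vector_derivative_def])
  moreover have "(cross3 (f (X p \<alpha>)) (s *\<^sub>R ?A (X\<^sub>\<alpha> p \<alpha>)) + cross3 (s *\<^sub>R ?A (f (X p \<alpha>))) (X\<^sub>\<alpha> p \<alpha>)) \<bullet> w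
      = - (normal p \<alpha> \<bullet> ?A w) * s" for s
  proof -
    have "(cross3 (f (X p \<alpha>)) (s *\<^sub>R ?A (X\<^sub>\<alpha> p \<alpha>)) + cross3 (s *\<^sub>R ?A (f (X p \<alpha>))) (X\<^sub>\<alpha> p \<alpha>)) \<bullet> w
      = s * ((cross3 (?A (f (X p \<alpha>))) (X\<^sub>\<alpha> p \<alpha>) + cross3 (f (X p \<alpha>)) (?A (X\<^sub>\<alpha> p \<alpha>))) \<bullet> w)"
      by (simp add: cross_mult_left cross_mult_right inner_add_left algebra_simps)
    also have "\<dots> = - (normal p \<alpha> \<bullet> ?A w) * s"
      by (subst cross3_linear_trace) (auto simp: div_free X_in_dom normal_def bounded_linear.linear[OF blinfun.bounded_linear_right])
    finally show ?thesis .
  qed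
  ultimately show ?thesis
    unfolding has_field_derivative_def by (simp only:)
qed

text \<open>\<open>K\<close> may fail to be convex, so a bound on \<open>f'\<close> over
  \<open>K\<close> would not give a Lipschitz constant; local Lipschitz continuity on
  \<open>\<Omega>\<close> combined with compactness does.\<close>

lemma lipschitz_on_K: obtains L where "L-lipschitz_on K f"
proof -
  have "local_lipschitz UNIV \<Omega> (\<lambda>t::real. f)"
    by (rule c1_implies_local_lipschitz[where f' = "\<lambda>(t, x). f' x"])
      (auto simp: split_beta f_deriv open_dom intro!: continuous_intros continuous_on_compose2[OF f'_cont])
  then have "local_lipschitz {0} K (\<lambda>t::real. f)"
    by (rule local_lipschitz_subset) (use K in auto)
  from local_lipschitz_compact_implies_lipschitz[OF this K(1)]
  obtain L where "\<And>t::real. t \<in> {0} \<Longrightarrow> L-lipschitz_on K f"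
    by auto
  then show ?thesis using that by auto
qed

end

section \<open>Uniform convergence of the trajectories to the saddle in backward time\<close>

lemma gronwall_difference:
  fixes y1 y2 :: "real \<Rightarrow> 'a::euclidean_space"
  assumes lip: "L-lipschitz_on K f" and "s \<ge> 0"
    and y1: "\<And>t. 0 \<le> t \<Longrightarrow> y1 t \<in> K" "\<And>t. 0 \<le> t \<Longrightarrow> (y1 has_vector_derivative f (y1 t)) (at t)"
    and y2: "\<And>t. 0 \<le> t \<Longrightarrow> y2 t \<in> K" "\<And>t. 0 \<le> t \<Longrightarrow> (y2 has_vector_derivative f (y2 t)) (at t)"
  shows "norm (y1 s - y2 s) \<le> exp (L * s) * norm (y1 0 - y2 0)"
proof -
  \<comment> \<open>The squared distance grows at relative rate at most \<open>2 * L\<close>, so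
    this weight makes \<open>u\<close> nonincreasing. Squares keep it differentiable where the
    solutions meet.\<close>
  define u where "u t = exp (- 2 * L * t) * ((y1 t - y2 t) \<bullet> (y1 t - y2 t))" for t
  have "\<exists>D. (u has_real_derivative D) (at t) \<and> D \<le> 0" if "0 \<le> t" for t
  proof (intro exI conjI)
    have d: "((\<lambda>t. y1 t - y2 t) has_vector_derivative (f (y1 t) - f (y2 t))) (at t)"
      by (intro has_vector_derivative_diff y1 y2 that)
    have "((\<lambda>t. (y1 t - y2 t) \<bullet> (y1 t - y2 t)) has_real_derivative 2 * ((y1 t - y2 t) \<bullet> (f (y1 t) - f (y2 t)))) (at t)"
      unfolding has_field_derivative_def
      by (rule has_derivative_eq_rhs[OF has_derivative_inner[OF d[unfolded has_vector_derivative_def] d[unfolded has_vector_derivative_def]]])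
        (simp add: fun_eq_iff inner_commute)
    then show "(u has_real_derivative
        exp (- 2 * L * t) * (2 * ((y1 t - y2 t) \<bullet> (f (y1 t) - f (y2 t))))
        + (exp (- 2 * L * t) * (- 2 * L)) * ((y1 t - y2 t) \<bullet> (y1 t - y2 t))) (at t)"
      unfolding u_def by (auto intro!: derivative_eq_intros)
    have "(y1 t - y2 t) \<bullet> (f (y1 t) - f (y2 t)) \<le> norm (y1 t - y2 t) * norm (f (y1 t) - f (y2 t))"
      by (rule norm_cauchy_schwarz)
    also have "\<dots> \<le> norm (y1 t - y2 t) * (L * norm (y1 t - y2 t))"
      by (intro mult_left_mono lipschitz_on_normD[OF lip] y1 y2 that) auto
    finally have "(y1 t - y2 t) \<bullet> (f (y1 t) - f (y2 t)) \<le> L * ((y1 t - y2 t) \<bullet> (y1 t - y2 t))"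
      by (simp add: dot_square_norm power2_eq_square mult.left_commute)
    then have "exp (- 2 * L * t) * (2 * ((y1 t - y2 t) \<bullet> (f (y1 t) - f (y2 t))))
        \<le> exp (- 2 * L * t) * (2 * (L * ((y1 t - y2 t) \<bullet> (y1 t - y2 t))))"
      by (intro mult_left_mono) auto
    then show "exp (- 2 * L * t) * (2 * ((y1 t - y2 t) \<bullet> (f (y1 t) - f (y2 t))))
        + (exp (- 2 * L * t) * (- 2 * L)) * ((y1 t - y2 t) \<bullet> (y1 t - y2 t)) \<le> 0"
      by (simp add: algebra_simps)
  qed
  then have "u s \<le> u 0"
    by (intro DERIV_nonpos_imp_nonincreasing[OF \<open>s \<ge> 0\<close>]) auto
  then have "exp (- 2 * L * s) * (norm (y1 s - y2 s))\<^sup>2 \<le> (norm (y1 0 - y2 0))\<^sup>2"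
    by (simp add: u_def power2_norm_eq_inner)
  then have "exp (2 * L * s) * (exp (- 2 * L * s) * (norm (y1 s - y2 s))\<^sup>2) \<le> exp (2 * L * s) * (norm (y1 0 - y2 0))\<^sup>2"
    by (intro mult_left_mono) auto
  then have "(norm (y1 s - y2 s))\<^sup>2 \<le> exp (2 * L * s) * (norm (y1 0 - y2 0))\<^sup>2"
    by (simp add: mult.assoc[symmetric] exp_add[symmetric])
  also have "\<dots> = (exp (L * s) * norm (y1 0 - y2 0))\<^sup>2"
    by (simp add: power_mult_distrib power2_eq_square exp_add[symmetric])
  finally show ?thesis
    by (rule power2_le_imp_le) simp
qed

lemma has_vector_derivative_shift:
  assumes "(g has_vector_derivative v) (at (t + c))"
  shows "((\<lambda>s. g (s + c)) has_vector_derivative v) (at t)"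
proof -
  have "((\<lambda>s. s + c) has_vector_derivative 1) (at t)"
    by (auto intro!: derivative_eq_intros)
  from vector_diff_chain_at[OF this assms] show ?thesis by (simp add: o_def)
qed

lemma last_time_outside_ball:
  fixes y :: "real \<Rightarrow> 'a::real_normed_vector"
  assumes "continuous_on UNIV y" "p \<le> P" "r \<le> norm (y p - a)" "norm (y P - a) < r"
  obtains q where "p \<le> q" "q < P" "r \<le> norm (y q - a)" "\<And>s. q < s \<Longrightarrow> s \<le> P \<Longrightarrow> norm (y s - a) < r"
proof -
  let ?E = "{q \<in> {p..P}. r \<le> norm (y q - a)}"
  have "closed ?E"
    by (intro closed_Collect_conj closed_Collect_le continuous_intros assms(1) | simp add: closed_atLeastAtMost[unfolded atLeastAtMost_def])+
  moreover have "bounded ?E" by (rule bounded_subset[of "{p..P}"]) auto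
  ultimately have "compact ?E" by (simp add: compact_eq_bounded_closed)
  then obtain q where q: "q \<in> ?E" "\<And>s. s \<in> ?E \<Longrightarrow> s \<le> q"
    using compact_attains_sup[of ?E] assms by force
  show thesis
  proof (rule that)
    show "q < P" using q(1) assms(4) by (cases "q = P") auto
    show "norm (y s - a) < r" if "q < s" "s \<le> P" for s
      using q(1) q(2)[of s] that by (cases "r \<le> norm (y s - a)") auto
  qed (use q in auto)
qed

context saddle_end
begin

lemma X_frac: "X p \<alpha> = X p (frac \<alpha>)"
  using periodic_frac[of "X p", OF X_periodic] by simp

lemma X\<alpha>_frac: "X\<^sub>\<alpha> p \<alpha> = X\<^sub>\<alpha> p (frac \<alpha>)"
proof -
  define d where "d = frac \<alpha> - \<alpha>"
  have "((\<lambda>\<beta>. X p (\<beta> + d)) has_vector_derivative X\<^sub>\<alpha> p (frac \<alpha>)) (at \<alpha>)"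
    by (rule has_vector_derivative_shift) (simp add: d_def X_deriv_label)
  moreover have "X p (\<beta> + d) = X p \<beta>" for \<beta>
    using periodic_shift_int[of "X p" \<beta> "- \<lfloor>\<alpha>\<rfloor>", OF X_periodic] by (simp add: d_def frac_def)
  ultimately show ?thesis
    using vector_derivative_unique_at[OF X_deriv_label] by auto
qed

lemma normal_frac: "normal p \<alpha> = normal p (frac \<alpha>)"
  unfolding normal_def using X_frac X\<alpha>_frac by metis

text \<open>If the convergence were not uniform, points leaving a small ball around \<open>a\<close> backwards in
  time would accumulate at a point of the manifold whose forward orbit never leaves that ball, although
  it has to converge to \<open>b\<close>.\<close>

lemma uniform_limit_a_unit:
  assumes "r > 0"
  shows "\<exists>T. \<forall>p\<le>T. \<forall>\<alpha>\<in>{0..1}. norm (X p \<alpha> - a) < r"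
proof -
  \<comment> \<open>The restriction \<open>r < norm (b - a)\<close> creates the contradiction: the
    limiting orbit stays within \<open>r\<close> of \<open>a\<close> and yet tends to
    \<open>b\<close>. Larger radii are reduced to this case at the end.\<close>
  have main: False if r: "0 < r" "r < norm (b - a)"
    and nex: "\<nexists>T. \<forall>p\<le>T. \<forall>\<alpha>\<in>{0..1}. norm (X p \<alpha> - a) < r" for r
  proof -
    have "\<exists>p \<alpha>. p \<le> - real n \<and> \<alpha> \<in> {0..1} \<and> r \<le> norm (X p \<alpha> - a)" for n
      using nex by (meson not_le)
    then obtain P A where PA: "\<And>n. P n \<le> - real n" "\<And>n. A n \<in> {0..1}" "\<And>n. r \<le> norm (X (P n) (A n) - a)"
      by metis
    obtain \<alpha>0 k0 where \<alpha>0: "\<alpha>0 \<in> {0..1}" "strict_mono k0" "(A \<circ> k0) \<longlonglongrightarrow> \<alpha>0"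
      using compact_Icc[of "0::real" 1] PA(2) unfolding compact_def by metis
    have "eventually (\<lambda>p. dist (X p \<alpha>0) a < r / 2) at_bot"
      using tendstoD[OF X_lim_a, of "r/2" \<alpha>0] r by auto
    then obtain T where T: "\<And>p. p \<le> T \<Longrightarrow> norm (X p \<alpha>0 - a) < r / 2"
      unfolding eventually_at_bot_linorder dist_norm by blast
    \<comment> \<open>Before \<open>T\<close> the trajectory with the limit label is within
      \<open>r / 2\<close> of \<open>a\<close>. Nearby labels inherit the radius \<open>r\<close> on
      each compact window ending at \<open>T\<close>, so times outside the ball escape to minus
      infinity.\<close>
    have close: "eventually (\<lambda>n. \<forall>q\<in>{-R..T}. norm (X q (A (k0 n)) - a) < r) sequentially" for R
    proof -
      have "uniformly_continuous_on ({-R..T} \<times> {0..1}) (case_prod X)"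
        by (intro compact_uniformly_continuous compact_Times continuous_on_subset[OF X_cont]) auto
      then obtain d where d: "d > 0"
        "\<And>z z'. z \<in> {-R..T} \<times> {0..1} \<Longrightarrow> z' \<in> {-R..T} \<times> {0..1} \<Longrightarrow> dist z' z < d
           \<Longrightarrow> dist (case_prod X z') (case_prod X z) < r / 2"
        unfolding uniformly_continuous_on_def using r by (metis half_gt_zero)
      have "eventually (\<lambda>n. dist (A (k0 n)) \<alpha>0 < d) sequentially"
        using tendstoD[OF \<alpha>0(3) d(1)] by simp
      then show ?thesis
      proof eventually_elim
        case (elim n)
        show ?case
        proof
          fix q assume q: "q \<in> {-R..T}"
          have "dist (X q (A (k0 n))) (X q \<alpha>0) < r / 2"
            using d(2)[of "(q, \<alpha>0)" "(q, A (k0 n))"] q elim PA(2) \<alpha>0 by (auto simp: dist_Pair_Pair)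
          moreover have "norm (X q \<alpha>0 - a) < r / 2" using T q by auto
          ultimately show "norm (X q (A (k0 n)) - a) < r"
            using norm_triangle_ineq[of "X q (A (k0 n)) - X q \<alpha>0" "X q \<alpha>0 - a"] by (simp add: dist_norm)
        qed
      qed
    qed
    have "eventually (\<lambda>n. P (k0 n) \<le> T \<and> norm (X T (A (k0 n)) - a) < r) sequentially"
    proof (rule eventually_conj)
      show "eventually (\<lambda>n. P (k0 n) \<le> T) sequentially"
      proof (rule eventually_sequentiallyI[of "nat \<lceil>- T\<rceil>"])
        fix n assume "nat \<lceil>- T\<rceil> \<le> n"
        then have "- T \<le> real n" by linarith
        also have "real n \<le> real (k0 n)" using seq_suble[OF \<alpha>0(2)] by simp
        finally show "P (k0 n) \<le> T" using PA(1)[of "k0 n"] by linarith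
      qed
      show "eventually (\<lambda>n. norm (X T (A (k0 n)) - a) < r) sequentially"
        using close[of "-T"] by simp
    qed
    then obtain n0 where n0: "\<And>n. n \<ge> n0 \<Longrightarrow> P (k0 n) \<le> T \<and> norm (X T (A (k0 n)) - a) < r"
      unfolding eventually_sequentially by blast
    \<comment> \<open>The last exit time before \<open>T\<close> is used instead of
      \<open>P\<close>: from there until \<open>T\<close> the trajectory remains in the
      ball.\<close>
    have "\<exists>q. q < T \<and> r \<le> norm (X q (A (k0 (n0 + n))) - a) \<and>
          (\<forall>s. q < s \<longrightarrow> s \<le> T \<longrightarrow> norm (X s (A (k0 (n0 + n))) - a) < r)" for n
    proof -
      have "continuous_on UNIV (\<lambda>s. X s (A (k0 (n0 + n))))" by (intro continuous_intros)
      from last_time_outside_ball[OF this, of "P (k0 (n0 + n))" T r a] n0[of "n0 + n"] PA(3)[of "k0 (n0 + n)"]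
      show ?thesis by (metis le_add1)
    qed
    then obtain Q where Q: "\<And>n. Q n < T" "\<And>n. r \<le> norm (X (Q n) (A (k0 (n0 + n))) - a)"
        "\<And>n s. Q n < s \<Longrightarrow> s \<le> T \<Longrightarrow> norm (X s (A (k0 (n0 + n))) - a) < r"
      by metis
    define Z where "Z n = X (Q n) (A (k0 (n0 + n)))" for n
    obtain z k1 where z: "z \<in> K" "strict_mono k1" "(Z \<circ> k1) \<longlonglongrightarrow> z"
      using K(1) X_in_K unfolding compact_def Z_def by metis
    have rz: "r \<le> norm (z - a)"
      by (rule tendsto_lowerbound[OF tendsto_norm[OF tendsto_diff[OF z(3) tendsto_const]]])
        (use Q(2) in \<open>auto simp: Z_def o_def\<close>)
    then have "z \<noteq> a" using r by auto
    \<comment> \<open>An accumulation point of the exit points lies in \<open>K\<close> and differs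
      from \<open>a\<close>, so it is \<open>b\<close> or a point of a trajectory; in both cases an
      orbit in \<open>K\<close> starts there and tends to \<open>b\<close>.\<close>
    have "\<exists>y. y 0 = z \<and> (\<forall>t. y t \<in> K \<and> (y has_vector_derivative f (y t)) (at t)) \<and> (y \<longlongrightarrow> b) at_top"
    proof (cases "z = b")
      case True
      then show ?thesis using K f_b by (intro exI[of _ "\<lambda>_. b"]) auto
    next
      case False
      then obtain p \<alpha> where p: "z = X p \<alpha>" using z(1) K(5) \<open>z \<noteq> a\<close> by auto
      have "((\<lambda>s. X (p + s) \<alpha>) has_vector_derivative f (X (p + t) \<alpha>)) (at t)" for t
        unfolding add.commute[of p] by (rule has_vector_derivative_shift) (rule X_deriv_time)
      moreover have "((\<lambda>s. X (p + s) \<alpha>) \<longlongrightarrow> b) at_top"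
        by (rule filterlim_compose[OF X_lim_b]) (rule filterlim_tendsto_add_at_top[OF tendsto_const filterlim_ident])
      ultimately show ?thesis using p X_in_K by (intro exI[of _ "\<lambda>s. X (p + s) \<alpha>"]) auto
    qed
    then obtain y where y: "y 0 = z" "\<And>t. y t \<in> K" "\<And>t. (y has_vector_derivative f (y t)) (at t)" "(y \<longlongrightarrow> b) at_top"
      by metis
    obtain L where L: "L-lipschitz_on K f" by (rule lipschitz_on_K)
    \<comment> \<open>For fixed \<open>s\<close>, the trajectories followed for time
      \<open>s\<close> after their exit points converge to \<open>y s\<close> by the Gronwall
      estimate. Their exit times eventually lie before \<open>T - s\<close>, so these points are
      still inside the ball.\<close>
    have bound: "norm (y s - a) \<le> r" if "s > 0" for s
    proof -
      let ?W = "\<lambda>n. X (Q (k1 n) + s) (A (k0 (n0 + k1 n)))"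
      have W: "norm (?W n - y s) \<le> exp (L * s) * norm (Z (k1 n) - z)" for n
      proof -
        have "((\<lambda>s. X (Q (k1 n) + s) (A (k0 (n0 + k1 n)))) has_vector_derivative
            f (X (Q (k1 n) + t) (A (k0 (n0 + k1 n))))) (at t)" for t
          unfolding add.commute[of "Q (k1 n)"] by (rule has_vector_derivative_shift) (rule X_deriv_time)
        from gronwall_difference[OF L, of s, OF _ _ this y(2) y(3)] show ?thesis
          using that X_in_K y(1) by (simp add: Z_def)
      qed
      have "(\<lambda>n. exp (L * s) * norm (Z (k1 n) - z)) \<longlonglongrightarrow> 0"
      proof (rule tendsto_mult_right_zero)
        show "(\<lambda>n. norm (Z (k1 n) - z)) \<longlonglongrightarrow> 0"
          using z(3) by (simp add: tendsto_norm_zero_iff LIM_zero_iff o_def)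
      qed
      with W have "(\<lambda>n. ?W n - y s) \<longlonglongrightarrow> 0"
        by (rule Lim_null_comparison[OF always_eventually[OF allI]])
      then have "?W \<longlonglongrightarrow> y s" by (rule LIM_zero_cancel)
      then have "(\<lambda>n. norm (?W n - a)) \<longlonglongrightarrow> norm (y s - a)"
        by (intro tendsto_norm tendsto_diff tendsto_const)
      moreover have "eventually (\<lambda>n. norm (?W n - a) \<le> r) sequentially"
      proof -
        \<comment> \<open>The window is \<open>{T - s..T}\<close>. The exit point is outside the
          ball and before \<open>T\<close>, hence it precedes the whole window.\<close>
        obtain n1 where n1: "\<And>n. n \<ge> n1 \<Longrightarrow> \<forall>q\<in>{-(s - T)..T}. norm (X q (A (k0 n)) - a) < r"
          using close[of "s - T"] unfolding eventually_sequentially by blast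
        show ?thesis
        proof (rule eventually_sequentiallyI[of n1])
          fix n assume n: "n1 \<le> n"
          have "n1 \<le> n0 + k1 n" using n seq_suble[OF z(2), of n] by linarith
          then have "Q (k1 n) \<notin> {-(s - T)..T}"
            using n1[of "n0 + k1 n"] Q(2)[of "k1 n"] by (meson not_le)
          then have "Q (k1 n) + s \<le> T" using Q(1)[of "k1 n"] by auto
          then show "norm (?W n - a) \<le> r" using Q(3)[of "k1 n" "Q (k1 n) + s"] that by simp
        qed
      qed
      ultimately show ?thesis by (rule tendsto_upperbound) simp
    qed
    have "norm (b - a) \<le> r"
      by (rule tendsto_upperbound[OF tendsto_norm[OF tendsto_diff[OF y(4) tendsto_const]]])
        (rule eventually_mono[OF eventually_gt_at_top bound], simp_all)
    then show False using r by simp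
  qed
  define r' where "r' = min r (norm (b - a) / 2)"
  have r': "0 < r'" "r' < norm (b - a)" "r' \<le> r" using assms a_neq_b by (auto simp: r'_def min_def field_simps)
  from main[OF r'(1,2)] r'(3) show ?thesis by (meson order_less_le_trans)
qed

lemma uniform_limit_a:
  assumes "r > 0"
  obtains T where "\<And>p \<alpha>. p \<le> T \<Longrightarrow> norm (X p \<alpha> - a) < r"
proof -
  from uniform_limit_a_unit[OF assms] obtain T where T: "\<And>p \<alpha>. p \<le> T \<Longrightarrow> \<alpha> \<in> {0..1} \<Longrightarrow> norm (X p \<alpha> - a) < r"
    by blast
  show thesis
  proof (rule that)
    fix p \<alpha> assume "p \<le> T"
    then show "norm (X p \<alpha> - a) < r"
      using T[of p "frac \<alpha>"] X_frac[of p \<alpha>] frac_lt_1[of \<alpha>] by (simp add: less_imp_le)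
  qed
qed

end

section \<open>Level-set form of the surface at the saddle and exponential decay of the
  normal\<close>

lemma det_matrix_columns:
  "det (matrix (\<lambda>h::real^3. h $ 1 *\<^sub>R u + h $ 2 *\<^sub>R v + h $ 3 *\<^sub>R w)) = cross3 u v \<bullet> w"
  for u v w :: "real^3"
  by (simp add: matrix_def det_3 axis_def cross3_def inner_vec_def sum_3 algebra_simps)

lemma gradient_normal_to_level_curve:
  fixes F :: "'a::real_inner \<Rightarrow> real" and c :: "real \<Rightarrow> 'a"
  assumes c: "(c has_vector_derivative v) (at t)"
    and F: "(F has_derivative (\<lambda>h. g \<bullet> h)) (at (c t))"
    and "open B" "c t \<in> B" and level: "\<And>s. c s \<in> B \<Longrightarrow> F (c s) = 0"
  shows "g \<bullet> v = 0"
proof -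
  have d: "((\<lambda>s. F (c s)) has_real_derivative g \<bullet> v) (at t)"
    using has_derivative_compose[OF c[unfolded has_vector_derivative_def] F]
    by (simp add: has_field_derivative_def mult_commute_abs)
  have "isCont c t"
    using c has_vector_derivative_continuous by blast
  then have "eventually (\<lambda>s. c s \<in> B) (nhds t)"
    using assms(3,4) by (simp add: topological_tendstoD tendsto_nhds_iff isCont_def)
  then obtain e where e: "e > 0" "\<And>s. dist s t < e \<Longrightarrow> c s \<in> B"
    unfolding eventually_nhds_metric by blast
  show ?thesis
    by (rule DERIV_local_const[OF d e(1)]) (use level e assms(4) in \<open>auto simp: dist_real_def abs_minus_commute\<close>)
qed

context saddle_end
begin

text \<open>The gradient \<open>G\<close> of the local equation is orthogonal to both tangent
  vectors, so the normal is a multiple of it. Dividing \<open>G\<close> by its component along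
  \<open>m = G a\<close> makes \<open>\<zeta>\<close> satisfy
  \<open>\<zeta> x \<bullet> m = 1\<close>, and the scalar factor becomes
  \<open>normal p \<alpha> \<bullet> m\<close>. The ball is small enough that
  \<open>G x \<bullet> m > 0\<close>; thus F is strictly monotone along \<open>m\<close>, and two
  surface points in the ball cannot differ by a nonzero multiple of \<open>m\<close>.\<close>

lemma normal_form_near_a:
  obtains r m \<zeta> where "r > 0" "m \<noteq> 0" "ball a r \<subseteq> \<Omega>" "continuous_on (ball a r) \<zeta>" "\<zeta> a = m /\<^sub>R (m \<bullet> m)"
    "\<And>p \<alpha>. X p \<alpha> \<in> ball a r \<Longrightarrow> normal p \<alpha> \<bullet> m \<noteq> 0"
    "\<And>p \<alpha>. X p \<alpha> \<in> ball a r \<Longrightarrow> normal p \<alpha> = (normal p \<alpha> \<bullet> m) *\<^sub>R \<zeta> (X p \<alpha>)"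
    "\<And>p \<alpha> q \<beta> s. X p \<alpha> \<in> ball a r \<Longrightarrow> X q \<beta> \<in> ball a r \<Longrightarrow> X p \<alpha> = X q \<beta> + s *\<^sub>R m \<Longrightarrow> s = 0"
proof -
  from surf obtain r0 F G where r0: "0 < r0"
    and F: "\<And>x. x \<in> ball a r0 \<Longrightarrow> (F has_derivative (\<lambda>h. G x \<bullet> h)) (at x)"
    and G: "continuous_on (ball a r0) G" "G a \<noteq> 0"
    and level: "\<And>p \<alpha>. X p \<alpha> \<in> ball a r0 \<Longrightarrow> F (X p \<alpha>) = (0::real)"
    by blast
  define m where "m = G a"
  have "isCont (\<lambda>x. G x \<bullet> m) a"
    using continuous_on_interior[OF G(1)] r0 by (intro continuous_intros) auto
  then have "eventually (\<lambda>x. G x \<bullet> m > 0) (nhds a)"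
    using G(2) by (intro order_tendstoD) (auto simp: m_def isCont_def tendsto_nhds_iff)
  then obtain r1 where r1: "r1 > 0" "\<And>x. dist x a < r1 \<Longrightarrow> G x \<bullet> m > 0"
    unfolding eventually_nhds_metric by blast
  have "a \<in> \<Omega>" using K by auto
  then obtain r2 where r2: "r2 > 0" "ball a r2 \<subseteq> \<Omega>" using open_dom open_contains_ball by blast
  define r where "r = min r0 (min r1 r2)"
  have r: "r > 0" "ball a r \<subseteq> ball a r0" "ball a r \<subseteq> ball a r1" "ball a r \<subseteq> \<Omega>"
    using r0 r1 r2 by (auto simp: r_def)
  have pos: "G x \<bullet> m > 0" if "x \<in> ball a r" for x
    using r1(2)[of x] r(3) that by (auto simp: dist_commute)
  have N: "(G (X p \<alpha>) \<bullet> G (X p \<alpha>)) *\<^sub>R normal p \<alpha> = (normal p \<alpha> \<bullet> G (X p \<alpha>)) *\<^sub>R G (X p \<alpha>)"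
    if "X p \<alpha> \<in> ball a r" for p \<alpha>
    unfolding normal_def
  proof (rule cross3_parallel_common_normal)
    show "G (X p \<alpha>) \<bullet> f (X p \<alpha>) = 0"
      by (rule gradient_normal_to_level_curve[OF X_deriv_time F open_ball]) (use that r level in blast)+
    show "G (X p \<alpha>) \<bullet> X\<^sub>\<alpha> p \<alpha> = 0"
      by (rule gradient_normal_to_level_curve[OF X_deriv_label F open_ball]) (use that r level in blast)+
  qed
  show thesis
  proof (rule that[of r m "\<lambda>x. G x /\<^sub>R (G x \<bullet> m)"])
    show "continuous_on (ball a r) (\<lambda>x. G x /\<^sub>R (G x \<bullet> m))"
      using pos by (intro continuous_intros continuous_on_subset[OF G(1)] r) force
    fix p \<alpha> assume x: "X p \<alpha> \<in> ball a r"
    have g: "G (X p \<alpha>) \<bullet> G (X p \<alpha>) > 0" using pos[OF x] by auto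
    have e: "(G (X p \<alpha>) \<bullet> G (X p \<alpha>)) * (normal p \<alpha> \<bullet> m) = (normal p \<alpha> \<bullet> G (X p \<alpha>)) * (G (X p \<alpha>) \<bullet> m)"
      using arg_cong[OF N[OF x], of "\<lambda>v. v \<bullet> m"] by simp
    have nG: "normal p \<alpha> \<bullet> G (X p \<alpha>) \<noteq> 0"
    proof
      assume "normal p \<alpha> \<bullet> G (X p \<alpha>) = 0"
      then have "normal p \<alpha> = 0" using N[OF x] g by simp
      then show False using normal_nz by (simp add: normal_def)
    qed
    then have "(G (X p \<alpha>) \<bullet> G (X p \<alpha>)) * (normal p \<alpha> \<bullet> m) \<noteq> 0" using e pos[OF x] by simp
    then show "normal p \<alpha> \<bullet> m \<noteq> 0" by simp
    have "normal p \<alpha> = ((normal p \<alpha> \<bullet> G (X p \<alpha>)) / (G (X p \<alpha>) \<bullet> G (X p \<alpha>))) *\<^sub>R G (X p \<alpha>)"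
      using arg_cong[OF N[OF x], of "\<lambda>v. inverse (G (X p \<alpha>) \<bullet> G (X p \<alpha>)) *\<^sub>R v"] g
      by (simp add: divide_inverse mult.commute)
    also have "(normal p \<alpha> \<bullet> G (X p \<alpha>)) / (G (X p \<alpha>) \<bullet> G (X p \<alpha>)) = (normal p \<alpha> \<bullet> m) / (G (X p \<alpha>) \<bullet> m)"
    proof -
      have "G (X p \<alpha>) \<bullet> G (X p \<alpha>) \<noteq> 0" "G (X p \<alpha>) \<bullet> m \<noteq> 0" using g pos[OF x] by linarith+
      then show ?thesis using e by (metis frac_eq_eq mult.commute)
    qed
    finally show "normal p \<alpha> = (normal p \<alpha> \<bullet> m) *\<^sub>R (G (X p \<alpha>) /\<^sub>R (G (X p \<alpha>) \<bullet> m))"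
      unfolding divide_inverse scaleR_scaleR .
  next
    fix p \<alpha> q \<beta> s
    assume x: "X p \<alpha> \<in> ball a r" "X q \<beta> \<in> ball a r" "X p \<alpha> = X q \<beta> + s *\<^sub>R m"
    \<comment> \<open>F along the segment joining the two points, which stays in the ball by
      convexity. It vanishes at both ends, while its derivative is \<open>s\<close> times a positive
      number.\<close>
    define \<phi> where "\<phi> t = F (X q \<beta> + t *\<^sub>R (s *\<^sub>R m))" for t
    have seg: "X q \<beta> + t *\<^sub>R (s *\<^sub>R m) \<in> ball a r" if "0 \<le> t" "t \<le> 1" for t
    proof -
      have "(1 - t) *\<^sub>R X q \<beta> + t *\<^sub>R X p \<alpha> \<in> ball a r"
        by (rule convexD[OF convex_ball x(2,1)]) (use that in auto)
      then show ?thesis unfolding x(3) by (simp add: algebra_simps)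
    qed
    have d: "(\<phi> has_real_derivative s * (G (X q \<beta> + t *\<^sub>R (s *\<^sub>R m)) \<bullet> m)) (at t)" if "0 \<le> t" "t \<le> 1" for t
    proof -
      have "((\<lambda>t. X q \<beta> + t *\<^sub>R (s *\<^sub>R m)) has_derivative (\<lambda>h. h *\<^sub>R (s *\<^sub>R m))) (at t)"
        by (auto intro!: derivative_eq_intros)
      from has_derivative_compose[OF this F] seg[OF that] r(2)
      have "(\<phi> has_derivative (\<lambda>h. G (X q \<beta> + t *\<^sub>R (s *\<^sub>R m)) \<bullet> (h *\<^sub>R (s *\<^sub>R m)))) (at t)"
        unfolding \<phi>_def by blast
      then show ?thesis
        unfolding has_field_derivative_def by (rule has_derivative_eq_rhs) (auto simp: fun_eq_iff)
    qed
    obtain z where z: "0 < z" "z < 1" "\<phi> 1 - \<phi> 0 = (1 - 0) * (s * (G (X q \<beta> + z *\<^sub>R (s *\<^sub>R m)) \<bullet> m))"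
      using MVT2[of 0 1 \<phi> "\<lambda>t. s * (G (X q \<beta> + t *\<^sub>R (s *\<^sub>R m)) \<bullet> m)"] d by auto
    have "\<phi> 1 = 0" "\<phi> 0 = 0"
      using level[of p \<alpha>] level[of q \<beta>] x r(2) by (auto simp: \<phi>_def)
    then show "s = 0" using z pos[OF seg[of z]] by auto
  qed (use r G in \<open>auto simp: m_def\<close>)
qed

text \<open>The map \<open>(p, \<alpha>, s) \<mapsto> X p \<alpha> + s m\<close> is injective near \<open>a\<close> with Jacobian \<open>normal p \<alpha> \<bullet> m\<close>,
  and its image lies in a fixed ball.\<close>

lemma normal_component_not_bounded_below:
  assumes r: "\<And>p \<alpha>. p \<le> T \<Longrightarrow> X p \<alpha> \<in> ball a r"
    and inj: "\<And>p \<alpha> q \<beta> s. X p \<alpha> \<in> ball a r \<Longrightarrow> X q \<beta> \<in> ball a r \<Longrightarrow> X p \<alpha> = X q \<beta> + s *\<^sub>R m \<Longrightarrow> s = 0"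
    and "c > 0"
  shows "\<exists>p\<le>T. \<exists>\<alpha>\<in>{0..1}. \<bar>normal p \<alpha> \<bullet> m\<bar> < c"
proof (rule ccontr)
  assume "\<not> ?thesis"
  then have lower: "c \<le> \<bar>normal p \<alpha> \<bullet> m\<bar>" if "p \<le> T" "\<alpha> \<in> {0..1}" for p \<alpha> using that by force
  define Q where "Q v = X (v $ 1) (v $ 2) + v $ 3 *\<^sub>R m" for v :: "real^3"
  define Q' where "Q' v h = h $ 1 *\<^sub>R f (X (v $ 1) (v $ 2)) + h $ 2 *\<^sub>R X\<^sub>\<alpha> (v $ 1) (v $ 2) + h $ 3 *\<^sub>R m" for v h :: "real^3"
  have det: "det (matrix (Q' v)) = normal (v $ 1) (v $ 2) \<bullet> m" for v
    unfolding Q'_def[abs_def] det_matrix_columns normal_def ..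
  have Q: "(Q has_derivative Q' v) (at v within S)" for v S
  proof -
    have "((\<lambda>v::real^3. (v $ 1, v $ 2)) has_derivative (\<lambda>h. (h $ 1, h $ 2))) (at v within S)"
      by (intro derivative_intros bounded_linear_imp_has_derivative bounded_linear_vec_nth)
    from has_derivative_compose[OF this X_deriv]
    have "((\<lambda>v. X (v $ 1) (v $ 2)) has_derivative
        (\<lambda>h. h $ 1 *\<^sub>R f (X (v $ 1) (v $ 2)) + h $ 2 *\<^sub>R X\<^sub>\<alpha> (v $ 1) (v $ 2))) (at v within S)"
      by simp
    then show ?thesis
      unfolding Q_def[abs_def] Q'_def[abs_def]
      by (intro has_derivative_add bounded_linear.has_derivative[OF bounded_linear_scaleR_left]
          bounded_linear_imp_has_derivative[OF bounded_linear_vec_nth])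
  qed
  \<comment> \<open>Labels fill only half a turn, so that this closed box fits into the half-open
    range where \<open>X\<close> is injective. Its volume is \<open>n / 2\<close>, growing with the
    length of the time interval.\<close>
  define B where "B n = cbox (vector [T - real n, 0, 0]) (vector [T, 1/2, 1] :: real^3)" for n :: nat
  have B: "v \<in> B n \<longleftrightarrow> T - real n \<le> v $ 1 \<and> v $ 1 \<le> T \<and> 0 \<le> v $ 2 \<and> v $ 2 \<le> 1/2 \<and> 0 \<le> v $ 3 \<and> v $ 3 \<le> 1" for v n
    by (auto simp: B_def mem_box_cart forall_3)
  have "inj_on Q (B n)" for n
  proof (rule inj_onI)
    fix v w assume v: "v \<in> B n" and w: "w \<in> B n" and eq: "Q v = Q w"
    then have "X (v $ 1) (v $ 2) = X (w $ 1) (w $ 2) + (w $ 3 - v $ 3) *\<^sub>R m"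
      by (simp add: Q_def algebra_simps)
    moreover from this have "w $ 3 - v $ 3 = 0"
      by (rule inj[rotated 2]) (use v w r in \<open>auto simp: B\<close>)
    ultimately have "case_prod X (v $ 1, v $ 2) = case_prod X (w $ 1, w $ 2)" by simp
    from inj_onD[OF X_inj this] have "(v $ 1, v $ 2) = (w $ 1, w $ 2)"
      using v w by (auto simp: B)
    then show "v = w" using \<open>w $ 3 - v $ 3 = 0\<close> by (simp add: vec_eq_iff forall_3)
  qed
  moreover have int: "(\<lambda>v. \<bar>det (matrix (Q' v))\<bar>) integrable_on B n" for n
    unfolding det B_def by (intro integrable_continuous continuous_intros)
  moreover have "B n \<in> sets lebesgue" for n by (simp add: B_def)
  ultimately have meas: "Q ` B n \<in> lmeasurable" "measure lebesgue (Q ` B n) = integral (B n) (\<lambda>v. \<bar>det (matrix (Q' v))\<bar>)" for n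
    using measure_differentiable_image_eq[OF _ Q] measurable_differentiable_image_eq[OF _ Q] by blast+
  have "c * (real n / 2) \<le> measure lebesgue (Q ` B n)" for n
  proof -
    have "vector [T, 0, 0] \<in> B n" unfolding B by simp
    then have "cbox (vector [T - real n, 0, 0]) (vector [T, 1/2, 1] :: real^3) \<noteq> {}"
      unfolding B_def by blast
    from content_cbox_cart[OF this]
    have "measure lborel (B n) = (\<Prod>i\<in>{1, 2, 3}. (vector [T, 1/2, 1] :: real^3) $ i - (vector [T - real n, 0, 0] :: real^3) $ i)"
      unfolding B_def UNIV_3 .
    also have "\<dots> = real n / 2" by simp
    finally have "measure lborel (B n) = real n / 2" .
    then have "c * (real n / 2) = integral (B n) (\<lambda>v. c)"
      unfolding B_def integral_const by simp
    also have "\<dots> \<le> integral (B n) (\<lambda>v. \<bar>det (matrix (Q' v))\<bar>)"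
    proof (rule integral_le[OF _ int])
      show "(\<lambda>v. c) integrable_on B n" unfolding B_def by (rule integrable_const)
      show "c \<le> \<bar>det (matrix (Q' v))\<bar>" if "v \<in> B n" for v
        unfolding det using that by (intro lower) (auto simp: B)
    qed
    finally show ?thesis using meas by simp
  qed
  moreover have "measure lebesgue (Q ` B n) \<le> measure lebesgue (ball a (r + norm m))" for n
  proof (rule measure_mono_fmeasurable)
    show "Q ` B n \<subseteq> ball a (r + norm m)"
    proof
      fix x assume "x \<in> Q ` B n"
      then obtain v where v: "v \<in> B n" "x = Q v" by auto
      have "norm (v $ 3 *\<^sub>R m) \<le> norm m" using v(1) by (auto simp: B intro!: mult_left_le_one_le)
      moreover have "dist a (X (v $ 1) (v $ 2)) < r" using r v(1) by (auto simp: B)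
      moreover have "dist a x \<le> dist a (X (v $ 1) (v $ 2)) + dist (X (v $ 1) (v $ 2)) x" by (rule dist_triangle)
      ultimately show "x \<in> ball a (r + norm m)" by (simp add: v(2) Q_def dist_norm)
    qed
  qed (use meas in auto)
  ultimately have *: "c * (real n / 2) \<le> measure lebesgue (ball a (r + norm m))" for n
    using order_trans by blast
  obtain n where "real n > 2 * measure lebesgue (ball a (r + norm m)) / c" using reals_Archimedean2 by blast
  then show False using *[of n] \<open>c > 0\<close> by (simp add: field_simps)
qed

lemma normal_exponential_decay_at_bot:
  obtains C c T where "c > 0" "\<And>p \<alpha>. p \<le> T \<Longrightarrow> norm (normal p \<alpha>) \<le> C * exp (c * p)"
proof -
  obtain r m \<zeta> where r: "r > 0" "m \<noteq> 0" "ball a r \<subseteq> \<Omega>"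
    and \<zeta>: "continuous_on (ball a r) \<zeta>" "\<zeta> a = m /\<^sub>R (m \<bullet> m)"
    and nz: "\<And>p \<alpha>. X p \<alpha> \<in> ball a r \<Longrightarrow> normal p \<alpha> \<bullet> m \<noteq> 0"
    and N: "\<And>p \<alpha>. X p \<alpha> \<in> ball a r \<Longrightarrow> normal p \<alpha> = (normal p \<alpha> \<bullet> m) *\<^sub>R \<zeta> (X p \<alpha>)"
    and inj: "\<And>p \<alpha> q \<beta> s. X p \<alpha> \<in> ball a r \<Longrightarrow> X q \<beta> \<in> ball a r \<Longrightarrow> X p \<alpha> = X q \<beta> + s *\<^sub>R m \<Longrightarrow> s = 0"
    by (rule normal_form_near_a) (rule that, assumption+)
  define \<psi> where "\<psi> p \<alpha> = normal p \<alpha> \<bullet> m" for p \<alpha>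
  define \<kappa> where "\<kappa> x = - (\<zeta> x \<bullet> f' x m)" for x
  have f'c: "continuous_on (ball a r) (\<lambda>x. f' x w)" for w
    by (intro continuous_intros continuous_on_subset[OF f'_cont] r)
  have at_a: "(g \<longlongrightarrow> g a) (nhds a)" if "continuous_on (ball a r) g" for g :: "real^3 \<Rightarrow> real"
    using continuous_on_interior[OF that] r(1) by (simp add: isCont_def tendsto_nhds_iff)
  have \<kappa>c: "continuous_on (ball a r) \<kappa>"
    unfolding \<kappa>_def by (intro continuous_intros \<zeta> f'c)
  \<comment> \<open>Inserting the form of the normal into its derivative closes the equation: a
    scalar linear equation whose coefficient depends on the position alone.\<close>
  have \<psi>': "((\<lambda>q. \<psi> q \<alpha>) has_real_derivative \<psi> p \<alpha> * \<kappa> (X p \<alpha>)) (at p)" if "X p \<alpha> \<in> ball a r" for p \<alpha>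
  proof -
    have "- (normal p \<alpha> \<bullet> f' (X p \<alpha>) m) = \<psi> p \<alpha> * \<kappa> (X p \<alpha>)"
      by (subst N[OF that]) (simp add: \<psi>_def \<kappa>_def)
    then show ?thesis using normal_deriv[of \<alpha> m p] by (simp add: \<psi>_def)
  qed
  have near: "\<exists>T. \<forall>p\<le>T. \<forall>\<alpha>. X p \<alpha> \<in> ball a r \<and> P (X p \<alpha>)" if "eventually P (nhds a)" for P
  proof -
    from that obtain e where e: "e > 0" "\<And>x. dist x a < e \<Longrightarrow> P x" unfolding eventually_nhds_metric by blast
    obtain T where "\<And>p \<alpha>. p \<le> T \<Longrightarrow> norm (X p \<alpha> - a) < min r e"
      using uniform_limit_a[of "min r e"] e(1) r(1) by auto
    then show ?thesis using e(2) by (intro exI[of _ T]) (auto simp: dist_norm norm_minus_commute)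
  qed
  \<comment> \<open>\<open>(normal p 0 \<bullet> w) / \<psi> p 0\<close> converges as \<open>p \<rightarrow> -\<infinity>\<close>, so the limit of its derivative vanishes.\<close>
  have "\<kappa> a \<noteq> 0"
  proof
    assume 0: "\<kappa> a = 0"
    have "\<zeta> a \<bullet> f' a w = 0" for w
    proof -
      \<comment> \<open>Near \<open>a\<close> the quotient equals
        \<open>\<zeta> (X p 0) \<bullet> w\<close>, and the quotient rule cancels every factor of
        \<open>\<psi>\<close>. Hence its derivative is a continuous function of the position and has
        a limit at \<open>a\<close>.\<close>
      define R' where "R' x = - (\<zeta> x \<bullet> f' x w) - (\<zeta> x \<bullet> w) * \<kappa> x" for x
      obtain T where T: "\<And>p. p \<le> T \<Longrightarrow> X p 0 \<in> ball a r" using near[of "\<lambda>_. True"] by auto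
      have X0: "filterlim (\<lambda>p. X p 0) (nhds a) at_bot" by (rule X_lim_a)
      have "- (\<zeta> a \<bullet> f' a w) - (\<zeta> a \<bullet> w) * \<kappa> a = 0"
      proof (rule derivative_limit_at_bot_zero)
        show "eventually (\<lambda>p. ((\<lambda>p. (normal p 0 \<bullet> w) / \<psi> p 0) has_real_derivative R' (X p 0)) (at p)) at_bot"
          using eventually_le_at_bot[of T]
        proof eventually_elim
          case (elim p)
          note x = T[OF elim]
          have nw: "normal p 0 \<bullet> v = \<psi> p 0 * (\<zeta> (X p 0) \<bullet> v)" for v
            using arg_cong[OF N[OF x], of "\<lambda>u. u \<bullet> v"] by (simp add: \<psi>_def)
          have "((\<lambda>p. (normal p 0 \<bullet> w) / \<psi> p 0) has_real_derivative
             ((- (normal p 0 \<bullet> f' (X p 0) w)) * \<psi> p 0 - (normal p 0 \<bullet> w) * (\<psi> p 0 * \<kappa> (X p 0))) / (\<psi> p 0 * \<psi> p 0)) (at p)"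
            by (rule DERIV_divide[OF normal_deriv \<psi>'[OF x]]) (use nz[OF x] in \<open>simp add: \<psi>_def\<close>)
          moreover have "((- (normal p 0 \<bullet> f' (X p 0) w)) * \<psi> p 0 - (normal p 0 \<bullet> w) * (\<psi> p 0 * \<kappa> (X p 0))) / (\<psi> p 0 * \<psi> p 0) = R' (X p 0)"
            using nz[OF x] unfolding nw R'_def \<psi>_def[symmetric] by (simp add: field_simps)
          ultimately show ?case by simp
        qed
        have "continuous_on (ball a r) R'"
          unfolding R'_def by (intro continuous_intros \<zeta> f'c \<kappa>c)
        from filterlim_compose[OF at_a[OF this] X0]
        show "((\<lambda>p. R' (X p 0)) \<longlongrightarrow> - (\<zeta> a \<bullet> f' a w) - (\<zeta> a \<bullet> w) * \<kappa> a) at_bot"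
          by (simp add: R'_def)
        have "continuous_on (ball a r) (\<lambda>x. \<zeta> x \<bullet> w)" by (intro continuous_intros \<zeta>)
        from filterlim_compose[OF at_a[OF this] X0]
        have "((\<lambda>p. \<zeta> (X p 0) \<bullet> w) \<longlongrightarrow> \<zeta> a \<bullet> w) at_bot" .
        moreover have "eventually (\<lambda>p. \<zeta> (X p 0) \<bullet> w = (normal p 0 \<bullet> w) / \<psi> p 0) at_bot"
          using eventually_le_at_bot[of T]
        proof eventually_elim
          case (elim p)
          show ?case
            using nz[OF T[OF elim]] arg_cong[OF N[OF T[OF elim]], of "\<lambda>u. u \<bullet> w"] by (simp add: \<psi>_def field_simps)
        qed
        ultimately show "((\<lambda>p. (normal p 0 \<bullet> w) / \<psi> p 0) \<longlongrightarrow> \<zeta> a \<bullet> w) at_bot"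
          by (rule Lim_transform_eventually)
      qed
      then show ?thesis using 0 by simp
    qed
    \<comment> \<open>Thus \<open>m\<close> is orthogonal to the range of \<open>f' a\<close>.
      Surjectivity allows a \<open>w\<close> mapped to \<open>m\<close> itself, which forces
      \<open>m = 0\<close>.\<close>
    then have "m \<bullet> f' a w = 0" for w using r(2) by (simp add: \<zeta>)
    moreover obtain w where "f' a w = m" using surj_a by (metis surjD)
    ultimately show False using r(2) by (metis inner_eq_zero_iff)
  qed
  moreover have "\<not> \<kappa> a < 0"
  proof
    assume "\<kappa> a < 0"
    with at_a[OF \<kappa>c] have "eventually (\<lambda>x. \<kappa> x < 0) (nhds a)" by (rule order_tendstoD)
    from near[OF this] obtain T where T: "\<And>p \<alpha>. p \<le> T \<Longrightarrow> X p \<alpha> \<in> ball a r" "\<And>p \<alpha>. p \<le> T \<Longrightarrow> \<kappa> (X p \<alpha>) < 0"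
      by blast
    \<comment> \<open>The minimum of the modulus of \<open>\<psi>\<close> over all labels at time
      \<open>T\<close> will be the lower bound that the volume argument contradicts.\<close>
    have "continuous_on {0..1} (\<lambda>\<alpha>. \<bar>\<psi> T \<alpha>\<bar>)"
      unfolding \<psi>_def by (intro continuous_intros)
    then obtain \<alpha>0 where \<alpha>0: "\<alpha>0 \<in> {0..1}" "\<And>\<alpha>. \<alpha> \<in> {0..1} \<Longrightarrow> \<bar>\<psi> T \<alpha>0\<bar> \<le> \<bar>\<psi> T \<alpha>\<bar>"
      using continuous_attains_inf[of "{0..1::real}" "\<lambda>\<alpha>. \<bar>\<psi> T \<alpha>\<bar>"] by auto
    have "\<bar>\<psi> T \<alpha>0\<bar> > 0" using nz[OF T(1)[of T \<alpha>0]] by (simp add: \<psi>_def)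
    then have "\<exists>p\<le>T. \<exists>\<alpha>\<in>{0..1}. \<bar>normal p \<alpha> \<bullet> m\<bar> < \<bar>\<psi> T \<alpha>0\<bar>"
      by (rule normal_component_not_bounded_below[where r = r, rotated 2]) (fact T(1), fact inj)
    then obtain p \<alpha> where p: "p \<le> T" "\<alpha> \<in> {0..1}" "\<bar>\<psi> p \<alpha>\<bar> < \<bar>\<psi> T \<alpha>0\<bar>"
      unfolding \<psi>_def by blast
    \<comment> \<open>With a negative rate the square of \<open>\<psi>\<close> can only grow when
      going back in time, so the value at \<open>p\<close> cannot fall below the one at
      \<open>T\<close>.\<close>
    have "(\<psi> T \<alpha>)\<^sup>2 \<le> (\<psi> p \<alpha>)\<^sup>2"
    proof (rule DERIV_nonpos_imp_nonincreasing[OF p(1)])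
      fix q assume "p \<le> q" "q \<le> T"
      have "((\<lambda>q. (\<psi> q \<alpha>)\<^sup>2) has_real_derivative 2 * (\<psi> q \<alpha>)\<^sup>2 * \<kappa> (X q \<alpha>)) (at q)"
        using \<psi>'[OF T(1)[OF \<open>q \<le> T\<close>], of \<alpha>] by (auto intro!: derivative_eq_intros simp: power2_eq_square)
      moreover have "2 * (\<psi> q \<alpha>)\<^sup>2 * \<kappa> (X q \<alpha>) \<le> 0"
        using T(2)[OF \<open>q \<le> T\<close>, of \<alpha>] by (simp add: mult_nonneg_nonpos)
      ultimately show "\<exists>y. ((\<lambda>q. (\<psi> q \<alpha>)\<^sup>2) has_real_derivative y) (at q) \<and> y \<le> 0" by blast
    qed
    then have "\<bar>\<psi> T \<alpha>\<bar> \<le> \<bar>\<psi> p \<alpha>\<bar>" by (simp add: abs_le_square_iff)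
    then show False using p \<alpha>0(2)[OF p(2)] by linarith
  qed
  ultimately have pos: "\<kappa> a > 0" by linarith
  \<comment> \<open>Half the limiting rate is a strict lower bound for \<open>\<kappa>\<close> in a
    neighbourhood of \<open>a\<close>, and all labels enter it before one common time.\<close>
  define c where "c = \<kappa> a / 2"
  have c: "c > 0" using pos by (simp add: c_def)
  have "eventually (\<lambda>x. c < \<kappa> x) (nhds a)"
    using at_a[OF \<kappa>c] by (rule order_tendstoD) (use pos in \<open>simp add: c_def\<close>)
  moreover have "eventually (\<lambda>x. norm (\<zeta> x) < norm (\<zeta> a) + 1) (nhds a)"
    by (rule order_tendstoD(2)[OF at_a]) (auto intro!: continuous_intros \<zeta>)
  ultimately have "eventually (\<lambda>x. c < \<kappa> x \<and> norm (\<zeta> x) < norm (\<zeta> a) + 1) (nhds a)"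
    by (rule eventually_conj)
  from near[OF this] obtain T where T: "\<And>p \<alpha>. p \<le> T \<Longrightarrow> X p \<alpha> \<in> ball a r" "\<And>p \<alpha>. p \<le> T \<Longrightarrow> c < \<kappa> (X p \<alpha>)"
      "\<And>p \<alpha>. p \<le> T \<Longrightarrow> norm (\<zeta> (X p \<alpha>)) < norm (\<zeta> a) + 1"
    by blast
  have "compact ((\<lambda>\<alpha>. \<psi> T \<alpha>) ` {0..1})"
    unfolding \<psi>_def by (intro compact_continuous_image continuous_intros) auto
  then obtain B where B: "\<And>\<alpha>. \<alpha> \<in> {0..1} \<Longrightarrow> \<bar>\<psi> T \<alpha>\<bar> \<le> B"
    using compact_imp_bounded bounded_iff by (metis imageI real_norm_def)
  have bound: "norm (normal p \<alpha>) \<le> ((norm (\<zeta> a) + 1) * B * exp (- c * T)) * exp (c * p)" if "p \<le> T" "\<alpha> \<in> {0..1}" for p \<alpha>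
  proof -
    \<comment> \<open>Its logarithmic derivative is \<open>2 * (\<kappa> - c)\<close>, which is
      positive here; comparing \<open>p\<close> with \<open>T\<close> then gives decay at rate
      \<open>c\<close>. Squaring makes the sign of \<open>\<psi>\<close> irrelevant.\<close>
    define u where "u q = (\<psi> q \<alpha>)\<^sup>2 * exp (- 2 * c * q)" for q
    have "u p \<le> u T"
    proof (rule DERIV_nonneg_imp_nondecreasing[OF that(1)])
      fix q assume "p \<le> q" "q \<le> T"
      have "(u has_real_derivative 2 * ((\<psi> q \<alpha>)\<^sup>2 * exp (- 2 * c * q)) * (\<kappa> (X q \<alpha>) - c)) (at q)"
        unfolding u_def using \<psi>'[OF T(1)[OF \<open>q \<le> T\<close>], of \<alpha>]
        by (auto intro!: derivative_eq_intros simp: power2_eq_square algebra_simps)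
      moreover have "2 * ((\<psi> q \<alpha>)\<^sup>2 * exp (- 2 * c * q)) * (\<kappa> (X q \<alpha>) - c) \<ge> 0"
        using T(2)[OF \<open>q \<le> T\<close>, of \<alpha>] by simp
      ultimately show "\<exists>y. (u has_real_derivative y) (at q) \<and> y \<ge> 0" by blast
    qed
    then have "exp (2 * c * p) * u p \<le> exp (2 * c * p) * u T" by (intro mult_left_mono) auto
    then have "(\<psi> p \<alpha>)\<^sup>2 \<le> (\<psi> T \<alpha>)\<^sup>2 * exp (2 * c * (p - T))"
      unfolding u_def by (simp add: mult.left_commute exp_add[symmetric] algebra_simps)
    also have "\<dots> = (\<bar>\<psi> T \<alpha>\<bar> * exp (c * (p - T)))\<^sup>2"
      by (simp add: power_mult_distrib power2_eq_square exp_add[symmetric] algebra_simps)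
    finally have "\<bar>\<psi> p \<alpha>\<bar> \<le> \<bar>\<psi> T \<alpha>\<bar> * exp (c * (p - T))"
      by (simp add: abs_le_square_iff[symmetric] abs_mult)
    also have "\<dots> \<le> B * exp (c * (p - T))" by (intro mult_right_mono B that) auto
    finally have 1: "\<bar>\<psi> p \<alpha>\<bar> \<le> B * exp (c * (p - T))" .
    have "norm (normal p \<alpha>) = \<bar>\<psi> p \<alpha>\<bar> * norm (\<zeta> (X p \<alpha>))"
      by (subst N[OF T(1)[OF that(1)]]) (simp add: \<psi>_def)
    also have "\<dots> \<le> (B * exp (c * (p - T))) * (norm (\<zeta> a) + 1)"
      using T(3)[OF that(1), of \<alpha>] by (intro mult_mono 1 order_trans[OF abs_ge_zero 1]) auto
    also have "\<dots> = ((norm (\<zeta> a) + 1) * B * exp (- c * T)) * exp (c * p)"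
      by (simp add: algebra_simps exp_add[symmetric] exp_diff exp_minus field_simps)
    finally show ?thesis .
  qed
  show thesis
  proof (rule that[OF c])
    fix p \<alpha> assume "p \<le> T"
    then show "norm (normal p \<alpha>) \<le> ((norm (\<zeta> a) + 1) * B * exp (- c * T)) * exp (c * p)"
      using bound[of p "frac \<alpha>"] normal_frac[of p \<alpha>] frac_lt_1[of \<alpha>] by (simp add: less_imp_le)
  qed
qed

end

section \<open>Volumes in tubular coordinates\<close>

lemma measurable_vec3: "(\<lambda>((p, \<alpha>), r). vector [p, \<alpha>, r] :: real^3) \<in> borel_measurable borel"
proof -
  have "(\<lambda>((p, \<alpha>), r). vector [p, \<alpha>, r] :: real^3)
      = (\<lambda>z. fst (fst z) *\<^sub>R axis 1 1 + snd (fst z) *\<^sub>R axis 2 1 + snd z *\<^sub>R axis 3 1)"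
    by (auto simp: fun_eq_iff vec_eq_iff forall_3 axis_def)
  then show ?thesis
    by (auto intro!: borel_measurable_continuous_onI continuous_intros)
qed

text \<open>It suffices to compare the measures of boxes. This identification lets Fubini for pairs
  act on \<open>real^3\<close>, where the change of variables for volumes is stated.\<close>

lemma lborel_vec3: "lborel = distr lborel borel (\<lambda>((p, \<alpha>), r). vector [p, \<alpha>, r] :: real^3)"
proof (rule lborel_eqI)
  let ?T = "\<lambda>((p, \<alpha>), r). vector [p, \<alpha>, r] :: real^3"
  have T: "?T \<in> borel_measurable borel"
    by (rule measurable_vec3)
  fix l u :: "real^3" assume le: "\<And>b. b \<in> Basis \<Longrightarrow> l \<bullet> b \<le> u \<bullet> b"
  have lu: "l $ i \<le> u $ i" for i
    using le[of "axis i 1"] by (simp add: inner_axis)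
  have prod_eq: "(\<Prod>i\<in>UNIV. u $ i - l $ i) = (\<Prod>b\<in>Basis. (u - l) \<bullet> b)"
  proof -
    have "cbox l u \<noteq> {}" using le by (simp add: box_ne_empty)
    from content_cbox_cart[OF this] content_cbox'[OF this] show ?thesis
      unfolding inner_diff_left by (rule trans[OF sym])
  qed
  have eq: "?T -` box l u = ({l $ 1<..<u $ 1} \<times> {l $ 2<..<u $ 2}) \<times> {l $ 3<..<u $ 3}"
    by (auto simp: mem_box_cart forall_3)
  have "emeasure (distr lborel borel ?T) (box l u) = emeasure lborel (?T -` box l u)"
    using T by (subst emeasure_distr) auto
  also have "\<dots> = ennreal (u $ 1 - l $ 1) * ennreal (u $ 2 - l $ 2) * ennreal (u $ 3 - l $ 3)"
    unfolding eq lborel_prod[symmetric]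
    by (simp add: lborel.emeasure_pair_measure_Times lborel_pair.P.emeasure_pair_measure_Times lu)
  also have "\<dots> = ennreal (\<Prod>i\<in>UNIV. u $ i - l $ i)"
  proof -
    have "(\<Prod>i\<in>UNIV. u $ i - l $ i) = (u $ 1 - l $ 1) * ((u $ 2 - l $ 2) * (u $ 3 - l $ 3))"
      unfolding UNIV_3 by simp
    then show ?thesis
      by (simp only: ennreal_mult lu diff_ge_0_iff_ge mult_nonneg_nonneg mult.assoc)
  qed
  also have "\<dots> = ennreal (\<Prod>b\<in>Basis. (u - l) \<bullet> b)"
    unfolding prod_eq ..
  finally show "emeasure (distr lborel borel ?T) (box l u) = (\<Prod>b\<in>Basis. (u - l) \<bullet> b)" .
qed simp

text \<open>Fubini in the third coordinate: the weight is constant on each vertical fibre, and the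
  fibre has length \<open>\<bar>hi z - lo z\<bar>\<close>. Using \<open>closed_segment\<close>
  covers both orders of the graphs, as the two perturbed manifolds exchange sides from one lobe to
  the next. The weights used later are the area density and 1.\<close>

lemma integral_between_graphs:
  fixes lo hi w :: "real \<times> real \<Rightarrow> real" and D :: "(real \<times> real) set"
  defines "S \<equiv> {v::real^3. (v $ 1, v $ 2) \<in> D \<and> v $ 3 \<in> closed_segment (lo (v $ 1, v $ 2)) (hi (v $ 1, v $ 2))}"
  assumes [measurable]: "D \<in> sets borel" "lo \<in> borel_measurable borel" "hi \<in> borel_measurable borel" "w \<in> borel_measurable borel"
    and D: "bounded D"
    and bd: "\<And>z. z \<in> D \<Longrightarrow> \<bar>lo z\<bar> \<le> B" "\<And>z. z \<in> D \<Longrightarrow> \<bar>hi z\<bar> \<le> B" "\<And>z. z \<in> D \<Longrightarrow> \<bar>w z\<bar> \<le> W"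
  shows "S \<in> sets borel" "bounded S"
    "set_integrable lborel S (\<lambda>v. w (v $ 1, v $ 2))"
    "(LINT v:S|lborel. w (v $ 1, v $ 2)) = (LINT z:D|lborel. \<bar>hi z - lo z\<bar> * w z)"
proof -
  have coord [measurable]: "(\<lambda>v::real^3. v $ i) \<in> borel_measurable borel" for i
    by (intro borel_measurable_continuous_onI continuous_intros)
  have S_eq: "S = {v. (v $ 1, v $ 2) \<in> D \<and> min (lo (v $ 1, v $ 2)) (hi (v $ 1, v $ 2)) \<le> v $ 3 \<and> v $ 3 \<le> max (lo (v $ 1, v $ 2)) (hi (v $ 1, v $ 2))}"
    unfolding S_def closed_segment_eq_real_ivl by (auto simp: min_def max_def)
  have pair [measurable]: "(\<lambda>v::real^3. (v $ 1, v $ 2)) \<in> borel \<rightarrow>\<^sub>M borel"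
    by (intro borel_measurable_continuous_onI continuous_intros)
  show S [measurable]: "S \<in> sets borel"
    unfolding S_eq by measurable
  obtain R where R: "\<And>z. z \<in> D \<Longrightarrow> norm z \<le> R"
    using D bounded_iff by blast
  have inS: "norm (v $ 1, v $ 2) \<le> R \<and> \<bar>v $ 3\<bar> \<le> B" if "v \<in> S" for v
    using that R[of "(v $ 1, v $ 2)"] bd(1,2)[of "(v $ 1, v $ 2)"] unfolding S_eq by (auto simp: min_def max_def split: if_splits)
  show bS: "bounded S"
  proof (rule boundedI)
    fix v assume v: "v \<in> S"
    have "\<bar>v $ 1\<bar> \<le> R" "\<bar>v $ 2\<bar> \<le> R" "\<bar>v $ 3\<bar> \<le> B"
      using inS[OF v] norm_fst_le[of "v $ 1" "v $ 2"] norm_snd_le[of "v $ 2" "v $ 1"] by auto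
    then show "norm v \<le> R + R + B"
      using norm_le_l1_cart[of v] by (simp add: sum_3)
  qed
  have fS: "emeasure lborel S < \<infinity>" by (rule emeasure_bounded_finite[OF bS])
  show int: "set_integrable lborel S (\<lambda>v. w (v $ 1, v $ 2))"
  proof (rule set_integrable_bound[where f = "\<lambda>_. W"])
    show "set_integrable lborel S (\<lambda>_. W)"
      using fS by (auto simp: set_integrable_def)
    show "set_borel_measurable lborel S (\<lambda>v. w (v $ 1, v $ 2))"
      unfolding set_borel_measurable_def by measurable
    show "AE v in lborel. v \<in> S \<longrightarrow> norm (w (v $ 1, v $ 2)) \<le> norm W"
      using bd(3) by (intro AE_I2) (force simp: S_def)
  qed
  let ?T = "\<lambda>((p, \<alpha>), r). vector [p, \<alpha>, r] :: real^3"
  have T [measurable]: "?T \<in> borel_measurable borel"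
    by (rule measurable_vec3)
  let ?h = "\<lambda>(z, r). indicator D z * (indicator (closed_segment (lo z) (hi z)) r * w z) :: real"
  have h: "(\<lambda>x. indicator S (?T x) *\<^sub>R w (?T x $ 1, ?T x $ 2)) = ?h"
    by (auto simp: fun_eq_iff S_def indicator_def)
  have m: "(\<lambda>v. indicator S v *\<^sub>R w (v $ 1, v $ 2)) \<in> borel_measurable borel"
    by measurable
  have "(LINT v:S|lborel. w (v $ 1, v $ 2)) = (LINT v|distr lborel borel ?T. indicator S v *\<^sub>R w (v $ 1, v $ 2))"
    unfolding set_lebesgue_integral_def by (subst lborel_vec3) simp
  also have "\<dots> = (LINT x|lborel. indicator S (?T x) *\<^sub>R w (?T x $ 1, ?T x $ 2))"
    by (rule integral_distr) (simp_all add: T m)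
  also have "\<dots> = (LINT x|lborel. ?h x)"
    unfolding h ..
  finally have 1: "(LINT v:S|lborel. w (v $ 1, v $ 2)) = (LINT x|(lborel \<Otimes>\<^sub>M lborel). ?h x)"
    by (simp add: lborel_prod)
  have "integrable (distr lborel borel ?T) (\<lambda>v. indicator S v *\<^sub>R w (v $ 1, v $ 2))"
    using int unfolding set_integrable_def by (subst lborel_vec3[symmetric])
  then have "integrable lborel (\<lambda>x. indicator S (?T x) *\<^sub>R w (?T x $ 1, ?T x $ 2))"
    by (rule integrable_distr[rotated]) (simp add: T)
  then have "integrable lborel ?h"
    unfolding h .
  then have "integrable (lborel \<Otimes>\<^sub>M lborel) ?h" by (simp add: lborel_prod)
  from lborel_pair.integral_fst'[OF this] 1
  have "(LINT v:S|lborel. w (v $ 1, v $ 2)) = (LINT z|lborel. LINT r|lborel. ?h (z, r))" by simp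
  also have "\<dots> = (LINT z:D|lborel. \<bar>hi z - lo z\<bar> * w z)"
  proof -
    have seg: "(LINT r|lborel. indicator (closed_segment x y) r) = \<bar>y - x\<bar>" for x y :: real
      by (simp add: closed_segment_eq_real_ivl)
    have "(LINT r|lborel. ?h (z, r)) = indicator D z *\<^sub>R (\<bar>hi z - lo z\<bar> * w z)" for z
      by (simp only: prod.case integral_mult_right_zero integral_mult_left_zero seg real_scaleR_def)
    then show ?thesis by (simp only: set_lebesgue_integral_def)
  qed
  finally show "(LINT v:S|lborel. w (v $ 1, v $ 2)) = (LINT z:D|lborel. \<bar>hi z - lo z\<bar> * w z)" .
qed

lemma continuous_on_case_prod2:
  assumes "continuous_on UNIV (case_prod g)" "continuous_on S p" "continuous_on S \<alpha>"
  shows "continuous_on S (\<lambda>x. g (p x) (\<alpha> x))"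
  using continuous_on_compose2[OF assms(1) continuous_on_Pair[OF assms(2,3)]] by auto

text \<open>A surface with a periodic transversal field \<open>\<nu>\<close>, positively oriented by
  \<open>normal_pos\<close>. The partial derivatives are explicit parameters, so the columns of the
  Jacobian matrix of the tubular map are available as continuous functions.\<close>

locale tube =
  fixes X X\<^sub>p X\<^sub>\<alpha> \<nu> \<nu>\<^sub>p \<nu>\<^sub>\<alpha> :: "real \<Rightarrow> real \<Rightarrow> real^3"
  assumes X_deriv: "\<And>p \<alpha>. (case_prod X has_derivative (\<lambda>(s, u). s *\<^sub>R X\<^sub>p p \<alpha> + u *\<^sub>R X\<^sub>\<alpha> p \<alpha>)) (at (p, \<alpha>))"
    and \<nu>_deriv: "\<And>p \<alpha>. (case_prod \<nu> has_derivative (\<lambda>(s, u). s *\<^sub>R \<nu>\<^sub>p p \<alpha> + u *\<^sub>R \<nu>\<^sub>\<alpha> p \<alpha>)) (at (p, \<alpha>))"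
    and Xp_cont: "continuous_on UNIV (case_prod X\<^sub>p)"
    and X\<alpha>_cont: "continuous_on UNIV (case_prod X\<^sub>\<alpha>)"
    and \<nu>p_cont: "continuous_on UNIV (case_prod \<nu>\<^sub>p)"
    and \<nu>\<alpha>_cont: "continuous_on UNIV (case_prod \<nu>\<^sub>\<alpha>)"
    and X_periodic: "\<And>p \<alpha>. X p (\<alpha> + 1) = X p \<alpha>"
    and \<nu>_periodic: "\<And>p \<alpha>. \<nu> p (\<alpha> + 1) = \<nu> p \<alpha>"
    and X_inj: "inj_on (case_prod X) {(p, \<alpha>). \<alpha> \<in> {0..<1}}"
    and normal_pos: "\<And>p \<alpha>. cross3 (X\<^sub>p p \<alpha>) (X\<^sub>\<alpha> p \<alpha>) \<bullet> \<nu> p \<alpha> > 0"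
begin

text \<open>When \<open>\<nu>\<close> is the unit normal, this is the norm of the cross product of
  the tangent vectors, hence the density of surface area; in general it is the Jacobian at height
  zero.\<close>

definition area :: "real \<Rightarrow> real \<Rightarrow> real" where
  "area p \<alpha> = cross3 (X\<^sub>p p \<alpha>) (X\<^sub>\<alpha> p \<alpha>) \<bullet> \<nu> p \<alpha>"

definition coords :: "real^3 \<Rightarrow> real^3" where
  "coords v = X (v $ 1) (v $ 2) + v $ 3 *\<^sub>R \<nu> (v $ 1) (v $ 2)"

definition jac :: "real^3 \<Rightarrow> real" where
  "jac v = cross3 (X\<^sub>p (v $ 1) (v $ 2) + v $ 3 *\<^sub>R \<nu>\<^sub>p (v $ 1) (v $ 2))
      (X\<^sub>\<alpha> (v $ 1) (v $ 2) + v $ 3 *\<^sub>R \<nu>\<^sub>\<alpha> (v $ 1) (v $ 2)) \<bullet> \<nu> (v $ 1) (v $ 2)"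

definition coords' :: "real^3 \<Rightarrow> real^3 \<Rightarrow> real^3" where
  "coords' v h = h $ 1 *\<^sub>R (X\<^sub>p (v $ 1) (v $ 2) + v $ 3 *\<^sub>R \<nu>\<^sub>p (v $ 1) (v $ 2))
     + h $ 2 *\<^sub>R (X\<^sub>\<alpha> (v $ 1) (v $ 2) + v $ 3 *\<^sub>R \<nu>\<^sub>\<alpha> (v $ 1) (v $ 2))
     + h $ 3 *\<^sub>R \<nu> (v $ 1) (v $ 2)"

lemma det_coords': "det (matrix (coords' v)) = jac v"
  unfolding coords'_def[abs_def] det_matrix_columns jac_def ..

lemma X_cont: "continuous_on UNIV (case_prod X)"
proof -
  have "isCont (case_prod X) z" for z
    by (cases z) (simp only: has_derivative_continuous[OF X_deriv])
  then show ?thesis by (simp add: continuous_at_imp_continuous_on)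
qed

lemma \<nu>_cont: "continuous_on UNIV (case_prod \<nu>)"
proof -
  have "isCont (case_prod \<nu>) z" for z
    by (cases z) (simp only: has_derivative_continuous[OF \<nu>_deriv])
  then show ?thesis by (simp add: continuous_at_imp_continuous_on)
qed

lemmas tube_continuous_intros [continuous_intros] =
  continuous_on_case_prod2[OF X_cont] continuous_on_case_prod2[OF \<nu>_cont] continuous_on_case_prod2[OF Xp_cont]
  continuous_on_case_prod2[OF X\<alpha>_cont] continuous_on_case_prod2[OF \<nu>p_cont] continuous_on_case_prod2[OF \<nu>\<alpha>_cont]
  bounded_bilinear.continuous_on[OF bounded_bilinear_cross3]

lemma jac_cont: "continuous_on S jac"
  unfolding jac_def[abs_def] by (intro continuous_intros)

lemma area_cont: "continuous_on UNIV (case_prod area)"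
  unfolding area_def split_beta by (intro continuous_intros)

lemma coords_deriv: "(coords has_derivative coords' v) (at v within S)"
proof -
  have "((\<lambda>v::real^3. (v $ 1, v $ 2)) has_derivative (\<lambda>h. (h $ 1, h $ 2))) (at v within S)"
    by (intro derivative_intros bounded_linear_imp_has_derivative bounded_linear_vec_nth)
  from has_derivative_compose[OF this X_deriv] has_derivative_compose[OF this \<nu>_deriv]
  have 1: "((\<lambda>v. X (v $ 1) (v $ 2)) has_derivative
        (\<lambda>h. h $ 1 *\<^sub>R X\<^sub>p (v $ 1) (v $ 2) + h $ 2 *\<^sub>R X\<^sub>\<alpha> (v $ 1) (v $ 2))) (at v within S)"
    and 2: "((\<lambda>v. \<nu> (v $ 1) (v $ 2)) has_derivative
        (\<lambda>h. h $ 1 *\<^sub>R \<nu>\<^sub>p (v $ 1) (v $ 2) + h $ 2 *\<^sub>R \<nu>\<^sub>\<alpha> (v $ 1) (v $ 2))) (at v within S)"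
    by simp_all
  have "((\<lambda>v::real^3. v $ 3) has_derivative (\<lambda>h. h $ 3)) (at v within S)"
    by (intro bounded_linear_imp_has_derivative bounded_linear_vec_nth)
  from has_derivative_add[OF 1 has_derivative_scaleR[OF this 2]] show ?thesis
    unfolding coords_def[abs_def] coords'_def[abs_def]
    by (rule has_derivative_eq_rhs) (simp add: fun_eq_iff algebra_simps)
qed

text \<open>The inverse function argument: the derivative at \<open>w\<close> has a left inverse and
  varies continuously in operator norm.\<close>

lemma coords_locally_inj:
  assumes "jac w \<noteq> 0"
  obtains r where "r > 0" "inj_on coords (ball w r)"
proof -
  have lin: "linear (coords' w)"
    using coords_deriv has_derivative_linear by blast
  then have "inj (coords' w)"
    using assms det_coords' det_nz_iff_inj by metis
  then obtain g' where g': "linear g'" "g' \<circ> coords' w = id"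
    using linear_injective_left_inverse[OF lin] by blast
  define c1 where "c1 v = X\<^sub>p (v $ 1) (v $ 2) + v $ 3 *\<^sub>R \<nu>\<^sub>p (v $ 1) (v $ 2)" for v :: "real^3"
  define c2 where "c2 v = X\<^sub>\<alpha> (v $ 1) (v $ 2) + v $ 3 *\<^sub>R \<nu>\<^sub>\<alpha> (v $ 1) (v $ 2)" for v :: "real^3"
  define c3 where "c3 v = \<nu> (v $ 1) (v $ 2)" for v :: "real^3"
  \<comment> \<open>The sum of the column differences dominates the operator norm of the difference
    of derivatives, and it is continuous with value zero at \<open>w\<close>.\<close>
  define d where "d v = norm (c1 v - c1 w) + norm (c2 v - c2 w) + norm (c3 v - c3 w)" for v
  have "continuous_on UNIV d"
    unfolding d_def c1_def c2_def c3_def by (intro continuous_intros)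
  then have "isCont d w"
    using continuous_on_eq_continuous_at open_UNIV by blast
  moreover have "d w = 0" by (simp add: d_def)
  ultimately have d: "(d \<longlongrightarrow> 0) (nhds w)"
    by (simp add: isCont_def tendsto_nhds_iff)
  have onorm_le: "onorm (\<lambda>h. coords' v h - coords' w h) \<le> d v" for v
  proof (rule onorm_le)
    fix h
    have "norm (coords' v h - coords' w h)
      = norm (h $ 1 *\<^sub>R (c1 v - c1 w) + h $ 2 *\<^sub>R (c2 v - c2 w) + h $ 3 *\<^sub>R (c3 v - c3 w))"
      unfolding coords'_def c1_def[symmetric] c2_def[symmetric] c3_def[symmetric] by (simp add: algebra_simps)
    also have "\<dots> \<le> norm (h $ 1 *\<^sub>R (c1 v - c1 w)) + norm (h $ 2 *\<^sub>R (c2 v - c2 w)) + norm (h $ 3 *\<^sub>R (c3 v - c3 w))"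
      by (intro norm_triangle_mono norm_triangle_ineq order_refl)
    also have "\<dots> = \<bar>h $ 1\<bar> * norm (c1 v - c1 w) + \<bar>h $ 2\<bar> * norm (c2 v - c2 w) + \<bar>h $ 3\<bar> * norm (c3 v - c3 w)"
      by simp
    also have "\<dots> \<le> norm h * norm (c1 v - c1 w) + norm h * norm (c2 v - c2 w) + norm h * norm (c3 v - c3 w)"
      by (intro add_mono mult_right_mono component_le_norm_cart norm_ge_zero)
    finally show "norm (coords' v h - coords' w h) \<le> d v * norm h" by (simp add: d_def algebra_simps)
  qed
  have "\<exists>\<delta>>0. \<forall>v. dist w v < \<delta> \<longrightarrow> onorm (\<lambda>h. coords' v h - coords' w h) < e" if "e > 0" for e
  proof -
    have "eventually (\<lambda>v. d v < e) (nhds w)" using d that by (rule order_tendstoD)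
    then obtain \<delta> where \<delta>: "\<delta> > 0" "\<And>v. dist v w < \<delta> \<Longrightarrow> d v < e" unfolding eventually_nhds_metric by blast
    show ?thesis
    proof (intro exI[of _ \<delta>] conjI allI impI)
      fix v assume "dist w v < \<delta>"
      then have "d v < e" using \<delta>(2) by (simp add: dist_commute)
      with onorm_le[of v] show "onorm (\<lambda>h. coords' v h - coords' w h) < e" by (rule order_le_less_trans)
    qed (rule \<delta>)
  qed
  from has_derivative_locally_injective[OF UNIV_I open_UNIV _ g'(2) coords_deriv this] g'(1)
  obtain r where "r > 0" "inj_on coords (ball w r)"
    unfolding linear_conv_bounded_linear by blast
  then show thesis by (rule that)
qed

text \<open>If injectivity failed for every height, distinct pairs with equal images would
  accumulate at surface points with equal images. Injectivity of \<open>X\<close> identifies these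
  limits up to a full turn of the label, and local injectivity of the tubular map contradicts the
  pairs being distinct. The half-open label range is not compact, which is why the limits may differ
  by such a turn.\<close>

lemma coords_inj:
  obtains \<delta> where "\<delta> > 0" "inj_on coords {v. \<bar>v $ 1\<bar> \<le> P \<and> v $ 2 \<in> {0..<1} \<and> \<bar>v $ 3\<bar> \<le> \<delta>}"
proof (rule ccontr)
  let ?S = "\<lambda>\<delta>. {v::real^3. \<bar>v $ 1\<bar> \<le> P \<and> v $ 2 \<in> {0..<1} \<and> \<bar>v $ 3\<bar> \<le> \<delta>}"
  assume "\<not> thesis"
  have "\<not> inj_on coords (?S (inverse (real (Suc n))))" for n
  proof
    assume "inj_on coords (?S (inverse (real (Suc n))))"
    then have thesis by (rule that[rotated]) simp
    with \<open>\<not> thesis\<close> show False by contradiction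
  qed
  moreover define S where "S n = ?S (inverse (real (Suc n)))" for n
  ultimately have "\<exists>v w. v \<in> S n \<and> w \<in> S n \<and> coords v = coords w \<and> v \<noteq> w" for n
    unfolding inj_on_def by blast
  then obtain V W where "\<And>n. V n \<in> S n" "\<And>n. W n \<in> S n"
    and VW: "\<And>n. coords (V n) = coords (W n)" "\<And>n. V n \<noteq> W n" by metis
  then have VS: "\<And>n. V n \<in> ?S (inverse (real (Suc n)))" and WS: "\<And>n. W n \<in> ?S (inverse (real (Suc n)))"
    unfolding S_def by blast+
  let ?B = "cbox (vector [-P, 0, -1]) (vector [P, 1, 1]) :: (real^3) set"
  have inB: "v \<in> ?B" if "v \<in> ?S (inverse (real (Suc n)))" for v n
  proof -
    have "inverse (real (Suc n)) \<le> 1" by (simp add: inverse_le_1_iff)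
    then show ?thesis using that by (auto simp: mem_box_cart forall_3)
  qed
  have "compact (?B \<times> ?B)" by (intro compact_Times compact_cbox)
  moreover have "(V n, W n) \<in> ?B \<times> ?B" for n using inB[OF VS] inB[OF WS] by blast
  ultimately obtain l k where l: "strict_mono (k::nat\<Rightarrow>nat)" "((\<lambda>n. (V n, W n)) \<circ> k) \<longlonglongrightarrow> l"
    unfolding compact_def by meson
  obtain v w where vw: "l = (v, w)" by (cases l)
  have V: "(\<lambda>n. V (k n)) \<longlonglongrightarrow> v" using tendsto_fst[OF l(2)] by (simp add: vw o_def)
  have W: "(\<lambda>n. W (k n)) \<longlonglongrightarrow> w" using tendsto_snd[OF l(2)] by (simp add: vw o_def)
  have lim3: "u $ 3 = 0" if U: "(\<lambda>n. U (k n)) \<longlonglongrightarrow> u" "\<And>n. U n \<in> ?S (inverse (real (Suc n)))" for U u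
  proof -
    have "(\<lambda>n. inverse (real (Suc (k n)))) \<longlonglongrightarrow> 0"
      using LIMSEQ_subseq_LIMSEQ[OF LIMSEQ_inverse_real_of_nat l(1)] by (simp add: o_def)
    then have "(\<lambda>n. U (k n) $ 3) \<longlonglongrightarrow> 0"
      by (rule Lim_null_comparison[rotated]) (use U(2) in auto)
    moreover have "(\<lambda>n. U (k n) $ 3) \<longlonglongrightarrow> u $ 3" using U(1) by (rule tendsto_vec_nth)
    ultimately show ?thesis using LIMSEQ_unique by blast
  qed
  have v3: "v $ 3 = 0" and w3: "w $ 3 = 0" using lim3[OF V VS] lim3[OF W WS] .
  have cc: "isCont coords u" for u using coords_deriv has_derivative_continuous by blast
  have "(\<lambda>n. coords (V (k n))) \<longlonglongrightarrow> coords v" "(\<lambda>n. coords (W (k n))) \<longlonglongrightarrow> coords w"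
    using isCont_tendsto_compose[OF cc V] isCont_tendsto_compose[OF cc W] .
  then have "coords v = coords w" using VW(1) LIMSEQ_unique by simp
  then have "X (v $ 1) (v $ 2) = X (w $ 1) (w $ 2)" by (simp add: coords_def v3 w3)
  then have "X (v $ 1) (frac (v $ 2)) = X (w $ 1) (frac (w $ 2))"
    using periodic_frac[of "X (v $ 1)", OF X_periodic] periodic_frac[of "X (w $ 1)", OF X_periodic] by simp
  then have "case_prod X (v $ 1, frac (v $ 2)) = case_prod X (w $ 1, frac (w $ 2))" by simp
  from inj_onD[OF X_inj this] have eq: "v $ 1 = w $ 1" "frac (v $ 2) = frac (w $ 2)"
    by (auto simp: frac_lt_1)
  define j where "j = \<lfloor>v $ 2\<rfloor> - \<lfloor>w $ 2\<rfloor>"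
  have v2: "v $ 2 = w $ 2 + of_int j" using eq(2) by (simp add: frac_def j_def algebra_simps)
  \<comment> \<open>\<open>v\<close> and \<open>w\<close> may represent the same point on opposite sides of the seam \<open>\<alpha> = 0 \<equiv> 1\<close>.\<close>
  define W' where "W' n = W (k n) + axis 2 (of_int j)" for n
  have W'_coords: "coords (W' n) = coords (W (k n))" for n
    unfolding coords_def W'_def
    using periodic_shift_int[of "X (W (k n) $ 1)", OF X_periodic] periodic_shift_int[of "\<nu> (W (k n) $ 1)", OF \<nu>_periodic]
    by (simp add: axis_def)
  have "W' \<longlonglongrightarrow> w + axis 2 (of_int j)" unfolding W'_def by (intro tendsto_intros W)
  also have "w + axis 2 (of_int j) = v"
    using v2 eq v3 w3 by (simp add: vec_eq_iff forall_3 axis_def)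
  finally have W'v: "W' \<longlonglongrightarrow> v" .
  \<comment> \<open>At height zero the Jacobian is the positive quantity of
    \<open>normal_pos\<close>, so the map is injective near \<open>v\<close>; both
    \<open>V (k n)\<close> and the shifted \<open>W' n\<close> eventually lie there.\<close>
  have "jac v \<noteq> 0" using normal_pos[of "v $ 1" "v $ 2"] by (simp add: jac_def v3)
  then obtain r where r: "r > 0" "inj_on coords (ball v r)" by (rule coords_locally_inj)
  have "eventually (\<lambda>n. dist (V (k n)) v < r \<and> dist (W' n) v < r) sequentially"
    using tendstoD[OF V r(1)] tendstoD[OF W'v r(1)] by (rule eventually_conj)
  then obtain n where "dist (V (k n)) v < r" "dist (W' n) v < r" by (auto dest: eventually_happens)
  then have "V (k n) = W' n"
    using inj_onD[OF r(2)] W'_coords[of n] VW(1)[of "k n"] by (simp add: dist_commute)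
  moreover from this have "V (k n) $ 2 = W (k n) $ 2 + of_int j" by (simp add: W'_def axis_def)
  \<comment> \<open>Both labels lie in \<open>{0..<1}\<close>, so the integer shift between them can
    only be zero.\<close>
  moreover have "\<bar>V (k n) $ 2 - W (k n) $ 2\<bar> < 1" using VS[of "k n"] WS[of "k n"] by auto
  ultimately have "j = 0" by simp
  then have "V (k n) = W (k n)" using \<open>V (k n) = W' n\<close> by (simp add: W'_def)
  then show False using VW(2) by blast
qed


text \<open>The Jacobian is a quadratic polynomial in the height with constant term
  \<open>area\<close>; its other coefficients are bounded on the compact rectangle. Positivity of
  \<open>area\<close> allows passing to the absolute value of \<open>jac\<close> without enlarging
  the error.\<close>

lemma jac_bound:
  obtains C where "C \<ge> 0" "\<And>v. (v $ 1, v $ 2) \<in> {-P..P} \<times> {0..1} \<Longrightarrow> \<bar>v $ 3\<bar> \<le> 1 \<Longrightarrow>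
      \<bar>\<bar>jac v\<bar> - area (v $ 1) (v $ 2)\<bar> \<le> C * \<bar>v $ 3\<bar>"
    "\<And>z. z \<in> {-P..P} \<times> {0..1} \<Longrightarrow> \<bar>case_prod area z\<bar> \<le> C"
proof -
  let ?K = "{-P..P} \<times> {0..1} :: (real \<times> real) set"
  have bd: "\<exists>B. \<forall>z\<in>?K. \<bar>g z\<bar> \<le> B" if "continuous_on UNIV g" for g :: "real \<times> real \<Rightarrow> real"
  proof -
    have "compact (g ` ?K)"
      by (intro compact_continuous_image compact_Times continuous_on_subset[OF that]) auto
    then show ?thesis using compact_imp_bounded bounded_iff by (metis imageI real_norm_def)
  qed
  define A where "A z = (cross3 (X\<^sub>p (fst z) (snd z)) (\<nu>\<^sub>\<alpha> (fst z) (snd z)) + cross3 (\<nu>\<^sub>p (fst z) (snd z)) (X\<^sub>\<alpha> (fst z) (snd z))) \<bullet> \<nu> (fst z) (snd z)" for z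
  define A2 where "A2 z = cross3 (\<nu>\<^sub>p (fst z) (snd z)) (\<nu>\<^sub>\<alpha> (fst z) (snd z)) \<bullet> \<nu> (fst z) (snd z)" for z
  have "continuous_on UNIV A" "continuous_on UNIV A2"
    unfolding A_def A2_def by (intro continuous_intros)+
  then obtain B1 B2 B3 where B: "\<And>z. z \<in> ?K \<Longrightarrow> \<bar>A z\<bar> \<le> B1" "\<And>z. z \<in> ?K \<Longrightarrow> \<bar>A2 z\<bar> \<le> B2"
      "\<And>z. z \<in> ?K \<Longrightarrow> \<bar>case_prod area z\<bar> \<le> B3"
    using bd[OF area_cont] bd[of A] bd[of A2] by blast
  show thesis
  proof (rule that[of "\<bar>B1\<bar> + \<bar>B2\<bar> + \<bar>B3\<bar>"])
    fix v :: "real^3" assume v: "(v $ 1, v $ 2) \<in> ?K" "\<bar>v $ 3\<bar> \<le> 1"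
    let ?z = "(v $ 1, v $ 2)"
    have "jac v = area (v $ 1) (v $ 2) + v $ 3 * A ?z + (v $ 3 * v $ 3) * A2 ?z"
      unfolding jac_def area_def A_def A2_def
      by (simp add: cross_add_left cross_add_right cross_mult_left cross_mult_right inner_add_left algebra_simps)
    then have "\<bar>jac v - area (v $ 1) (v $ 2)\<bar> \<le> \<bar>v $ 3\<bar> * \<bar>A ?z\<bar> + \<bar>v $ 3\<bar> * (\<bar>v $ 3\<bar> * \<bar>A2 ?z\<bar>)"
      using abs_triangle_ineq[of "v $ 3 * A ?z" "(v $ 3 * v $ 3) * A2 ?z"] by (simp add: abs_mult mult.assoc)
    also have "\<dots> \<le> \<bar>v $ 3\<bar> * \<bar>B1\<bar> + \<bar>v $ 3\<bar> * (1 * \<bar>B2\<bar>)"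
      using B(1,2)[OF v(1)] v(2) by (intro add_mono mult_left_mono mult_mono) auto
    also have "\<dots> \<le> (\<bar>B1\<bar> + \<bar>B2\<bar> + \<bar>B3\<bar>) * \<bar>v $ 3\<bar>" by (simp add: algebra_simps)
    finally have 1: "\<bar>jac v - area (v $ 1) (v $ 2)\<bar> \<le> (\<bar>B1\<bar> + \<bar>B2\<bar> + \<bar>B3\<bar>) * \<bar>v $ 3\<bar>" .
    have "area (v $ 1) (v $ 2) > 0" using normal_pos by (simp add: area_def)
    then have "\<bar>\<bar>jac v\<bar> - area (v $ 1) (v $ 2)\<bar> \<le> \<bar>jac v - area (v $ 1) (v $ 2)\<bar>" by linarith
    with 1 show "\<bar>\<bar>jac v\<bar> - area (v $ 1) (v $ 2)\<bar> \<le> (\<bar>B1\<bar> + \<bar>B2\<bar> + \<bar>B3\<bar>) * \<bar>v $ 3\<bar>" by linarith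
  next
    fix z assume "z \<in> ?K"
    then show "\<bar>case_prod area z\<bar> \<le> \<bar>B1\<bar> + \<bar>B2\<bar> + \<bar>B3\<bar>" using B(3)[of z] by linarith
  qed simp
qed

text \<open>After the change of variables, replacing the absolute Jacobian by \<open>area\<close>
  gives the main term exactly. The error is at most \<open>C * (\<epsilon> * B')\<close> pointwise,
  on a set whose volume is itself of order \<open>\<epsilon>\<close>.\<close>

lemma volume_between_graphs:
  fixes lo hi :: "real \<times> real \<Rightarrow> real" and D :: "(real \<times> real) set"
  assumes [measurable]: "D \<in> sets borel" "lo \<in> borel_measurable borel" "hi \<in> borel_measurable borel"
    and D: "D \<subseteq> {-P..P} \<times> {0..<1}"
    and bd: "\<And>z. z \<in> D \<Longrightarrow> \<bar>lo z\<bar> \<le> B" "\<And>z. z \<in> D \<Longrightarrow> \<bar>hi z\<bar> \<le> B"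
  shows "(\<lambda>\<epsilon>. measure lebesgue (coords ` {v. (v $ 1, v $ 2) \<in> D \<and>
              v $ 3 \<in> closed_segment (\<epsilon> * lo (v $ 1, v $ 2)) (\<epsilon> * hi (v $ 1, v $ 2))})
          - \<epsilon> * (LINT z:D|lborel. \<bar>hi z - lo z\<bar> * case_prod area z)) \<in> O[at_right 0](\<lambda>\<epsilon>. \<epsilon>\<^sup>2)"
proof -
  \<comment> \<open>\<open>B\<close> may be zero, or even negative if \<open>D\<close> is empty; a
    positive bound is wanted because the admissible range of \<open>\<epsilon>\<close> is found by
    dividing by it.\<close>
  define B' where "B' = \<bar>B\<bar> + 1"
  have "B \<le> B'" "B' > 0" by (auto simp: B'_def)
  then have B': "B' > 0" "\<And>z. z \<in> D \<Longrightarrow> \<bar>lo z\<bar> \<le> B'" "\<And>z. z \<in> D \<Longrightarrow> \<bar>hi z\<bar> \<le> B'"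
    using bd order_trans by blast+
  obtain \<delta> where \<delta>: "\<delta> > 0" "inj_on coords {v. \<bar>v $ 1\<bar> \<le> P \<and> v $ 2 \<in> {0..<1} \<and> \<bar>v $ 3\<bar> \<le> \<delta>}"
    by (rule coords_inj[of P])
  obtain C where C: "C \<ge> 0" "\<And>v. (v $ 1, v $ 2) \<in> {-P..P} \<times> {0..1} \<Longrightarrow> \<bar>v $ 3\<bar> \<le> 1 \<Longrightarrow>
      \<bar>\<bar>jac v\<bar> - area (v $ 1) (v $ 2)\<bar> \<le> C * \<bar>v $ 3\<bar>"
    "\<And>z. z \<in> {-P..P} \<times> {0..1} \<Longrightarrow> \<bar>case_prod area z\<bar> \<le> C"
    by (rule jac_bound[of P]) (rule that, assumption+)
  have D1: "D \<subseteq> {-P..P} \<times> {0..1}" using D by auto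
  have bD: "bounded D"
    by (rule bounded_subset[OF _ D1]) (simp add: bounded_Times)
  have fD: "emeasure lborel D < \<infinity>" by (rule emeasure_bounded_finite[OF bD])
  have area_m [measurable]: "case_prod area \<in> borel_measurable borel"
    by (rule borel_measurable_continuous_onI[OF area_cont])
  define S where "S \<epsilon> = {v::real^3. (v $ 1, v $ 2) \<in> D \<and>
              v $ 3 \<in> closed_segment (\<epsilon> * lo (v $ 1, v $ 2)) (\<epsilon> * hi (v $ 1, v $ 2))}" for \<epsilon>
  define M where "M = (LINT z:D|lborel. \<bar>hi z - lo z\<bar> * case_prod area z)"
  \<comment> \<open>Jacobian error \<open>C * B'\<close> times the volume
    \<open>2 * B' * measure lborel D\<close> of the region, each with one factor of
    \<open>\<epsilon>\<close> taken out.\<close>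
  define K where "K = C * B' * (2 * B' * measure lborel D)"
  \<comment> \<open>The two smallness conditions bound the height: by \<open>\<delta>\<close> for
    injectivity of \<open>coords\<close>, and by 1 for the Jacobian estimate.\<close>
  have est: "\<bar>measure lebesgue (coords ` S \<epsilon>) - \<epsilon> * M\<bar> \<le> K * \<epsilon>\<^sup>2"
    if \<epsilon>: "\<epsilon> > 0" "\<epsilon> * B' \<le> \<delta>" "\<epsilon> * B' \<le> 1" for \<epsilon>
  proof -
    have lo_hi: "\<bar>\<epsilon> * lo z\<bar> \<le> \<epsilon> * B'" "\<bar>\<epsilon> * hi z\<bar> \<le> \<epsilon> * B'" if "z \<in> D" for z
      using B'(2,3)[OF that] \<epsilon>(1) by (auto simp: abs_mult)
    have area_D: "\<bar>case_prod area z\<bar> \<le> C" if "z \<in> D" for z using C(3) D1 that by blast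
    have m: "(\<lambda>z. \<epsilon> * lo z) \<in> borel_measurable borel" "(\<lambda>z. \<epsilon> * hi z) \<in> borel_measurable borel"
      by measurable
    have one_m: "(\<lambda>z::real \<times> real. 1 :: real) \<in> borel_measurable borel" by simp
    have area_int: "S \<epsilon> \<in> sets borel" "bounded (S \<epsilon>)"
        "set_integrable lborel (S \<epsilon>) (\<lambda>v. case_prod area (v $ 1, v $ 2))"
        "(LINT v:S \<epsilon>|lborel. case_prod area (v $ 1, v $ 2)) = (LINT z:D|lborel. \<bar>\<epsilon> * hi z - \<epsilon> * lo z\<bar> * case_prod area z)"
      unfolding S_def
      by (rule integral_between_graphs[OF assms(1) m area_m bD, of "\<epsilon> * B'" C]; fact lo_hi area_D)+
    have one_int: "set_integrable lborel (S \<epsilon>) (\<lambda>v. 1::real)"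
      "(LINT v:S \<epsilon>|lborel. 1) = (LINT z:D|lborel. \<bar>\<epsilon> * hi z - \<epsilon> * lo z\<bar> * 1)"
      unfolding S_def
      by (rule integral_between_graphs[OF assms(1) m one_m bD, of "\<epsilon> * B'" 1]; (fact lo_hi | simp))+
    have S: "S \<epsilon> \<in> sets borel" "bounded (S \<epsilon>)" using area_int(1,2) .
    have S3: "\<bar>v $ 3\<bar> \<le> \<epsilon> * B'" if "v \<in> S \<epsilon>" for v
    proof -
      have "v $ 3 \<in> closed_segment (\<epsilon> * lo (v $ 1, v $ 2)) (\<epsilon> * hi (v $ 1, v $ 2))" "(v $ 1, v $ 2) \<in> D"
        using that by (auto simp: S_def)
      then show ?thesis using lo_hi[of "(v $ 1, v $ 2)"]
        by (auto simp: closed_segment_eq_real_ivl split: if_splits)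
    qed
    have SD: "(v $ 1, v $ 2) \<in> D" if "v \<in> S \<epsilon>" for v using that by (simp add: S_def)
    have close: "\<bar>\<bar>jac v\<bar> - area (v $ 1) (v $ 2)\<bar> \<le> C * (\<epsilon> * B')" if "v \<in> S \<epsilon>" for v
    proof -
      have "\<bar>\<bar>jac v\<bar> - area (v $ 1) (v $ 2)\<bar> \<le> C * \<bar>v $ 3\<bar>"
        using SD[OF that] D1 S3[OF that] \<epsilon>(3) by (intro C(2)) auto
      also have "\<dots> \<le> C * (\<epsilon> * B')" by (intro mult_left_mono S3 that C)
      finally show ?thesis .
    qed
    have jac_m: "jac \<in> borel_measurable borel" by (rule borel_measurable_continuous_onI[OF jac_cont])
    have jac_int: "set_integrable lborel (S \<epsilon>) (\<lambda>v. \<bar>jac v\<bar>)"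
    proof (rule set_integrable_bound[where f = "\<lambda>v. area (v $ 1) (v $ 2) + C * (\<epsilon> * B') * 1"])
      show "set_integrable lborel (S \<epsilon>) (\<lambda>v. area (v $ 1) (v $ 2) + C * (\<epsilon> * B') * 1)"
        by (intro set_integral_add(1) set_integrable_mult_right one_int) (use area_int(3) in simp)
      show "set_borel_measurable lborel (S \<epsilon>) (\<lambda>v. \<bar>jac v\<bar>)"
        unfolding set_borel_measurable_def using S(1) jac_m by measurable
      show "AE v in lborel. v \<in> S \<epsilon> \<longrightarrow> norm \<bar>jac v\<bar> \<le> norm (area (v $ 1) (v $ 2) + C * (\<epsilon> * B') * 1)"
        using close by (intro AE_I2) (force simp: abs_le_iff)
    qed
    have inj: "inj_on coords (S \<epsilon>)"
      by (rule inj_on_subset[OF \<delta>(2)]) (use SD D S3 \<epsilon>(2) in force)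
    have "measure lebesgue (coords ` S \<epsilon>) = integral (S \<epsilon>) (\<lambda>v. \<bar>det (matrix (coords' v))\<bar>)"
      using S(1) set_borel_integral_eq_integral(1)[OF jac_int]
      by (intro measure_differentiable_image_eq coords_deriv inj) (auto simp: det_coords')
    also have "\<dots> = (LINT v:S \<epsilon>|lborel. \<bar>jac v\<bar>)"
      using set_borel_integral_eq_integral(2)[OF jac_int] by (simp add: det_coords')
    finally have 1: "measure lebesgue (coords ` S \<epsilon>) = (LINT v:S \<epsilon>|lborel. \<bar>jac v\<bar>)" .
    have 2: "(LINT v:S \<epsilon>|lborel. area (v $ 1) (v $ 2)) = \<epsilon> * M"
    proof -
      have "(LINT v:S \<epsilon>|lborel. area (v $ 1) (v $ 2)) = (LINT z:D|lborel. \<bar>\<epsilon> * hi z - \<epsilon> * lo z\<bar> * case_prod area z)"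
        using area_int(4) by simp
      also have "\<dots> = (LINT z:D|lborel. \<epsilon> * (\<bar>hi z - lo z\<bar> * case_prod area z))"
        using \<epsilon>(1) by (simp add: right_diff_distrib[symmetric] abs_mult mult.assoc)
      finally show ?thesis unfolding M_def by simp
    qed
    have area_S: "set_integrable lborel (S \<epsilon>) (\<lambda>v. area (v $ 1) (v $ 2))" using area_int(3) by simp
    have "\<bar>measure lebesgue (coords ` S \<epsilon>) - \<epsilon> * M\<bar> = \<bar>LINT v:S \<epsilon>|lborel. \<bar>jac v\<bar> - area (v $ 1) (v $ 2)\<bar>"
      unfolding 1 2[symmetric] by (simp add: set_integral_diff(2)[OF jac_int area_S])
    also have "\<dots> \<le> (LINT v:S \<epsilon>|lborel. \<bar>\<bar>jac v\<bar> - area (v $ 1) (v $ 2)\<bar>)"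
      using set_integral_norm_bound[OF set_integral_diff(1)[OF jac_int area_S]] by simp
    also have "\<dots> \<le> (LINT v:S \<epsilon>|lborel. C * (\<epsilon> * B') * 1)"
      by (intro set_integral_mono set_integrable_mult_right one_int set_integrable_abs set_integral_diff(1) jac_int area_S)
        (use close in simp)
    also have "\<dots> = C * (\<epsilon> * B') * (LINT z:D|lborel. \<bar>\<epsilon> * hi z - \<epsilon> * lo z\<bar> * 1)"
      unfolding one_int(2)[symmetric] by (rule set_integral_mult_right)
    also have "\<dots> \<le> C * (\<epsilon> * B') * (LINT z:D|lborel. 2 * \<epsilon> * B')"
    proof (intro mult_left_mono set_integral_mono)
      have cD: "set_integrable lborel D (\<lambda>z. 2 * \<epsilon> * B')" using fD by (auto simp: set_integrable_def)
      then show "set_integrable lborel D (\<lambda>z. 2 * \<epsilon> * B')" .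
      have le: "\<bar>\<epsilon> * hi z - \<epsilon> * lo z\<bar> \<le> 2 * \<epsilon> * B'" if "z \<in> D" for z
        using lo_hi[OF that] by linarith
      then show "\<bar>\<epsilon> * hi z - \<epsilon> * lo z\<bar> * 1 \<le> 2 * \<epsilon> * B'" if "z \<in> D" for z using that by simp
      show "set_integrable lborel D (\<lambda>z. \<bar>\<epsilon> * hi z - \<epsilon> * lo z\<bar> * 1)"
      proof (rule set_integrable_bound[OF cD])
        show "set_borel_measurable lborel D (\<lambda>z. \<bar>\<epsilon> * hi z - \<epsilon> * lo z\<bar> * 1)"
          unfolding set_borel_measurable_def by measurable
        show "AE z in lborel. z \<in> D \<longrightarrow> norm (\<bar>\<epsilon> * hi z - \<epsilon> * lo z\<bar> * 1) \<le> norm (2 * \<epsilon> * B')"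
          using le by (intro AE_I2) force
      qed
    qed (use C(1) \<epsilon>(1) B'(1) in auto)
    also have "(LINT z:D|lborel. 2 * \<epsilon> * B') = 2 * \<epsilon> * B' * measure lborel D"
      using fD by (simp add: set_lebesgue_integral_def)
    finally show ?thesis by (simp add: K_def power2_eq_square algebra_simps)
  qed
  have "eventually (\<lambda>\<epsilon>. norm (measure lebesgue (coords ` S \<epsilon>) - \<epsilon> * M) \<le> K * norm (\<epsilon>\<^sup>2)) (at_right 0)"
    unfolding eventually_at_right_field
  proof (intro exI[of _ "min \<delta> 1 / B'"] conjI allI impI)
    show "0 < min \<delta> 1 / B'" using \<delta> B' by auto
    fix \<epsilon> assume "0 < \<epsilon>" "\<epsilon> < min \<delta> 1 / B'"
    then show "norm (measure lebesgue (coords ` S \<epsilon>) - \<epsilon> * M) \<le> K * norm (\<epsilon>\<^sup>2)"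
      using est[of \<epsilon>] B'(1) by (auto simp: field_simps)
  qed
  then show ?thesis
    unfolding S_def M_def by (rule bigoI)
qed

end

section \<open>Melnikov functions and lobes\<close>

text \<open>The total derivative on the parameter plane is tied to two named continuous partial
  derivatives. Both locales take such fields as parameters, and the form is stable under cross
  products, normalization and reversal of time.\<close>

definition C1_partials :: "(real \<Rightarrow> real \<Rightarrow> real^3) \<Rightarrow> (real \<Rightarrow> real \<Rightarrow> real^3) \<Rightarrow> (real \<Rightarrow> real \<Rightarrow> real^3) \<Rightarrow> bool" where
  "C1_partials g g\<^sub>p g\<^sub>\<alpha> \<longleftrightarrow>
     (\<forall>p \<alpha>. (case_prod g has_derivative (\<lambda>(s, u). s *\<^sub>R g\<^sub>p p \<alpha> + u *\<^sub>R g\<^sub>\<alpha> p \<alpha>)) (at (p, \<alpha>))) \<and>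
     continuous_on UNIV (case_prod g\<^sub>p) \<and> continuous_on UNIV (case_prod g\<^sub>\<alpha>)"

lemma C1_partials_cont:
  assumes "C1_partials g g\<^sub>p g\<^sub>\<alpha>"
  shows "continuous_on UNIV (case_prod g)"
proof -
  have "isCont (case_prod g) z" for z
  proof (cases z)
    case (Pair p \<alpha>)
    then show ?thesis using assms has_derivative_continuous unfolding C1_partials_def by blast
  qed
  then show ?thesis by (simp add: continuous_at_imp_continuous_on)
qed

lemma linear_on_plane:
  fixes L :: "real \<times> real \<Rightarrow> 'a::real_vector"
  assumes "linear L"
  shows "L = (\<lambda>(s, u). s *\<^sub>R L (1, 0) + u *\<^sub>R L (0, 1))"
proof
  fix z :: "real \<times> real"
  have "z = fst z *\<^sub>R (1, 0) + snd z *\<^sub>R (0, 1)" by (cases z) simp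
  then have "L z = L (fst z *\<^sub>R (1, 0) + snd z *\<^sub>R (0, 1))" by simp
  also have "\<dots> = fst z *\<^sub>R L (1, 0) + snd z *\<^sub>R L (0, 1)"
    using assms by (simp only: linear_add linear_scale)
  finally show "L z = (case z of (s, u) \<Rightarrow> s *\<^sub>R L (1, 0) + u *\<^sub>R L (0, 1))" by (simp add: split_beta)
qed

lemma C2_on_partials:
  fixes X :: "real \<Rightarrow> real \<Rightarrow> real^3"
  assumes "C2_on UNIV (\<lambda>(p, \<alpha>). X p \<alpha>)"
  obtains X1 X2 X11 X12 X21 X22 where "C1_partials X X1 X2" "C1_partials X1 X11 X12" "C1_partials X2 X21 X22"
proof -
  from assms obtain X' :: "real \<times> real \<Rightarrow> (real \<times> real) \<Rightarrow>\<^sub>L (real^3)"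
    and X'' :: "real \<times> real \<Rightarrow> (real \<times> real) \<Rightarrow>\<^sub>L ((real \<times> real) \<Rightarrow>\<^sub>L (real^3))"
    where X': "\<And>z. (case_prod X has_derivative blinfun_apply (X' z)) (at z)"
      and X'': "\<And>z. (X' has_derivative blinfun_apply (X'' z)) (at z)"
      and c: "continuous_on UNIV X''"
    unfolding C2_on_def by auto
  have c': "continuous_on UNIV X'"
    using X'' has_derivative_continuous continuous_at_imp_continuous_on by blast
  have d: "((\<lambda>z. X' z v) has_derivative (\<lambda>h. X'' z h v)) (at z)" for z v
    using bounded_linear.has_derivative[OF blinfun.bounded_linear_left X''] .
  have lin: "linear (\<lambda>h. blinfun_apply (X'' z h) v)" for z v
    using has_derivative_linear[OF d] .
  have cv': "continuous_on UNIV (\<lambda>z. X' z v)" if "continuous_on UNIV X'" for v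
    by (intro continuous_intros that)
  have cv: "continuous_on UNIV (\<lambda>z. X'' z w v)" if "continuous_on UNIV X''" for v w
    by (intro continuous_intros that)
  show thesis
  proof (rule that)
    show "C1_partials X (\<lambda>p \<alpha>. X' (p, \<alpha>) (1, 0)) (\<lambda>p \<alpha>. X' (p, \<alpha>) (0, 1))"
      unfolding C1_partials_def
    proof (intro conjI allI)
      show "(case_prod X has_derivative (\<lambda>(s, u). s *\<^sub>R X' (p, \<alpha>) (1, 0) + u *\<^sub>R X' (p, \<alpha>) (0, 1))) (at (p, \<alpha>))" for p \<alpha>
        using X'[of "(p, \<alpha>)"] by (rule has_derivative_eq_rhs) (rule linear_on_plane[OF has_derivative_linear[OF X']])
    qed (use cv'[OF c'] in \<open>simp_all add: case_prod_unfold\<close>)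
    have C: "C1_partials (\<lambda>p \<alpha>. X' (p, \<alpha>) v) (\<lambda>p \<alpha>. X'' (p, \<alpha>) (1, 0) v) (\<lambda>p \<alpha>. X'' (p, \<alpha>) (0, 1) v)" for v
      unfolding C1_partials_def
    proof (intro conjI allI)
      show "((\<lambda>(p, \<alpha>). X' (p, \<alpha>) v) has_derivative
          (\<lambda>(s, u). s *\<^sub>R X'' (p, \<alpha>) (1, 0) v + u *\<^sub>R X'' (p, \<alpha>) (0, 1) v)) (at (p, \<alpha>))" for p \<alpha>
      proof -
        have "(\<lambda>(p, \<alpha>). X' (p, \<alpha>) v) = (\<lambda>z. X' z v)" by auto
        then show ?thesis
          using d[of v "(p, \<alpha>)"] linear_on_plane[OF lin[of "(p, \<alpha>)" v]] by simp
      qed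
    qed (use cv[OF c] in \<open>simp_all add: case_prod_unfold\<close>)
    show "C1_partials (\<lambda>p \<alpha>. X' (p, \<alpha>) (1, 0)) (\<lambda>p \<alpha>. X'' (p, \<alpha>) (1, 0) (1, 0)) (\<lambda>p \<alpha>. X'' (p, \<alpha>) (0, 1) (1, 0))"
      "C1_partials (\<lambda>p \<alpha>. X' (p, \<alpha>) (0, 1)) (\<lambda>p \<alpha>. X'' (p, \<alpha>) (1, 0) (0, 1)) (\<lambda>p \<alpha>. X'' (p, \<alpha>) (0, 1) (0, 1))"
      by (rule C)+
  qed
qed

lemma C1_partials_cross3:
  assumes u: "C1_partials u u1 u2" and v: "C1_partials v v1 v2"
  shows "C1_partials (\<lambda>p \<alpha>. cross3 (u p \<alpha>) (v p \<alpha>))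
     (\<lambda>p \<alpha>. cross3 (u p \<alpha>) (v1 p \<alpha>) + cross3 (u1 p \<alpha>) (v p \<alpha>))
     (\<lambda>p \<alpha>. cross3 (u p \<alpha>) (v2 p \<alpha>) + cross3 (u2 p \<alpha>) (v p \<alpha>))"
  unfolding C1_partials_def
proof (intro conjI allI)
  fix p \<alpha>
  have du: "(case_prod u has_derivative (\<lambda>(s, t). s *\<^sub>R u1 p \<alpha> + t *\<^sub>R u2 p \<alpha>)) (at (p, \<alpha>))"
    and dv: "(case_prod v has_derivative (\<lambda>(s, t). s *\<^sub>R v1 p \<alpha> + t *\<^sub>R v2 p \<alpha>)) (at (p, \<alpha>))"
    using u v by (auto simp: C1_partials_def)
  show "((\<lambda>(p, \<alpha>). cross3 (u p \<alpha>) (v p \<alpha>)) has_derivative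
     (\<lambda>(s, t). s *\<^sub>R (cross3 (u p \<alpha>) (v1 p \<alpha>) + cross3 (u1 p \<alpha>) (v p \<alpha>))
        + t *\<^sub>R (cross3 (u p \<alpha>) (v2 p \<alpha>) + cross3 (u2 p \<alpha>) (v p \<alpha>)))) (at (p, \<alpha>))"
    using bounded_bilinear.FDERIV[OF bounded_bilinear_cross3 du dv]
    by (simp add: case_prod_unfold cross_add_left cross_add_right cross_mult_left cross_mult_right algebra_simps)
next
  note c = C1_partials_cont[OF u] C1_partials_cont[OF v]
    u[unfolded C1_partials_def, THEN conjunct2, THEN conjunct1] u[unfolded C1_partials_def, THEN conjunct2, THEN conjunct2]
    v[unfolded C1_partials_def, THEN conjunct2, THEN conjunct1] v[unfolded C1_partials_def, THEN conjunct2, THEN conjunct2]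
  note [continuous_intros] = bounded_bilinear.continuous_on[OF bounded_bilinear_cross3] c[unfolded split_beta]
  show "continuous_on UNIV (\<lambda>(p, \<alpha>). cross3 (u p \<alpha>) (v1 p \<alpha>) + cross3 (u1 p \<alpha>) (v p \<alpha>))"
    "continuous_on UNIV (\<lambda>(p, \<alpha>). cross3 (u p \<alpha>) (v2 p \<alpha>) + cross3 (u2 p \<alpha>) (v p \<alpha>))"
    unfolding split_beta by (intro continuous_intros)+
qed

lemma has_derivative_norm_compose:
  fixes g :: "'a::real_normed_vector \<Rightarrow> 'b::real_inner"
  assumes "g x \<noteq> 0" "(g has_derivative g') (at x)"
  shows "((\<lambda>x. norm (g x)) has_derivative (\<lambda>h. sgn (g x) \<bullet> g' h)) (at x)"
  using has_derivative_compose[OF assms(2) has_derivative_norm[OF assms(1)]] by (simp add: inner_commute)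

lemma C1_partials_normalize:
  assumes N: "C1_partials N N1 N2" and nz: "\<And>p \<alpha>. N p \<alpha> \<noteq> 0"
  obtains \<nu>1 \<nu>2 where "C1_partials (\<lambda>p \<alpha>. N p \<alpha> /\<^sub>R norm (N p \<alpha>)) \<nu>1 \<nu>2"
proof -
  \<comment> \<open>The derivative of \<open>N / norm N\<close> when \<open>N\<close> moves in
    direction \<open>v\<close>: the vector \<open>v\<close> minus its projection onto
    \<open>N\<close>, divided by the norm of \<open>N\<close>.\<close>
  define D where "D v p \<alpha> = v /\<^sub>R norm (N p \<alpha>) - (inverse (norm (N p \<alpha>)) * (sgn (N p \<alpha>) \<bullet> v) * inverse (norm (N p \<alpha>))) *\<^sub>R N p \<alpha>" for v p \<alpha>
  have "C1_partials (\<lambda>p \<alpha>. N p \<alpha> /\<^sub>R norm (N p \<alpha>)) (\<lambda>p \<alpha>. D (N1 p \<alpha>) p \<alpha>) (\<lambda>p \<alpha>. D (N2 p \<alpha>) p \<alpha>)"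
    unfolding C1_partials_def
  proof (intro conjI allI)
    fix p \<alpha>
    have dN: "(case_prod N has_derivative (\<lambda>(s, t). s *\<^sub>R N1 p \<alpha> + t *\<^sub>R N2 p \<alpha>)) (at (p, \<alpha>))"
      using N by (auto simp: C1_partials_def)
    have n: "norm (case_prod N (p, \<alpha>)) \<noteq> 0" using nz by simp
    have "((\<lambda>z. norm (case_prod N z)) has_derivative
        (\<lambda>h. sgn (N p \<alpha>) \<bullet> (case h of (s, t) \<Rightarrow> s *\<^sub>R N1 p \<alpha> + t *\<^sub>R N2 p \<alpha>))) (at (p, \<alpha>))"
      using has_derivative_norm_compose[OF _ dN] nz by simp
    from has_derivative_scaleR[OF Deriv.has_derivative_inverse[OF n this] dN]
    have "((\<lambda>(p, \<alpha>). N p \<alpha> /\<^sub>R norm (N p \<alpha>)) has_derivative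
        (\<lambda>h. inverse (norm (N p \<alpha>)) *\<^sub>R (fst h *\<^sub>R N1 p \<alpha> + snd h *\<^sub>R N2 p \<alpha>) +
           (- (inverse (norm (N p \<alpha>)) * (sgn (N p \<alpha>) \<bullet> (fst h *\<^sub>R N1 p \<alpha> + snd h *\<^sub>R N2 p \<alpha>)) * inverse (norm (N p \<alpha>)))) *\<^sub>R N p \<alpha>)) (at (p, \<alpha>))"
      by (simp add: case_prod_unfold)
    then show "((\<lambda>(p, \<alpha>). N p \<alpha> /\<^sub>R norm (N p \<alpha>)) has_derivative
        (\<lambda>(s, t). s *\<^sub>R D (N1 p \<alpha>) p \<alpha> + t *\<^sub>R D (N2 p \<alpha>) p \<alpha>)) (at (p, \<alpha>))"
      by (rule has_derivative_eq_rhs)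
        (simp add: fun_eq_iff D_def inner_add_right algebra_simps)
  next
    note c = C1_partials_cont[OF N] N[unfolded C1_partials_def, THEN conjunct2, THEN conjunct1] N[unfolded C1_partials_def, THEN conjunct2, THEN conjunct2]
    note [continuous_intros] = c[unfolded split_beta]
    show "continuous_on UNIV (\<lambda>(p, \<alpha>). D (N1 p \<alpha>) p \<alpha>)" "continuous_on UNIV (\<lambda>(p, \<alpha>). D (N2 p \<alpha>) p \<alpha>)"
      unfolding split_beta D_def sgn_div_norm by (intro continuous_intros; simp add: nz)+
  qed
  then show thesis by (rule that)
qed

lemma C2_surface_local_equation:
  assumes "C2_surface S" "a \<in> S"
  obtains r F G where "0 < r" "\<And>x. x \<in> ball a r \<Longrightarrow> (F has_derivative (\<lambda>h. G x \<bullet> h)) (at x)"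
    "continuous_on (ball a r) G" "G a \<noteq> (0::real^3)" "\<And>x. x \<in> S \<Longrightarrow> x \<in> ball a r \<Longrightarrow> F x = (0::real)"
proof -
  obtain U and F :: "real^3 \<Rightarrow> real" where U: "open U" "a \<in> U" "C2_on U F"
      and reg: "\<And>y. y \<in> U \<Longrightarrow> frechet_derivative F (at y) \<noteq> (\<lambda>_. 0)" and S: "S \<inter> U = {y \<in> U. F y = 0}"
  proof -
    from assms obtain U and F :: "real^3 \<Rightarrow> real" where
      *: "open U \<and> a \<in> U \<and> C2_on U F \<and> (\<forall>y\<in>U. frechet_derivative F (at y) \<noteq> (\<lambda>_. 0)) \<and> S \<inter> U = {y \<in> U. F y = 0}"
      unfolding C2_surface_def by (elim ballE exE) auto
    show thesis by (rule that[of U F]) (use * in blast)+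
  qed
  from U(3) obtain F' :: "real^3 \<Rightarrow> (real^3) \<Rightarrow>\<^sub>L real" and F'' :: "real^3 \<Rightarrow> (real^3) \<Rightarrow>\<^sub>L ((real^3) \<Rightarrow>\<^sub>L real)"
    where F': "\<And>x. x \<in> U \<Longrightarrow> (F has_derivative blinfun_apply (F' x)) (at x)"
      and F'': "\<And>x. x \<in> U \<Longrightarrow> (F' has_derivative blinfun_apply (F'' x)) (at x)"
    unfolding C2_on_def by blast
  obtain r where r: "0 < r" "ball a r \<subseteq> U" using U open_contains_ball by blast
  \<comment> \<open>The gradient: the vector representing the functional \<open>F' x\<close>. It
    inherits continuity from \<open>F'\<close> componentwise.\<close>
  define G where "G x = (\<chi> i. F' x (axis i 1))" for x
  have G: "blinfun_apply (F' x) = (\<lambda>h. G x \<bullet> h)" for x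
  proof
    fix h :: "real^3"
    have "F' x h = F' x (\<Sum>i\<in>UNIV. h $ i *\<^sub>R axis i 1)"
      using basis_expansion[of h] by (simp add: scalar_mult_eq_scaleR)
    also have "\<dots> = G x \<bullet> h"
      by (simp add: blinfun.sum_right blinfun.scaleR_right G_def inner_vec_def mult.commute)
    finally show "F' x h = G x \<bullet> h" .
  qed
  show thesis
  proof (rule that[of r F G])
    show "(F has_derivative (\<lambda>h. G x \<bullet> h)) (at x)" if "x \<in> ball a r" for x
      using F'[of x] r that by (auto simp: G)
    have "continuous_on (ball a r) F'"
      using F'' r by (intro continuous_at_imp_continuous_on ballI) (meson has_derivative_continuous subsetD)
    then show "continuous_on (ball a r) G"
      unfolding G_def by (intro continuous_intros)
    show "G a \<noteq> 0"
    proof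
      assume "G a = 0"
      then have "(F has_derivative (\<lambda>_. 0)) (at a)" using F'[OF U(2)] by (simp add: G)
      then show False using reg[OF U(2)] frechet_derivative_at by metis
    qed
    show "F x = 0" if "x \<in> S" "x \<in> ball a r" for x using S that r by blast
  qed (rule r)
qed

text \<open>Evaluate the characteristic polynomial at zero: it equals minus the determinant, the
  dimension being odd, and also minus the product of the eigenvalues.\<close>

lemma saddle_spectrum_surj:
  assumes "saddle_spectrum (matrix L) l0 l1 l2" "l0 \<noteq> 0" "l1 \<noteq> 0" "l2 \<noteq> 0" "linear L"
  shows "surj L"
proof -
  let ?B = "map_matrix complex_of_real (matrix L)"
  have "det (mat 0 - ?B) = (0 - complex_of_real l0) * (0 - l1) * (0 - l2)"
    using assms(1) unfolding saddle_spectrum_def Let_def by blast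
  then have "det (mat 0 - ?B) \<noteq> 0" using assms by simp
  moreover have "det (mat 0 - ?B) = - complex_of_real (det (matrix L))"
    by (simp add: det_3 mat_def map_matrix_def)
  ultimately have "det (matrix L) \<noteq> 0" by auto
  then have "inj L" using det_nz_iff_inj[OF assms(5)] by simp
  then show ?thesis using linear_injective_imp_surjective[OF assms(5)] by simp
qed

text \<open>The sign in \<open>melnikov_s\<close> turns the difference of the two Melnikov functions
  into this sum. The half-lines overlap only at \<open>p\<close>, so it is an integral over the
  whole line: the real part of the Fourier transform times a phase that does not depend on
  \<open>\<tau>\<close>.\<close>

lemma half_lines_harmonic_integral:
  fixes H :: "real \<Rightarrow> real"
  assumes H: "integrable lborel H"
    and F: "fourier H \<omega> = of_real (norm (fourier H \<omega>)) * cis \<theta>"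
  shows "(LINT \<tau>:{..p}|lborel. H \<tau> * cos (\<omega> * (\<tau> + t - p) + \<phi>)) + (LINT \<tau>:{p..}|lborel. H \<tau> * cos (\<omega> * (\<tau> + t - p) + \<phi>))
    = norm (fourier H \<omega>) * cos (\<omega> * (t - p) + \<phi> + \<theta>)"
proof -
  have [measurable]: "H \<in> borel_measurable borel" using H by (simp add: borel_measurable_integrable[of lborel, simplified])
  let ?I = "\<lambda>\<tau>. H \<tau> * cos (\<omega> * (\<tau> + t - p) + \<phi>)"
  let ?\<psi> = "\<omega> * (t - p) + \<phi>"
  have I: "integrable lborel ?I"
  proof (rule Bochner_Integration.integrable_bound[OF H])
    show "AE \<tau> in lborel. norm (?I \<tau>) \<le> norm (H \<tau>)"
      by (intro AE_I2) (simp add: abs_mult mult_left_le)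
  qed measurable
  have set_I: "set_integrable lborel A ?I" if "A \<in> sets lborel" for A
    unfolding set_integrable_def by (rule integrable_mult_indicator[OF that I])
  have E: "integrable lborel (\<lambda>\<tau>. exp (\<i> * of_real (\<omega> * \<tau>)) * of_real (H \<tau>))"
  proof (rule Bochner_Integration.integrable_bound[OF H])
    show "AE \<tau> in lborel. norm (exp (\<i> * of_real (\<omega> * \<tau>)) * of_real (H \<tau>)) \<le> norm (H \<tau>)"
      by (intro AE_I2) (simp add: norm_mult norm_exp_i_times del: of_real_mult)
    show "(\<lambda>\<tau>. exp (\<i> * of_real (\<omega> * \<tau>)) * complex_of_real (H \<tau>)) \<in> borel_measurable lborel"
      by (intro borel_measurable_times borel_measurable_continuous_onI) (auto intro!: continuous_intros simp: of_real_def)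
  qed
  have "(LINT \<tau>:{..p}|lborel. ?I \<tau>) + (LINT \<tau>:{p..}|lborel. ?I \<tau>) = (LINT \<tau>:{..p} \<union> {p..}|lborel. ?I \<tau>)"
  proof (rule set_integral_Un_AE[symmetric])
    have "AE \<tau> in lborel. \<tau> \<noteq> p" by (rule AE_lborel_singleton)
    then show "AE \<tau> in lborel. \<not> (\<tau> \<in> {..p} \<and> \<tau> \<in> {p..})" by eventually_elim auto
  qed (simp_all add: set_I)
  also have "{..p} \<union> {p..} = (UNIV :: real set)" by auto
  also have "(LINT \<tau>:UNIV|lborel. ?I \<tau>) = (LINT \<tau>|lborel. Re (cis ?\<psi> * (exp (\<i> * of_real (\<omega> * \<tau>)) * of_real (H \<tau>))))"
  proof -
    have "?I \<tau> = Re (cis ?\<psi> * (exp (\<i> * of_real (\<omega> * \<tau>)) * of_real (H \<tau>)))" for \<tau>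
    proof -
      have "cis ?\<psi> * (exp (\<i> * of_real (\<omega> * \<tau>)) * of_real (H \<tau>)) = of_real (H \<tau>) * (cis ?\<psi> * cis (\<omega> * \<tau>))"
        by (simp add: cis_conv_exp mult_ac)
      also have "Re \<dots> = H \<tau> * cos (?\<psi> + \<omega> * \<tau>)" by (simp add: cis_mult)
      finally show ?thesis by (simp add: algebra_simps)
    qed
    then show ?thesis by (simp add: set_lebesgue_integral_def)
  qed
  also have "\<dots> = Re (cis ?\<psi> * fourier H \<omega>)"
    unfolding fourier_def
    by (subst integral_Re[OF integrable_mult_right[OF E]]) (simp only: integral_mult_right_zero)
  also have "\<dots> = Re (of_real (norm (fourier H \<omega>)) * (cis ?\<psi> * cis \<theta>))"
    by (subst F) (simp only: mult_ac)
  also have "\<dots> = norm (fourier H \<omega>) * cos (?\<psi> + \<theta>)"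
    by (simp add: cis_mult)
  finally show ?thesis .
qed

text \<open>Here \<open>z\<close> is a zero of the cosine, and the next zero is half a period later.
  In between, the cosine agrees up to sign with \<open>sin (\<omega> * (p - z))\<close>, which is
  nonnegative there and has integral \<open>2 / \<omega>\<close>.\<close>

lemma integral_abs_cos_half_period:
  fixes \<omega> :: real
  assumes "\<omega> > 0" and z: "\<omega> * z = \<theta> - pi * (2 * of_int k + 1) / 2 + \<omega> * t + \<phi>"
  shows "(LINT p:{z..z + pi / \<omega>}|lborel. \<bar>A * cos (\<omega> * (t - p) + \<phi> + \<theta>)\<bar>) = 2 * \<bar>A\<bar> / \<omega>"
proof -
  have le: "0 \<le> pi / \<omega>" using assms(1) by simp
  have eq: "\<bar>A * cos (\<omega> * (t - p) + \<phi> + \<theta>)\<bar> = \<bar>A\<bar> * sin (\<omega> * (p - z))" if "p \<in> {z..z + pi / \<omega>}" for p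
  proof -
    have "\<omega> * (t - p) + \<phi> + \<theta> = pi * of_int k + (pi / 2 - \<omega> * (p - z))"
      using z by (simp add: field_simps)
    then have "cos (\<omega> * (t - p) + \<phi> + \<theta>) = cos (pi * of_int k) * sin (\<omega> * (p - z))"
      by (simp add: cos_add cos_diff)
    then have "\<bar>cos (\<omega> * (t - p) + \<phi> + \<theta>)\<bar> = \<bar>sin (\<omega> * (p - z))\<bar>"
      by (simp add: cos_npi_int)
    moreover have "0 \<le> sin (\<omega> * (p - z))"
      using that assms(1) by (intro sin_ge_zero) (auto simp: field_simps)
    ultimately show ?thesis by (simp add: abs_mult)
  qed
  have "(LINT p:{z..z + pi / \<omega>}|lborel. \<bar>A * cos (\<omega> * (t - p) + \<phi> + \<theta>)\<bar>)
      = (LINT p|lborel. (\<bar>A\<bar> * sin (\<omega> * (p - z))) * indicator {z..z + pi / \<omega>} p)"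
    unfolding set_lebesgue_integral_def
    by (intro Bochner_Integration.integral_cong) (auto simp: eq indicator_def)
  also have "\<dots> = - (\<bar>A\<bar> / \<omega>) * cos (\<omega> * (z + pi / \<omega> - z)) - - (\<bar>A\<bar> / \<omega>) * cos (\<omega> * (z - z))"
    by (rule integral_FTC_Icc_real[where F = "\<lambda>p. - (\<bar>A\<bar> / \<omega>) * cos (\<omega> * (p - z))"])
      (use assms(1) le in \<open>auto intro!: derivative_eq_intros continuous_intros\<close>)
  also have "\<dots> = 2 * \<bar>A\<bar> / \<omega>" using assms(1) by (simp add: field_simps)
  finally show ?thesis .
qed

text \<open>\<open>S\<close> is the invariant manifold with its saddle included, so the surface
  hypothesis supplies a regular equation at \<open>a\<close> itself, where the punctured surface
  \<open>\<Gamma>\<close> would give none. The field and the roles of \<open>a\<close> and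
  \<open>b\<close> are left general so that the reversed flow can be inserted.\<close>

lemma heteroclinic_saddle_end:
  assumes "open \<Omega>" and f': "\<And>x. x \<in> \<Omega> \<Longrightarrow> (f has_derivative blinfun_apply (f' x)) (at x)" "continuous_on \<Omega> f'"
    and S: "C2_surface S" "a \<in> S" "S - {a} = \<Gamma>" "S \<subseteq> \<Omega>"
    and b: "b \<in> \<Omega>" "f b = 0" "a \<noteq> b" and K: "compact (\<Gamma> \<union> {a, b})"
    and per: "\<And>p \<alpha>. X p (\<alpha> + 1) = X p \<alpha>"
    and bij: "bij_betw (case_prod X) {(p, \<alpha>). \<alpha> \<in> {0..<1}} \<Gamma>"
    and C1: "C1_partials X (\<lambda>p \<alpha>. f (X p \<alpha>)) X\<^sub>\<alpha>"
    and lim: "\<And>\<alpha>. ((\<lambda>p. X p \<alpha>) \<longlongrightarrow> a) at_bot" "\<And>\<alpha>. ((\<lambda>p. X p \<alpha>) \<longlongrightarrow> b) at_top"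
    and nz: "\<And>p \<alpha>. cross3 (f (X p \<alpha>)) (X\<^sub>\<alpha> p \<alpha>) \<noteq> 0"
    and div: "\<And>x. x \<in> \<Omega> \<Longrightarrow> trace (matrix (blinfun_apply (f' x))) = 0"
    and surj: "surj (blinfun_apply (f' a))"
  shows "saddle_end \<Omega> (\<Gamma> \<union> {a, b}) f f' a b X X\<^sub>\<alpha>"
proof
  have X\<Gamma>: "X p \<alpha> \<in> \<Gamma>" for p \<alpha>
  proof -
    have "X p (frac \<alpha>) \<in> \<Gamma>"
      using bij_betwE[OF bij] frac_lt_1[of \<alpha>] by force
    then show ?thesis using periodic_frac[of "X p", OF per] by simp
  qed
  then show "X p \<alpha> \<in> \<Gamma> \<union> {a, b}" for p \<alpha> by blast
  show "\<Gamma> \<union> {a, b} \<subseteq> {a, b} \<union> range (case_prod X)"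
    using bij_betw_imp_surj_on[OF bij] by blast
  show "\<Gamma> \<union> {a, b} \<subseteq> \<Omega>" using S b by blast
  show "inj_on (case_prod X) {(p, \<alpha>). \<alpha> \<in> {0..<1}}" using bij by (rule bij_betw_imp_inj_on)
  show "(case_prod X has_derivative (\<lambda>(s, u). s *\<^sub>R f (X p \<alpha>) + u *\<^sub>R X\<^sub>\<alpha> p \<alpha>)) (at (p, \<alpha>))" for p \<alpha>
    using C1 by (simp add: C1_partials_def)
  show "continuous_on UNIV (case_prod X\<^sub>\<alpha>)" using C1 by (simp add: C1_partials_def)
  obtain r F G where rFG: "0 < r" "\<And>x. x \<in> ball a r \<Longrightarrow> (F has_derivative (\<lambda>h. G x \<bullet> h)) (at x)"
    "continuous_on (ball a r) G" "G a \<noteq> (0::real^3)" "\<And>x. x \<in> S \<Longrightarrow> x \<in> ball a r \<Longrightarrow> F x = (0::real)"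
    using C2_surface_local_equation[OF S(1,2)] by blast
  have "X p \<alpha> \<in> S" for p \<alpha> using X\<Gamma>[of p \<alpha>] S by blast
  then show "\<exists>r F G. 0 < r \<and> (\<forall>x\<in>ball a r. (F has_derivative (\<lambda>h. G x \<bullet> h)) (at x)) \<and>
        continuous_on (ball a r) G \<and> G a \<noteq> (0::real^3) \<and> (\<forall>p \<alpha>. X p \<alpha> \<in> ball a r \<longrightarrow> F (X p \<alpha>) = (0::real))"
    using rFG by (intro exI[of _ r] exI[of _ F] exI[of _ G]) auto
qed (use assms in auto)

text \<open>Each end controls one tail, and compactness controls the middle. The smaller of the two
  rates serves for both tails, and \<open>exp (c * R)\<close> compensates the exponential on the
  middle range.\<close>

lemma normal_exponential_decay:
  assumes A: "saddle_end \<Omega> K f f' a b X X\<^sub>\<alpha>"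
    and B: "saddle_end \<Omega> K (\<lambda>x. - f x) (\<lambda>x. - f' x) b a (\<lambda>p. X (- p)) (\<lambda>p. X\<^sub>\<alpha> (- p))"
  obtains C c where "c > 0" "\<And>p \<alpha>. norm (cross3 (f (X p \<alpha>)) (X\<^sub>\<alpha> p \<alpha>)) \<le> C * exp (- c * \<bar>p\<bar>)"
proof -
  interpret A: saddle_end \<Omega> K f f' a b X X\<^sub>\<alpha> by (rule A)
  interpret B: saddle_end \<Omega> K "\<lambda>x. - f x" "\<lambda>x. - f' x" b a "\<lambda>p. X (- p)" "\<lambda>p. X\<^sub>\<alpha> (- p)" by (rule B)
  let ?n = "\<lambda>p \<alpha>. norm (A.normal p \<alpha>)"
  obtain C1 c1 T1 where c1: "c1 > 0" "\<And>p \<alpha>. p \<le> T1 \<Longrightarrow> ?n p \<alpha> \<le> C1 * exp (c1 * p)"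
    by (rule A.normal_exponential_decay_at_bot) (rule that, assumption+)
  obtain C2 c2 T2 where c2: "c2 > 0" "\<And>p \<alpha>. p \<le> T2 \<Longrightarrow> norm (B.normal p \<alpha>) \<le> C2 * exp (c2 * p)"
    by (rule B.normal_exponential_decay_at_bot) (rule that, assumption+)
  \<comment> \<open>Reversing time replaces \<open>f\<close> by its negative and leaves the label
    derivative unchanged, so the normal only changes sign.\<close>
  have BA: "norm (B.normal p \<alpha>) = ?n (- p) \<alpha>" for p \<alpha>
    by (simp add: B.normal_def A.normal_def)
  define R where "R = max (max (- T1) (- T2)) 0"
  define c where "c = min c1 c2"
  have "continuous_on UNIV (\<lambda>z. A.normal (fst z) (snd z))"
    by (intro A.normal_continuous_on continuous_intros)
  then have "compact ((\<lambda>z. A.normal (fst z) (snd z)) ` ({-R..R} \<times> {0..1}))"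
    by (intro compact_continuous_image compact_Times) (auto elim: continuous_on_subset)
  then obtain M where M: "\<And>z. z \<in> {-R..R} \<times> {0..1} \<Longrightarrow> norm (A.normal (fst z) (snd z)) \<le> M"
    using compact_imp_bounded bounded_iff by (metis (no_types, lifting) imageI)
  have c: "c > 0" using c1 c2 by (simp add: c_def)
  have pos: "0 \<le> \<bar>C1\<bar> * exp (- c * \<bar>p\<bar>)" "0 \<le> \<bar>C2\<bar> * exp (- c * \<bar>p\<bar>)" "0 \<le> \<bar>M\<bar> * exp (c * R) * exp (- c * \<bar>p\<bar>)" for p
    by auto
  have bound: "?n p \<alpha> \<le> (\<bar>C1\<bar> + \<bar>C2\<bar> + \<bar>M\<bar> * exp (c * R)) * exp (- c * \<bar>p\<bar>)" for p \<alpha>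
  proof -
    consider "p < - R" | "p > R" | "\<bar>p\<bar> \<le> R" by linarith
    then show ?thesis
    proof cases
      case 1
      then have p: "p \<le> T1" "p \<le> 0" by (auto simp: R_def)
      have "?n p \<alpha> \<le> C1 * exp (c1 * p)" using c1 p by auto
      also have "\<dots> \<le> \<bar>C1\<bar> * exp (- c * \<bar>p\<bar>)"
        using p by (intro mult_mono) (auto simp: c_def intro: mult_right_mono_neg)
      finally show ?thesis using pos[of p] unfolding distrib_right by linarith
    next
      case 2
      then have p: "- p \<le> T2" "p \<ge> 0" by (auto simp: R_def)
      have "?n p \<alpha> \<le> C2 * exp (c2 * (- p))" using c2(2)[OF p(1), of \<alpha>] by (simp add: BA)
      also have "\<dots> \<le> \<bar>C2\<bar> * exp (- c * \<bar>p\<bar>)"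
        using p by (intro mult_mono) (auto simp: c_def intro: mult_right_mono)
      finally show ?thesis using pos[of p] unfolding distrib_right by linarith
    next
      case 3
      have "?n p \<alpha> = ?n p (frac \<alpha>)" using A.normal_frac[of p \<alpha>] by simp
      also have "\<dots> \<le> M" using M[of "(p, frac \<alpha>)"] 3 frac_lt_1[of \<alpha>] by (auto simp: abs_le_iff)
      also have "\<dots> \<le> \<bar>M\<bar> * exp (c * R) * exp (- c * \<bar>p\<bar>)"
      proof -
        have "1 \<le> exp (c * R) * exp (- c * \<bar>p\<bar>)"
          using 3 c by (simp add: exp_add[symmetric])
        then have "\<bar>M\<bar> * 1 \<le> \<bar>M\<bar> * (exp (c * R) * exp (- c * \<bar>p\<bar>))" by (intro mult_left_mono) auto
        then show ?thesis unfolding mult.assoc by linarith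
      qed
      finally show ?thesis using pos[of p] unfolding distrib_right by linarith
    qed
  qed
  show thesis
    by (rule that[OF c]) (use bound in \<open>simp add: A.normal_def\<close>)
qed

lemma integrable_exp_neg_abs:
  fixes c :: real
  assumes "c > 0"
  shows "integrable lborel (\<lambda>\<tau>. exp (- c * \<bar>\<tau>\<bar>))"
proof -
  have "(\<lambda>\<tau>. exp (- c * \<tau>)) integrable_on {0..}"
    using has_integral_exp_minus_to_infinity[OF assms, of 0] by blast
  then have "(\<lambda>\<tau>. exp (- c * \<tau>)) absolutely_integrable_on {0..}"
    by (intro nonnegative_absolutely_integrable_1) auto
  then have i: "integrable lborel (\<lambda>\<tau>. indicator {0..} \<tau> *\<^sub>R exp (- c * \<tau>))"
    unfolding set_integrable_def by (subst (asm) integrable_completion) auto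
  from lborel_integrable_real_affine[OF this, of "-1" 0]
  have j: "integrable lborel (\<lambda>\<tau>. indicator {0..} (- \<tau>) *\<^sub>R exp (c * \<tau>))" by simp
  show ?thesis
  proof (rule Bochner_Integration.integrable_bound[OF Bochner_Integration.integrable_add[OF i j]])
    show "AE \<tau> in lborel. norm (exp (- c * \<bar>\<tau>\<bar>)) \<le> norm (indicator {0..} \<tau> *\<^sub>R exp (- c * \<tau>) + indicator {0..} (- \<tau>) *\<^sub>R exp (c * \<tau>))"
      by (intro AE_I2) (auto simp: indicator_def abs_if)
  qed measurable
qed

text \<open>Integrate in \<open>p\<close> first. Each fibre is exactly half a period starting at the
  zero \<open>\<zeta> \<alpha>\<close>, so the inner integral depends on the label only through the
  amplitude. This is also why the result is independent of \<open>k\<close> and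
  \<open>t\<close>.\<close>

lemma integral_over_ring:
  fixes A \<theta> \<zeta> :: "real \<Rightarrow> real" and \<omega> :: real
  defines "D \<equiv> {z. 0 \<le> snd z \<and> snd z < 1 \<and> \<zeta> (snd z) \<le> fst z \<and> fst z \<le> \<zeta> (snd z) + pi / \<omega>}"
  assumes "\<omega> > 0" and \<zeta>: "\<And>\<alpha>. \<omega> * \<zeta> \<alpha> = \<theta> \<alpha> - pi * (2 * of_int k + 1) / 2 + \<omega> * t + \<phi>"
    and int: "set_integrable lborel D (\<lambda>z. \<bar>A (snd z) * cos (\<omega> * (t - fst z) + \<phi> + \<theta> (snd z))\<bar>)"
  shows "(LINT z:D|lborel. \<bar>A (snd z) * cos (\<omega> * (t - fst z) + \<phi> + \<theta> (snd z))\<bar>) = 2 / \<omega> * (LINT \<alpha>:{0..1}|lborel. \<bar>A \<alpha>\<bar>)"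
proof -
  let ?M = "\<lambda>p \<alpha>. \<bar>A \<alpha> * cos (\<omega> * (t - p) + \<phi> + \<theta> \<alpha>)\<bar>"
  let ?h = "\<lambda>p \<alpha>. indicator {0..<1} \<alpha> * (indicator {\<zeta> \<alpha>..\<zeta> \<alpha> + pi / \<omega>} p * ?M p \<alpha>) :: real"
  have h: "(\<lambda>z. indicator D z *\<^sub>R ?M (fst z) (snd z)) = (\<lambda>(p, \<alpha>). ?h p \<alpha>)"
    by (auto simp: fun_eq_iff D_def indicator_def)
  have "integrable (lborel \<Otimes>\<^sub>M lborel) (\<lambda>(p, \<alpha>). ?h p \<alpha>)"
    using int unfolding set_integrable_def h by (simp add: lborel_prod)
  from lborel_pair.integral_snd[OF this]
  have "(LINT z:D|lborel. ?M (fst z) (snd z)) = (LINT \<alpha>|lborel. LINT p|lborel. ?h p \<alpha>)"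
    unfolding set_lebesgue_integral_def h by (simp add: lborel_prod)
  also have "\<dots> = (LINT \<alpha>|lborel. indicator {0..<1} \<alpha> * (2 * \<bar>A \<alpha>\<bar> / \<omega>))"
  proof (rule Bochner_Integration.integral_cong)
    fix \<alpha>
    have "(LINT p|lborel. indicator {\<zeta> \<alpha>..\<zeta> \<alpha> + pi / \<omega>} p * ?M p \<alpha>) = 2 * \<bar>A \<alpha>\<bar> / \<omega>"
      using integral_abs_cos_half_period[OF assms(2) \<zeta>, of \<alpha> "A \<alpha>"] by (simp add: set_lebesgue_integral_def)
    then show "(LINT p|lborel. ?h p \<alpha>) = indicator {0..<1} \<alpha> * (2 * \<bar>A \<alpha>\<bar> / \<omega>)"
      by (simp only: integral_mult_right_zero)
  qed simp
  also have "\<dots> = (LINT \<alpha>|lborel. indicator {0..<1} \<alpha> * \<bar>A \<alpha>\<bar> * (2 / \<omega>))"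
    by (simp add: mult_ac)
  also have "\<dots> = (LINT \<alpha>|lborel. indicator {0..<1} \<alpha> * \<bar>A \<alpha>\<bar>) * (2 / \<omega>)"
    by (rule integral_mult_left_zero)
  also have "(LINT \<alpha>|lborel. indicator {0..<1} \<alpha> * \<bar>A \<alpha>\<bar>) = (LINT \<alpha>:{0..1}|lborel. \<bar>A \<alpha>\<bar>)"
    unfolding set_lebesgue_integral_def real_scaleR_def
  proof (rule integral_discrete_difference[of "{1}"])
    show "indicator {0..<1} \<alpha> * \<bar>A \<alpha>\<bar> = indicator {0..1} \<alpha> * \<bar>A \<alpha>\<bar>" if "\<alpha> \<in> space lborel" "\<alpha> \<notin> {1}" for \<alpha>
      using that by (auto simp: indicator_def)
  qed auto
  finally show ?thesis by (simp add: mult.commute)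
qed

lemma unstable_manifold_facts:
  assumes "a \<in> \<Omega>" "f a = 0"
  shows "a \<in> unstable_manifold \<Omega> f a" "unstable_manifold \<Omega> f a \<subseteq> \<Omega>"
  using assms by (auto simp: unstable_manifold_def intro!: exI[of _ "\<lambda>_. a"])

lemma stable_manifold_facts:
  assumes "a \<in> \<Omega>" "f a = 0"
  shows "a \<in> stable_manifold \<Omega> f a" "stable_manifold \<Omega> f a \<subseteq> \<Omega>"
  using assms by (auto simp: stable_manifold_def intro!: exI[of _ "\<lambda>_. a"])

lemma C2_on_imp_continuous_on: "C2_on S f \<Longrightarrow> continuous_on S f"
  unfolding C2_on_def using has_derivative_continuous continuous_at_imp_continuous_on by blast

lemma C2_on_derivative:
  assumes "C2_on S f"
  obtains f' where "\<And>x. x \<in> S \<Longrightarrow> (f has_derivative blinfun_apply (f' x)) (at x)" "continuous_on S f'"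
proof -
  from assms obtain f' :: "'a \<Rightarrow> 'a \<Rightarrow>\<^sub>L 'b" and f'' :: "'a \<Rightarrow> 'a \<Rightarrow>\<^sub>L ('a \<Rightarrow>\<^sub>L 'b)" where
    d: "\<And>x. x \<in> S \<Longrightarrow> (f has_derivative blinfun_apply (f' x)) (at x)"
       "\<And>x. x \<in> S \<Longrightarrow> (f' has_derivative blinfun_apply (f'' x)) (at x)"
    unfolding C2_on_def by blast
  have "continuous_on S f'"
    by (intro continuous_at_imp_continuous_on ballI has_derivative_continuous[OF d(2)])
  with d(1) show thesis by (rule that)
qed

lemma C1_partials_reverse_time:
  assumes C1: "C1_partials X X1 X2"
  shows "C1_partials (\<lambda>p. X (- p)) (\<lambda>p \<alpha>. - X1 (- p) \<alpha>) (\<lambda>p. X2 (- p))"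
  unfolding C1_partials_def
proof (intro conjI allI)
  fix p \<alpha>
  have "((\<lambda>z::real \<times> real. (- fst z, snd z)) has_derivative (\<lambda>h. (- fst h, snd h))) (at (p, \<alpha>))"
    by (intro derivative_intros)
  moreover have "(case_prod X has_derivative (\<lambda>(s, u). s *\<^sub>R X1 (- p) \<alpha> + u *\<^sub>R X2 (- p) \<alpha>)) (at (- fst (p, \<alpha>), snd (p, \<alpha>)))"
    using C1 by (simp add: C1_partials_def)
  ultimately show "((\<lambda>(p, \<alpha>). X (- p) \<alpha>) has_derivative (\<lambda>(s, u). s *\<^sub>R - X1 (- p) \<alpha> + u *\<^sub>R X2 (- p) \<alpha>)) (at (p, \<alpha>))"
    using has_derivative_compose by (fastforce simp: case_prod_unfold)
next
  have c: "continuous_on UNIV (\<lambda>z. g (- fst z) (snd z))" if "continuous_on UNIV (case_prod g)" for g :: "real \<Rightarrow> real \<Rightarrow> real^3"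
  proof -
    have "continuous_on UNIV (\<lambda>z::real \<times> real. (- fst z, snd z))" by (intro continuous_intros)
    from continuous_on_compose2[OF that this] show ?thesis by simp
  qed
  show "continuous_on UNIV (\<lambda>(p, \<alpha>). - X1 (- p) \<alpha>)" "continuous_on UNIV (\<lambda>(p, \<alpha>). X2 (- p) \<alpha>)"
    using C1 c[of X1] c[of X2] by (auto simp: C1_partials_def case_prod_unfold intro!: continuous_on_minus)
qed

lemma saddle_spectrum_uminus_surj:
  assumes "(f has_derivative blinfun_apply L) (at a)" "saddle_spectrum (jacobian f (at a)) l0 l1 l2" "l0 \<noteq> 0" "l1 \<noteq> 0" "l2 \<noteq> 0"
  shows "surj (blinfun_apply L)" "surj (blinfun_apply (- L))"
proof -
  have "jacobian f (at a) = matrix (blinfun_apply L)"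
    unfolding jacobian_def frechet_derivative_at[OF assms(1), symmetric] ..
  then show s: "surj (blinfun_apply L)"
    using saddle_spectrum_surj[of "blinfun_apply L"] assms(2-5) bounded_linear.linear[OF blinfun.bounded_linear_right[of L]] by metis
  have "\<exists>x. y = (- L) x" for y
  proof -
    obtain x where "- y = L x" using s by (metis surjD)
    then show ?thesis by (intro exI[of _ x]) (simp add: uminus_blinfun.rep_eq minus_equation_iff[of y])
  qed
  then show "surj (blinfun_apply (- L))" unfolding surj_def by blast
qed

section \<open>The lobe in tubular coordinates and its volume\<close>

lemma unit_normal_inner:
  "surface_normal f X p \<alpha> \<bullet> unit_normal f X p \<alpha> = norm (surface_normal f X p \<alpha>)"
  by (cases "surface_normal f X p \<alpha> = 0") (simp_all add: unit_normal_def dot_square_norm power2_eq_square)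

text \<open>The lobe parameter \<open>s\<close> is the convex parameter on the segment from the
  stable height to the unstable height. The lobe thereby becomes the region between two graphs
  scaled by \<open>\<epsilon>\<close>.\<close>

lemma lobe_eq_image:
  "lobe f g X \<omega> \<phi> \<theta> t k \<epsilon> =
     (\<lambda>v. X (v $ 1) (v $ 2) + v $ 3 *\<^sub>R unit_normal f X (v $ 1) (v $ 2)) `
     {v::real^3. v $ 2 \<in> {0..<1} \<and>
        v $ 1 \<in> closed_segment (melnikov_zero \<omega> \<phi> \<theta> t (v $ 2) (k - 1)) (melnikov_zero \<omega> \<phi> \<theta> t (v $ 2) k) \<and>
        v $ 3 \<in> closed_segment (\<epsilon> * (melnikov_s f g X (v $ 1) (v $ 2) t / norm (surface_normal f X (v $ 1) (v $ 2))))
                              (\<epsilon> * (melnikov_u f g X (v $ 1) (v $ 2) t / norm (surface_normal f X (v $ 1) (v $ 2))))}"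
    (is "?L = ?\<Psi> ` ?S")
proof -
  have r: "\<epsilon> * (s * u + (1 - s) * v) / n = (1 - s) *\<^sub>R (\<epsilon> * (v / n)) + s *\<^sub>R (\<epsilon> * (u / n))" for s u v n :: real
    by (simp add: field_simps add_divide_distrib[symmetric])
  show ?thesis
  proof
    show "?L \<subseteq> ?\<Psi> ` ?S"
    proof
      fix x assume "x \<in> ?L"
      then obtain p \<alpha> s where x: "\<alpha> \<in> {0..<1}" "p \<in> closed_segment (melnikov_zero \<omega> \<phi> \<theta> t \<alpha> (k - 1)) (melnikov_zero \<omega> \<phi> \<theta> t \<alpha> k)"
          "s \<in> {0..1}"
          "x = X p \<alpha> + ((\<epsilon> * (s * melnikov_u f g X p \<alpha> t + (1 - s) * melnikov_s f g X p \<alpha> t)) / norm (surface_normal f X p \<alpha>)) *\<^sub>R unit_normal f X p \<alpha>"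
        unfolding lobe_def by blast
      let ?v = "vector [p, \<alpha>, (\<epsilon> * (s * melnikov_u f g X p \<alpha> t + (1 - s) * melnikov_s f g X p \<alpha> t)) / norm (surface_normal f X p \<alpha>)] :: real^3"
      have "?v \<in> ?S"
        using x(1-3) by (auto simp: r in_segment(1) intro!: exI[of _ s])
      moreover have "x = ?\<Psi> ?v" using x(4) by simp
      ultimately show "x \<in> ?\<Psi> ` ?S" by blast
    qed
    show "?\<Psi> ` ?S \<subseteq> ?L"
    proof
      fix x assume "x \<in> ?\<Psi> ` ?S"
      then obtain v where v: "v \<in> ?S" "x = ?\<Psi> v" by blast
      then obtain s where s: "0 \<le> s" "s \<le> 1"
        "v $ 3 = (1 - s) *\<^sub>R (\<epsilon> * (melnikov_s f g X (v $ 1) (v $ 2) t / norm (surface_normal f X (v $ 1) (v $ 2))))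
           + s *\<^sub>R (\<epsilon> * (melnikov_u f g X (v $ 1) (v $ 2) t / norm (surface_normal f X (v $ 1) (v $ 2))))"
        by (auto simp: in_segment(1))
      show "x \<in> ?L"
        unfolding lobe_def mem_Collect_eq
        by (rule exI[of _ "v $ 1"], rule exI[of _ "v $ 2"], rule exI[of _ s]) (use v s in \<open>auto simp: r\<close>)
    qed
  qed
qed

text \<open>The geometry of the saddles enters only through the decay of the normal. What remains is
  to verify measurability and bounds for the two heights over the ring and then to evaluate the
  leading integral.\<close>

lemma lobe_volume:
  fixes gt :: "real^3 \<Rightarrow> real^3"
  assumes C1: "C1_partials X (\<lambda>p \<alpha>. f (X p \<alpha>)) X2"
    and C1N: "C1_partials (surface_normal f X) N1 N2"
    and N_eq: "\<And>p \<alpha>. surface_normal f X p \<alpha> = cross3 (f (X p \<alpha>)) (X2 p \<alpha>)"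
    and N_nz: "\<And>p \<alpha>. surface_normal f X p \<alpha> \<noteq> 0"
    and N_per: "\<And>p \<alpha>. surface_normal f X p (\<alpha> + 1) = surface_normal f X p \<alpha>"
    and X_per: "\<And>p \<alpha>. X p (\<alpha> + 1) = X p \<alpha>"
    and X_inj: "inj_on (case_prod X) {(p, \<alpha>). \<alpha> \<in> {0..<1}}"
    and X_dom: "\<And>p \<alpha>. X p \<alpha> \<in> \<Omega>"
    and c: "c > 0" and decay: "\<And>p \<alpha>. norm (surface_normal f X p \<alpha>) \<le> C * exp (- c * \<bar>p\<bar>)"
    and gt: "continuous_on \<Omega> gt" "bounded (gt ` \<Omega>)"
    and g: "\<And>x t. x \<in> \<Omega> \<Longrightarrow> g x t = cos (\<omega> * t + \<phi>) *\<^sub>R gt x"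
    and omega: "\<omega> > 0"
    and four: "\<And>\<alpha>. fourier (melnikov_amplitude f gt X \<alpha>) \<omega> =
           of_real (norm (fourier (melnikov_amplitude f gt X \<alpha>) \<omega>)) * cis (\<theta> \<alpha>)"
    and \<theta>: "continuous_on UNIV \<theta>"
  shows "(\<lambda>\<epsilon>. measure lebesgue (lobe f g X \<omega> \<phi> \<theta> t k \<epsilon>) -
          2 * \<epsilon> / \<omega> * (LINT \<alpha>:{0..1}|lborel. norm (fourier (melnikov_amplitude f gt X \<alpha>) \<omega>)))
      \<in> O[at_right 0](\<lambda>\<epsilon>. \<epsilon>\<^sup>2)"
proof -
  define N where "N = surface_normal f X"
  define h where "h = melnikov_amplitude f gt X"
  define A where "A \<alpha> = norm (fourier (h \<alpha>) \<omega>)" for \<alpha>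
  define Mu where "Mu p \<alpha> = melnikov_u f g X p \<alpha> t" for p \<alpha>
  define Ms where "Ms p \<alpha> = melnikov_s f g X p \<alpha> t" for p \<alpha>
  have N0: "N p \<alpha> \<noteq> 0" for p \<alpha> using N_nz by (simp add: N_def)
  have N_cont: "continuous_on UNIV (case_prod N)"
    unfolding N_def by (rule C1_partials_cont[OF C1N])
  have X_cont: "continuous_on UNIV (case_prod X)"
    by (rule C1_partials_cont[OF C1])
  have gtX_cont: "continuous_on UNIV (\<lambda>z. gt (case_prod X z))"
    by (rule continuous_on_compose2[OF gt(1) X_cont]) (auto simp: X_dom)
  have h_eq: "h \<alpha> \<tau> = N \<tau> \<alpha> \<bullet> gt (X \<tau> \<alpha>)" for \<alpha> \<tau>
    by (simp add: h_def N_def melnikov_amplitude_def)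
  have h_cont: "continuous_on UNIV (\<lambda>z. h (snd z) (fst z))"
    using continuous_on_inner[OF N_cont gtX_cont] by (simp add: h_eq case_prod_unfold)
  have h_comp: "continuous_on UNIV (\<lambda>x. h (a x) (b x))"
    if "continuous_on UNIV a" "continuous_on UNIV b" for a b :: "'z::topological_space \<Rightarrow> real"
    using continuous_on_compose2[OF h_cont continuous_on_Pair[OF that(2,1)]] by simp
  obtain G where G: "\<And>x. x \<in> \<Omega> \<Longrightarrow> norm (gt x) \<le> G"
    using gt(2) by (auto simp: bounded_iff)
  have G0: "G \<ge> 0" using G[OF X_dom] norm_ge_zero order_trans by blast
  \<comment> \<open>An integrable majorant of the Melnikov amplitude that is the same for all
    labels. Its integral \<open>I\<close> bounds both Melnikov functions for every \<open>p\<close>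
    and \<alpha>.\<close>
  define E where "E \<tau> = C * G * exp (- c * \<bar>\<tau>\<bar>)" for \<tau>
  have hE: "\<bar>h \<alpha> \<tau>\<bar> \<le> E \<tau>" for \<alpha> \<tau>
  proof -
    have "\<bar>h \<alpha> \<tau>\<bar> \<le> norm (N \<tau> \<alpha>) * norm (gt (X \<tau> \<alpha>))"
      unfolding h_eq by (rule Cauchy_Schwarz_ineq2)
    also have "\<dots> \<le> (C * exp (- c * \<bar>\<tau>\<bar>)) * G"
      unfolding N_def by (rule mult_mono[OF decay G[OF X_dom] order_trans[OF norm_ge_zero decay] norm_ge_zero])
    finally show ?thesis by (simp add: E_def mult_ac)
  qed
  have E_int: "integrable lborel E"
    unfolding E_def by (intro integrable_mult_right integrable_exp_neg_abs c)
  define I where "I = (LINT \<tau>|lborel. E \<tau>)"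
  have h_int: "integrable lborel (h \<alpha>)" for \<alpha>
  proof (rule Bochner_Integration.integrable_bound[OF E_int])
    have "continuous_on UNIV (h \<alpha>)" using h_comp[of "\<lambda>_. \<alpha>" "\<lambda>x. x"] by simp
    then show "h \<alpha> \<in> borel_measurable lborel" using borel_measurable_continuous_onI by simp
    show "AE \<tau> in lborel. norm (h \<alpha> \<tau>) \<le> norm (E \<tau>)"
      using hE by (intro AE_I2) (metis abs_ge_self order_trans real_norm_def)
  qed
  have integrand: "melnikov_integrand f g X p \<alpha> t \<tau> = h \<alpha> \<tau> * cos (\<omega> * (\<tau> + t - p) + \<phi>)" for p \<alpha> \<tau>
    by (simp add: melnikov_integrand_def h_eq N_def g[OF X_dom])
  have Mu_eq: "Mu p \<alpha> = (LINT \<tau>|lborel. indicator {..p} \<tau> *\<^sub>R (h \<alpha> \<tau> * cos (\<omega> * (\<tau> + t - p) + \<phi>)))" for p \<alpha>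
    by (simp add: Mu_def melnikov_u_def integrand set_lebesgue_integral_def)
  have Ms_eq: "Ms p \<alpha> = - (LINT \<tau>|lborel. indicator {p..} \<tau> *\<^sub>R (h \<alpha> \<tau> * cos (\<omega> * (\<tau> + t - p) + \<phi>)))" for p \<alpha>
    by (simp add: Ms_def melnikov_s_def integrand set_lebesgue_integral_def)
  have bound: "\<bar>LINT \<tau>|lborel. indicator S \<tau> *\<^sub>R (h \<alpha> \<tau> * cos (\<omega> * (\<tau> + t - p) + \<phi>))\<bar> \<le> I" for S :: "real set" and p \<alpha>
  proof -
    have pt: "\<bar>indicator S \<tau> *\<^sub>R (h \<alpha> \<tau> * cos (\<omega> * (\<tau> + t - p) + \<phi>))\<bar> \<le> E \<tau>" for \<tau>
    proof -
      have "\<bar>indicator S \<tau> *\<^sub>R (h \<alpha> \<tau> * cos (\<omega> * (\<tau> + t - p) + \<phi>))\<bar> \<le> \<bar>h \<alpha> \<tau>\<bar>"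
        by (auto simp: indicator_def abs_mult mult_left_le)
      with hE show ?thesis using order_trans by blast
    qed
    have "\<bar>LINT \<tau>|lborel. indicator S \<tau> *\<^sub>R (h \<alpha> \<tau> * cos (\<omega> * (\<tau> + t - p) + \<phi>))\<bar>
        \<le> (LINT \<tau>|lborel. \<bar>indicator S \<tau> *\<^sub>R (h \<alpha> \<tau> * cos (\<omega> * (\<tau> + t - p) + \<phi>))\<bar>)"
      by (rule integral_abs_bound)
    also have "\<dots> \<le> I"
      unfolding I_def by (rule integral_mono'[OF E_int pt order_trans[OF abs_ge_zero pt]])
    finally show ?thesis .
  qed
  have Mu_bd: "\<bar>Mu p \<alpha>\<bar> \<le> I" and Ms_bd: "\<bar>Ms p \<alpha>\<bar> \<le> I" for p \<alpha>
    using bound[of "{..p}" \<alpha> p] bound[of "{p..}" \<alpha> p] by (simp_all add: Mu_eq Ms_eq)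
  have diff: "Mu p \<alpha> - Ms p \<alpha> = A \<alpha> * cos (\<omega> * (t - p) + \<phi> + \<theta> \<alpha>)" for p \<alpha>
    using half_lines_harmonic_integral[OF h_int[of \<alpha>], of \<omega> "\<theta> \<alpha>" p t \<phi>] four[of \<alpha>]
    by (simp add: Mu_eq Ms_eq set_lebesgue_integral_def A_def h_def)
  have Mu_m: "(\<lambda>z. Mu (fst z) (snd z)) \<in> borel_measurable borel"
    and Ms_m: "(\<lambda>z. Ms (fst z) (snd z)) \<in> borel_measurable borel"
  proof -
    \<comment> \<open>The half-line of integration moves with \<open>p\<close>, so its indicator is
      read as that of a closed half-plane in (p, \<tau>). This makes the integrand jointly
      measurable, and the parameter integral is then measurable.\<close>
    have m: "(\<lambda>(z, \<tau>). indicator S (fst z, \<tau>) *\<^sub>R (h (snd z) \<tau> * cos (\<omega> * (\<tau> + t - fst z) + \<phi>)))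
        \<in> borel_measurable (borel \<Otimes>\<^sub>M lborel)"
      if S: "closed S" for S :: "(real \<times> real) set"
    proof -
      have "continuous_on UNIV (\<lambda>x::(real \<times> real) \<times> real. h (snd (fst x)) (snd x) * cos (\<omega> * (snd x + t - fst (fst x)) + \<phi>))"
        by (intro continuous_intros h_comp)
      then have 1: "(\<lambda>x::(real \<times> real) \<times> real. h (snd (fst x)) (snd x) * cos (\<omega> * (snd x + t - fst (fst x)) + \<phi>)) \<in> borel_measurable borel"
        by (rule borel_measurable_continuous_onI)
      have "(\<lambda>x::(real \<times> real) \<times> real. (fst (fst x), snd x)) \<in> borel_measurable borel"
        by (intro borel_measurable_continuous_onI continuous_intros)
      then have 2: "(\<lambda>x::(real \<times> real) \<times> real. indicator S (fst (fst x), snd x) :: real) \<in> borel_measurable borel"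
        by (rule measurable_compose) (use S in simp)
      from borel_measurable_scaleR[OF 2 1] show ?thesis
        by (simp add: case_prod_unfold borel_prod[symmetric] cong: measurable_cong_sets)
    qed
    have "closed {(p, \<tau>). \<tau> \<le> (p::real)}" "closed {(p, \<tau>). p \<le> (\<tau>::real)}"
      unfolding case_prod_unfold by (intro closed_Collect_le continuous_intros)+
    note mm = this[THEN m, THEN lborel.borel_measurable_lebesgue_integral]
    have i: "indicator {(p, \<tau>). \<tau> \<le> p} (p, \<tau>) = (indicator {..p} \<tau> :: real)"
      "indicator {(p, \<tau>). p \<le> \<tau>} (p, \<tau>) = (indicator {p..} \<tau> :: real)" for p \<tau> :: real
      by (auto simp: indicator_def)
    show "(\<lambda>z. Mu (fst z) (snd z)) \<in> borel_measurable borel"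
      using mm(1) unfolding Mu_eq i .
    show "(\<lambda>z. Ms (fst z) (snd z)) \<in> borel_measurable borel"
      using mm(2) unfolding Ms_eq i by (rule borel_measurable_uminus)
  qed
  obtain \<nu>1 \<nu>2 where C1\<nu>: "C1_partials (unit_normal f X) \<nu>1 \<nu>2"
  proof (rule C1_partials_normalize[OF C1N N_nz])
    fix \<nu>1 \<nu>2 assume "C1_partials (\<lambda>p \<alpha>. surface_normal f X p \<alpha> /\<^sub>R norm (surface_normal f X p \<alpha>)) \<nu>1 \<nu>2"
    then show thesis by (intro that) (simp add: unit_normal_def[abs_def])
  qed
  interpret T: tube X "\<lambda>p \<alpha>. f (X p \<alpha>)" X2 "unit_normal f X" \<nu>1 \<nu>2
  proof
    show "0 < cross3 (f (X p \<alpha>)) (X2 p \<alpha>) \<bullet> unit_normal f X p \<alpha>" for p \<alpha>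
      using N_nz by (simp add: N_eq[symmetric] unit_normal_inner)
    show "unit_normal f X p (\<alpha> + 1) = unit_normal f X p \<alpha>" for p \<alpha>
      by (simp add: unit_normal_def N_per)
  qed (use C1 C1\<nu> X_per X_inj in \<open>simp_all add: C1_partials_def\<close>)
  have area: "T.area p \<alpha> = norm (N p \<alpha>)" for p \<alpha>
    by (simp add: T.area_def N_eq[symmetric] unit_normal_inner N_def)
  define \<zeta> where "\<zeta> \<alpha> = melnikov_zero \<omega> \<phi> \<theta> t \<alpha> k" for \<alpha>
  have \<zeta>_omega: "\<omega> * \<zeta> \<alpha> = \<theta> \<alpha> - pi * (2 * of_int k + 1) / 2 + \<omega> * t + \<phi>" for \<alpha>
    using omega by (simp add: \<zeta>_def melnikov_zero_def)
  \<comment> \<open>Lowering the index moves the zero half a period later, so the curve with index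
    \<open>k - 1\<close> is the upper end of the segment.\<close>
  have \<zeta>_prev: "melnikov_zero \<omega> \<phi> \<theta> t \<alpha> (k - 1) = \<zeta> \<alpha> + pi / \<omega>" for \<alpha>
    using omega by (simp add: \<zeta>_def melnikov_zero_def field_simps)
  have \<zeta>_cont: "continuous_on S \<zeta>" for S
    unfolding \<zeta>_def melnikov_zero_def using omega by (intro continuous_intros continuous_on_subset[OF \<theta>]) auto
  define D where "D = {z. 0 \<le> snd z \<and> snd z < 1 \<and> \<zeta> (snd z) \<le> fst z \<and> fst z \<le> \<zeta> (snd z) + pi / \<omega>}"
  have seg: "closed_segment (melnikov_zero \<omega> \<phi> \<theta> t \<alpha> (k - 1)) (melnikov_zero \<omega> \<phi> \<theta> t \<alpha> k) = {\<zeta> \<alpha>..\<zeta> \<alpha> + pi / \<omega>}" for \<alpha>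
  proof -
    have "0 < pi / \<omega>" using omega by (rule divide_pos_pos[OF pi_gt_zero])
    then show ?thesis unfolding \<zeta>_prev \<zeta>_def[symmetric] closed_segment_eq_real_ivl by simp
  qed
  have D_m [measurable]: "D \<in> sets borel"
  proof -
    have [measurable]: "(\<lambda>z::real \<times> real. \<zeta> (snd z)) \<in> borel_measurable borel"
      by (intro borel_measurable_continuous_onI continuous_on_compose2[OF \<zeta>_cont[of UNIV]] continuous_intros) auto
    have [measurable]: "fst \<in> borel_measurable (borel :: (real \<times> real) measure)" "snd \<in> borel_measurable (borel :: (real \<times> real) measure)"
      by (intro borel_measurable_continuous_onI continuous_intros)+
    show ?thesis unfolding D_def by measurable
  qed
  have "compact (\<zeta> ` {0..1})" by (intro compact_continuous_image \<zeta>_cont) simp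
  then obtain P0 where P0: "\<And>\<alpha>. \<alpha> \<in> {0..1} \<Longrightarrow> \<bar>\<zeta> \<alpha>\<bar> \<le> P0"
    using compact_imp_bounded bounded_iff by (metis imageI real_norm_def)
  \<comment> \<open>Continuity of \<theta> bounds the lower curve over a full turn; adding the half
    period bounds the whole ring.\<close>
  define P where "P = P0 + pi / \<omega>"
  have DP: "D \<subseteq> {-P..P} \<times> {0..<1}"
  proof
    fix z assume z: "z \<in> D"
    then have "\<bar>\<zeta> (snd z)\<bar> \<le> P0" "0 \<le> pi / \<omega>" using P0[of "snd z"] omega by (auto simp: D_def)
    then show "z \<in> {-P..P} \<times> {0..<1}" using z by (auto simp: D_def P_def mem_Times_iff)
  qed
  have nc: "continuous_on ({-P..P} \<times> {0..1}) (\<lambda>z. norm (case_prod N z))"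
    by (intro continuous_intros continuous_on_subset[OF N_cont]) auto
  \<comment> \<open>The heights are divided by the norm of the normal, which decays as p tends to
    either infinity. Over the bounded ring it has a positive minimum.\<close>
  have "\<exists>m>0. \<forall>z\<in>D. m \<le> norm (case_prod N z)"
  proof (cases "{-P..P} \<times> {0..1::real} = {}")
    case True
    then have "D = {}" using DP by auto
    then show ?thesis by (auto intro: exI[of _ 1])
  next
    case False
    have "compact ({-P..P} \<times> {0..1::real})" by (intro compact_Times) auto
    from continuous_attains_inf[OF this False nc]
    obtain w where w: "\<forall>z\<in>{-P..P} \<times> {0..1}. norm (case_prod N w) \<le> norm (case_prod N z)" by blast
    show ?thesis
    proof (intro exI[of _ "norm (case_prod N w)"] conjI ballI)
      show "0 < norm (case_prod N w)" using N0 by (cases w) simp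
      fix z assume "z \<in> D"
      then show "norm (case_prod N w) \<le> norm (case_prod N z)" using w DP by force
    qed
  qed
  then obtain m where m: "m > 0" "\<And>z. z \<in> D \<Longrightarrow> m \<le> norm (N (fst z) (snd z))"
    by (auto simp: case_prod_unfold)
  define lo where "lo z = Ms (fst z) (snd z) / norm (N (fst z) (snd z))" for z
  define hi where "hi z = Mu (fst z) (snd z) / norm (N (fst z) (snd z))" for z
  have nm: "(\<lambda>z. norm (N (fst z) (snd z))) \<in> borel_measurable borel"
    using N_cont by (intro borel_measurable_continuous_onI continuous_on_norm) (simp add: case_prod_unfold)
  have lo_m: "lo \<in> borel_measurable borel" and hi_m: "hi \<in> borel_measurable borel"
    unfolding lo_def hi_def by (rule borel_measurable_divide[OF Ms_m nm], rule borel_measurable_divide[OF Mu_m nm])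
  have quot: "\<bar>x / y\<bar> \<le> I / m" if "\<bar>x\<bar> \<le> I" "m \<le> y" for x y
    using that m(1) by (simp add: abs_divide frac_le)
  have lo_bd: "\<bar>lo z\<bar> \<le> I / m" and hi_bd: "\<bar>hi z\<bar> \<le> I / m" if "z \<in> D" for z
    unfolding lo_def hi_def by (intro quot Mu_bd Ms_bd m(2) that)+
  \<comment> \<open>The area density is the same norm by which the heights are divided. It cancels,
    leaving the modulus of the Melnikov function.\<close>
  have hilo: "\<bar>hi z - lo z\<bar> * case_prod T.area z = \<bar>A (snd z) * cos (\<omega> * (t - fst z) + \<phi> + \<theta> (snd z))\<bar>" for z
  proof -
    have "hi z - lo z = (Mu (fst z) (snd z) - Ms (fst z) (snd z)) / norm (N (fst z) (snd z))"
      by (simp add: hi_def lo_def diff_divide_distrib)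
    then show ?thesis
      using N0 by (simp add: diff area case_prod_unfold)
  qed
  have D_int: "set_integrable lborel D (\<lambda>z. \<bar>A (snd z) * cos (\<omega> * (t - fst z) + \<phi> + \<theta> (snd z))\<bar>)"
  proof (rule set_integrable_bound[where f = "\<lambda>_. 2 * I"])
    have "bounded D" by (rule bounded_subset[OF _ DP]) (simp add: bounded_Times)
    then show "set_integrable lborel D (\<lambda>_. 2 * I)"
      using emeasure_bounded_finite[of D] by (auto simp: set_integrable_def)
    have [measurable]: "(\<lambda>z. \<bar>A (snd z) * cos (\<omega> * (t - fst z) + \<phi> + \<theta> (snd z))\<bar>) \<in> borel_measurable borel"
      unfolding diff[symmetric] using Mu_m Ms_m by measurable
    show "set_borel_measurable lborel D (\<lambda>z. \<bar>A (snd z) * cos (\<omega> * (t - fst z) + \<phi> + \<theta> (snd z))\<bar>)"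
      unfolding set_borel_measurable_def by measurable
    have le: "norm \<bar>Mu p \<alpha> - Ms p \<alpha>\<bar> \<le> norm (2 * I)" for p \<alpha>
      using Mu_bd[of p \<alpha>] Ms_bd[of p \<alpha>] unfolding real_norm_def by linarith
    show "AE z in lborel. z \<in> D \<longrightarrow> norm \<bar>A (snd z) * cos (\<omega> * (t - fst z) + \<phi> + \<theta> (snd z))\<bar> \<le> norm (2 * I)"
      unfolding diff[symmetric] by (intro AE_I2 impI le)
  qed
  have total: "(LINT z:D|lborel. \<bar>hi z - lo z\<bar> * case_prod T.area z) = 2 / \<omega> * (LINT \<alpha>:{0..1}|lborel. A \<alpha>)"
    unfolding hilo using integral_over_ring[OF omega \<zeta>_omega D_int[unfolded D_def]]
    by (simp add: D_def A_def)
  have lobe: "lobe f g X \<omega> \<phi> \<theta> t k \<epsilon> = T.coords ` {v. (v $ 1, v $ 2) \<in> D \<and>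
              v $ 3 \<in> closed_segment (\<epsilon> * lo (v $ 1, v $ 2)) (\<epsilon> * hi (v $ 1, v $ 2))}" for \<epsilon>
  proof -
    have "T.coords = (\<lambda>v. X (v $ 1) (v $ 2) + v $ 3 *\<^sub>R unit_normal f X (v $ 1) (v $ 2))"
      by (simp add: T.coords_def fun_eq_iff)
    moreover have "{v. (v $ 1, v $ 2) \<in> D \<and> v $ 3 \<in> closed_segment (\<epsilon> * lo (v $ 1, v $ 2)) (\<epsilon> * hi (v $ 1, v $ 2))}
        = {v::real^3. v $ 2 \<in> {0..<1} \<and> v $ 1 \<in> {\<zeta> (v $ 2)..\<zeta> (v $ 2) + pi / \<omega>} \<and>
           v $ 3 \<in> closed_segment (\<epsilon> * lo (v $ 1, v $ 2)) (\<epsilon> * hi (v $ 1, v $ 2))}"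
      by (auto simp: D_def)
    ultimately show ?thesis
      unfolding lobe_eq_image seg by (simp add: lo_def hi_def Mu_def Ms_def N_def)
  qed
  have A_eq: "A = (\<lambda>\<alpha>. norm (fourier (melnikov_amplitude f gt X \<alpha>) \<omega>))"
    by (simp add: A_def h_def fun_eq_iff)
  from T.volume_between_graphs[OF D_m lo_m hi_m DP lo_bd hi_bd]
  show ?thesis
    unfolding lobe[symmetric] total A_eq by (simp add: mult_ac)
qed

theorem theorem6:
  fixes \<Omega> \<Gamma> :: "(real^3) set"
    and f gt :: "real^3 \<Rightarrow> real^3"
    and g :: "real^3 \<Rightarrow> real \<Rightarrow> real^3"
    and a b :: "real^3"
    and X :: "real \<Rightarrow> real \<Rightarrow> real^3"
    and \<omega> \<phi> :: real
    and \<theta> :: "real \<Rightarrow> real"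
  assumes "open \<Omega>"
    and "C2_on \<Omega> f"
    and "bounded ((\<lambda>x. onorm (frechet_derivative f (at x))) ` \<Omega>)"
    and "\<And>t. C2_on \<Omega> (\<lambda>x. g x t)"
    and "bounded {g x t | x t. x \<in> \<Omega>}"
    and "bounded {onorm (frechet_derivative (\<lambda>y. g y t) (at x)) | x t. x \<in> \<Omega>}"
    \<comment> \<open>fixed points\<close>
    and "a \<in> \<Omega>" "b \<in> \<Omega>" "a \<noteq> b" "f a = 0" "f b = 0"
    and "\<exists>l0 l1 l2. saddle_spectrum (jacobian f (at a)) l0 l1 l2 \<and> l0 < 0 \<and> Re l1 > 0 \<and> Re l2 > 0"
    and "\<exists>l0 l1 l2. saddle_spectrum (jacobian f (at b)) l0 l1 l2 \<and> l0 > 0 \<and> Re l1 < 0 \<and> Re l2 < 0"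
    \<comment> \<open>heteroclinic manifold\<close>
    and "C2_surface (unstable_manifold \<Omega> f a)" "C2_surface (stable_manifold \<Omega> f b)"
    and "unstable_manifold \<Omega> f a - {a} = \<Gamma>" "stable_manifold \<Omega> f b - {b} = \<Gamma>"
    and "orientable_surface \<Gamma>"
    and "compact (\<Gamma> \<union> {a, b})" "inside (\<Gamma> \<union> {a, b}) \<noteq> {}"
    \<comment> \<open>parametrization\<close>
    and "C2_on UNIV (\<lambda>(p, \<alpha>). X p \<alpha>)"
    and "\<And>p \<alpha>. X p (\<alpha> + 1) = X p \<alpha>"
    and "bij_betw (\<lambda>(p, \<alpha>). X p \<alpha>) {(p, \<alpha>). \<alpha> \<in> {0..<1}} \<Gamma>"
    and "\<And>p \<alpha>. ((\<lambda>q. X q \<alpha>) has_vector_derivative f (X p \<alpha>)) (at p)"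
    and "\<And>\<alpha>. ((\<lambda>p. X p \<alpha>) \<longlongrightarrow> a) at_bot"
    and "\<And>\<alpha>. ((\<lambda>p. X p \<alpha>) \<longlongrightarrow> b) at_top"
    and "\<And>p \<alpha>. surface_normal f X p \<alpha> \<noteq> 0"
    and "\<And>p \<alpha>. \<forall>\<^sub>F r in at_right 0.
           X p \<alpha> + r *\<^sub>R surface_normal f X p \<alpha> \<in> outside (\<Gamma> \<union> {a, b}) \<and>
           X p \<alpha> - r *\<^sub>R surface_normal f X p \<alpha> \<in> inside (\<Gamma> \<union> {a, b})"
    \<comment> \<open>harmonic perturbation, volume-preserving unperturbed flow\<close>
    and "\<omega> > 0"
    and "\<And>x t. x \<in> \<Omega> \<Longrightarrow> g x t = cos (\<omega> * t + \<phi>) *\<^sub>R gt x"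
    and "bounded (gt ` \<Omega>)"
    and "bounded ((\<lambda>x. onorm (frechet_derivative gt (at x))) ` \<Omega>)"
    and "\<And>x. x \<in> \<Omega> \<Longrightarrow> divergence f x = 0"
    \<comment> \<open>the zeros of the Melnikov function form closed rings\<close>
    and "\<exists>\<alpha>. fourier (melnikov_amplitude f gt X \<alpha>) \<omega> \<noteq> 0"
    and "\<And>\<alpha>. fourier (melnikov_amplitude f gt X \<alpha>) \<omega> =
           of_real (norm (fourier (melnikov_amplitude f gt X \<alpha>) \<omega>)) * cis (\<theta> \<alpha>)"
    and "continuous_on UNIV \<theta>"
    and "\<And>\<alpha>. \<theta> (\<alpha> + 1) = \<theta> \<alpha>"
  shows "\<And>t k.
    (\<lambda>\<epsilon>. measure lebesgue (lobe f g X \<omega> \<phi> \<theta> t k \<epsilon>) -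
          2 * \<epsilon> / \<omega> * (LINT \<alpha>:{0..1}|lborel. norm (fourier (melnikov_amplitude f gt X \<alpha>) \<omega>)))
      \<in> O[at_right 0](\<lambda>\<epsilon>. \<epsilon>\<^sup>2)"
proof -
  fix t :: real and k :: int
  note X_per = assms(22) and X_ode = assms(24)
  obtain f' where f': "\<And>x. x \<in> \<Omega> \<Longrightarrow> (f has_derivative blinfun_apply (f' x)) (at x)" "continuous_on \<Omega> f'"
    by (rule C2_on_derivative[OF assms(2)]) (rule that, assumption+)
  obtain X1 X2 X11 X12 X21 X22 where C1: "C1_partials X X1 X2" "C1_partials X1 X11 X12" "C1_partials X2 X21 X22"
    by (rule C2_on_partials[OF assms(21)]) (rule that, assumption+)
  have dX: "(case_prod X has_derivative (\<lambda>(s, u). s *\<^sub>R X1 p \<alpha> + u *\<^sub>R X2 p \<alpha>)) (at (p, \<alpha>))" for p \<alpha>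
    using C1(1) by (simp add: C1_partials_def)
  \<comment> \<open>The time partial produced by the smoothness hypothesis is identified with the
    vector field through uniqueness of derivatives.\<close>
  have "X1 p \<alpha> = f (X p \<alpha>)" for p \<alpha>
  proof -
    have "((\<lambda>q. (q, \<alpha>)) has_derivative (\<lambda>s. (s, 0))) (at p)"
      by (auto intro!: derivative_eq_intros)
    from has_derivative_compose[OF this dX] have "((\<lambda>q. X q \<alpha>) has_vector_derivative X1 p \<alpha>) (at p)"
      by (simp add: has_vector_derivative_def)
    then show ?thesis by (rule vector_derivative_unique_at[OF _ X_ode])
  qed
  then have X1: "X1 = (\<lambda>p \<alpha>. f (X p \<alpha>))" by blast
  have X2: "((\<lambda>\<beta>. X p \<beta>) has_vector_derivative X2 p \<alpha>) (at \<alpha>)" for p \<alpha>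
  proof -
    have "((\<lambda>\<beta>. (p, \<beta>)) has_derivative (\<lambda>s. (0, s))) (at \<alpha>)"
      by (auto intro!: derivative_eq_intros)
    from has_derivative_compose[OF this dX] show ?thesis
      by (simp add: has_vector_derivative_def)
  qed
  have N: "surface_normal f X p \<alpha> = cross3 (f (X p \<alpha>)) (X2 p \<alpha>)" for p \<alpha>
    by (simp add: surface_normal_def vector_derivative_at[OF X2])
  have N_per: "surface_normal f X p (\<alpha> + 1) = surface_normal f X p \<alpha>" for p \<alpha>
  proof -
    have "((\<lambda>\<beta>. X p (\<beta> + 1)) has_vector_derivative X2 p (\<alpha> + 1)) (at \<alpha>)"
      by (rule has_vector_derivative_shift) (rule X2)
    then have "((\<lambda>\<beta>. X p \<beta>) has_vector_derivative X2 p (\<alpha> + 1)) (at \<alpha>)"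
      by (simp only: X_per)
    then have "X2 p (\<alpha> + 1) = X2 p \<alpha>" by (rule vector_derivative_unique_at[OF _ X2])
    then show ?thesis by (simp add: N X_per)
  qed
  note C1X = C1(1)[unfolded X1]
  have C1N: "C1_partials (surface_normal f X)
     (\<lambda>p \<alpha>. cross3 (X1 p \<alpha>) (X21 p \<alpha>) + cross3 (X11 p \<alpha>) (X2 p \<alpha>))
     (\<lambda>p \<alpha>. cross3 (X1 p \<alpha>) (X22 p \<alpha>) + cross3 (X12 p \<alpha>) (X2 p \<alpha>))"
  proof -
    have "surface_normal f X = (\<lambda>p \<alpha>. cross3 (X1 p \<alpha>) (X2 p \<alpha>))"
      by (simp add: fun_eq_iff N X1)
    then show ?thesis using C1_partials_cross3[OF C1(2,3)] by simp
  qed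
  note U = unstable_manifold_facts[of a \<Omega> f, OF assms(7,10)] and S = stable_manifold_facts[of b \<Omega> f, OF assms(8,11)]
  have bij: "bij_betw (case_prod X) {(p, \<alpha>). \<alpha> \<in> {0..<1}} \<Gamma>" using assms(23) by simp
  have nz: "cross3 (f (X p \<alpha>)) (X2 p \<alpha>) \<noteq> 0" for p \<alpha> using assms(27)[of p \<alpha>] by (simp add: N)
  have div: "trace (matrix (blinfun_apply (f' x))) = 0" if "x \<in> \<Omega>" for x
    using assms(33)[OF that] frechet_derivative_at[OF f'(1)[OF that]] by (simp add: divergence_def jacobian_def)
  \<comment> \<open>Eigenvalues with nonzero real part are nonzero, which is all that the
    determinant argument asks for.\<close>
  have surj_a: "surj (blinfun_apply (f' a))"
    using assms(12) saddle_spectrum_uminus_surj(1)[OF f'(1)[OF assms(7)]] by (metis less_irrefl zero_complex.sel(1))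
  have surj_b: "surj (blinfun_apply (- f' b))"
    using assms(13) saddle_spectrum_uminus_surj(2)[OF f'(1)[OF assms(8)]] by (metis less_irrefl zero_complex.sel(1))
  have end_a: "saddle_end \<Omega> (\<Gamma> \<union> {a, b}) f f' a b X X2"
    by (rule heteroclinic_saddle_end[OF assms(1) f' assms(14) U(1) assms(16) U(2) assms(8,11,9,19) X_per bij C1X
        assms(25,26) nz div surj_a])
  \<comment> \<open>For \<open>-f\<close> the stable manifold of \<open>b\<close> is the surface
    left in backward time. The reversed field is again divergence-free, and reversing
    \<open>p\<close> preserves the bijection of the parametrization.\<close>
  have "saddle_end \<Omega> (\<Gamma> \<union> {b, a}) (\<lambda>x. - f x) (\<lambda>x. - f' x) b a (\<lambda>p. X (- p)) (\<lambda>p. X2 (- p))"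
  proof (rule heteroclinic_saddle_end[OF assms(1) _ _ assms(15) S(1) assms(17) S(2) assms(7)])
    show "((\<lambda>x. - f x) has_derivative blinfun_apply (- f' x)) (at x)" if "x \<in> \<Omega>" for x
      using has_derivative_minus[OF f'(1)[OF that]] by (simp add: uminus_blinfun.rep_eq)
    show "continuous_on \<Omega> (\<lambda>x. - f' x)" using f'(2) by (rule continuous_on_minus)
    show "C1_partials (\<lambda>p. X (- p)) (\<lambda>p \<alpha>. - f (X (- p) \<alpha>)) (\<lambda>p. X2 (- p))"
      by (rule C1_partials_reverse_time[OF C1X])
    show "((\<lambda>p. X (- p) \<alpha>) \<longlongrightarrow> b) at_bot" for \<alpha>
      by (rule filterlim_compose[OF assms(26) filterlim_uminus_at_top_at_bot])
    show "((\<lambda>p. X (- p) \<alpha>) \<longlongrightarrow> a) at_top" for \<alpha>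
      by (rule filterlim_compose[OF assms(25) filterlim_uminus_at_bot_at_top])
    show "trace (matrix (blinfun_apply (- f' x))) = 0" if "x \<in> \<Omega>" for x
      using div[OF that] by (simp add: trace_def matrix_def uminus_blinfun.rep_eq sum_negf)
    have "bij_betw (\<lambda>(p, \<alpha>). (- p, \<alpha>)) {(p, \<alpha>). \<alpha> \<in> {0..<1}} {(p :: real, \<alpha> :: real). \<alpha> \<in> {0..<1}}"
      by (rule bij_betwI[where g = "\<lambda>(p, \<alpha>). (- p, \<alpha>)"]) auto
    from bij_betw_trans[OF this bij]
    show "bij_betw (\<lambda>(p, \<alpha>). X (- p) \<alpha>) {(p, \<alpha>). \<alpha> \<in> {0..<1}} \<Gamma>"
      by (simp add: o_def case_prod_unfold)
    show "compact (\<Gamma> \<union> {b, a})" using assms(19) by (simp add: insert_commute)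
    show "- f a = 0" "b \<noteq> a" using assms(9,10) by simp_all
    show "cross3 (- f (X (- p) \<alpha>)) (X2 (- p) \<alpha>) \<noteq> 0" for p \<alpha> using nz by simp
  qed (rule X_per surj_b)+
  then have end_b: "saddle_end \<Omega> (\<Gamma> \<union> {a, b}) (\<lambda>x. - f x) (\<lambda>x. - f' x) b a (\<lambda>p. X (- p)) (\<lambda>p. X2 (- p))"
    by (simp add: insert_commute)
  obtain C c where c: "c > 0" and decay: "\<And>p \<alpha>. norm (cross3 (f (X p \<alpha>)) (X2 p \<alpha>)) \<le> C * exp (- c * \<bar>p\<bar>)"
    by (rule normal_exponential_decay[OF end_a end_b]) (rule that, assumption+)
  have gt: "continuous_on \<Omega> gt"
  proof -
    \<comment> \<open>At this time the cosine equals 1, so \<open>gt\<close> is a time slice of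
      \<open>g\<close> and inherits its continuity.\<close>
    have "gt x = g x (- \<phi> / \<omega>)" if "x \<in> \<Omega>" for x
      using assms(29) assms(30)[OF that, of "- \<phi> / \<omega>"] by simp
    then show ?thesis
      using C2_on_imp_continuous_on[OF assms(4)] by (simp cong: continuous_on_cong)
  qed
  show "(\<lambda>\<epsilon>. measure lebesgue (lobe f g X \<omega> \<phi> \<theta> t k \<epsilon>) -
          2 * \<epsilon> / \<omega> * (LINT \<alpha>:{0..1}|lborel. norm (fourier (melnikov_amplitude f gt X \<alpha>) \<omega>)))
      \<in> O[at_right 0](\<lambda>\<epsilon>. \<epsilon>\<^sup>2)"
    by (rule lobe_volume[OF C1X C1N N assms(27) N_per X_per bij_betw_imp_inj_on[OF bij] saddle_end.X_in_dom[OF end_a] c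
        decay[folded N] gt assms(31,30,29,35,36)])
qed

end
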